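(* Let $n\ge 2$, $1\le k\le n-1$ and $m\ge 1$ be integers, and let $M$ be a smooth $n$-dimensional manifold. Let $E_m=M\times\mathbb{R}^m\to M$ be the trivial bundle, let $X$ be the total space of $\bigwedge^kT^*M\otimes E_m$, let $\Theta$ be the canonical $\mathbb{R}^m$-valued $k$-form on $X$, and let $\Omega=d\Theta$. Suppose $\omega$ is an $\mathbb{R}^m$-valued $k$-plectic form on $M$, i.e. $$\omega=\begin{pmatrix}\omega_1\\ \vdots\\ \omega_m\end{pmatrix}$$ where for each $i\in\{1,\dots,m\}$, $\omega_i$ is a closed $(k+1)$-form on $M$, and $\omega$ is nondegenerate. Then for every $x\in M$ there exist a neighborhood $U$ of $x$ in $M$ and a smooth embedding $f:U\to X$ such that $\omega|_U=f^*\Omega$.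
   Context: An $\mathbb{R}^m$-valued $(k+1)$-form $\omega$ on a manifold $Y$ (a smooth section of $\bigwedge^{k+1}T^*Y\otimes E_m$ with $E_m=Y\times\mathbb{R}^m$) is identified with the $m$-tuple of its component real-valued $(k+1)$-forms; the exterior derivative $d$ and pullbacks act componentwise. It is nondegenerate if for every $y\in Y$: whenever $v\in T_yY$ satisfies $\omega_y(v,u_1,\dots,u_k)=0\in\mathbb{R}^m$ for all $u_1,\dots,u_k\in T_yY$, then $v=0$. An $\mathbb{R}^m$-valued $k$-plectic form on $Y$ is a nondegenerate $\mathbb{R}^m$-valued $(k+1)$-form $\omega$ with $d\omega=0$. Let $\pi:X=\bigwedge^kT^*M\otimes E_m\to M$ be the bundle projection. A point of $X$ is a pair $(x,\eta)$ with $x\in M$ and $\eta$ in the fiber over $x$, i.e. $\eta$ is an alternating $k$-linear map on $T_xM$ with values in $\mathbb{R}^m$. The canonical $\mathbb{R}^m$-valued $k$-form $\Theta$ on $X$ is defined by $$\Theta_{(x,\eta)}(v_1,\dots,v_k)=\eta(\pi_*(v_1),\dots,\pi_*(v_k)),\qquad v_1,\dots,v_k\in T_{(x,\eta)}X.$$ *)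

theory Defs
  imports "HOL-Analysis.Analysis" "HOL-Library.Function_Algebras"
begin

section \<open>Alternating multilinear maps\<close>

instantiation "fun" :: (type, real_vector) real_vector
begin

definition scaleR_fun_def: "a *\<^sub>R f = (\<lambda>x. a *\<^sub>R f x)"

instance
  by standard (simp_all add: scaleR_fun_def fun_eq_iff scaleR_add_right scaleR_add_left)

end

text \<open>A \<open>k\<close>-linear map on a linear subspace \<open>V\<close> takes a list of \<open>k\<close> vectors of \<open>V\<close>; by convention it
  is 0 on all other lists, so that equality of such maps is equality of HOL functions.\<close>

definition restr :: "nat \<Rightarrow> 'w set \<Rightarrow> ('w list \<Rightarrow> 'v::zero) \<Rightarrow> 'w list \<Rightarrow> 'v" where
  "restr k V h = (\<lambda>vs. if length vs = k \<and> set vs \<subseteq> V then h vs else 0)"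

definition alt_maps :: "nat \<Rightarrow> 'w::real_vector set \<Rightarrow> ('w list \<Rightarrow> 'v::real_vector) set" where
  "alt_maps k V = {h.
     (\<forall>vs. \<not> (length vs = k \<and> set vs \<subseteq> V) \<longrightarrow> h vs = 0) \<and>
     (\<forall>vs i u w a b. length vs = k \<and> set vs \<subseteq> V \<and> i < k \<and> u \<in> V \<and> w \<in> V \<longrightarrow>
        h (vs[i := a *\<^sub>R u + b *\<^sub>R w]) = a *\<^sub>R h (vs[i := u]) + b *\<^sub>R h (vs[i := w])) \<and>
     (\<forall>vs i j. length vs = k \<and> set vs \<subseteq> V \<and> i < j \<and> j < k \<and> vs ! i = vs ! j \<longrightarrow> h vs = 0)}"

text \<open>The finite-dimensional vector space of alternating \<open>k\<close>-linear maps from \<open>\<real>\<^sup>n\<close> to \<open>\<real>\<^sup>m\<close>, where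
  \<open>k = CARD('k)\<close>.\<close>

typedef ('n, 'm, 'k) alt_form =
  "alt_maps CARD('k) UNIV :: ((real^'n) list \<Rightarrow> real^'m) set"
  by (rule exI[of _ 0]) (simp add: alt_maps_def)

text \<open>Its inner product is the Euclidean one on the family of values on \<open>k\<close>-tuples of standard basis
  vectors. The vector space is finite-dimensional, so the induced topology and notion of smoothness
  do not depend on this choice.\<close>

definition index_list :: "'k::finite list" where
  "index_list = (SOME ks. distinct ks \<and> set ks = UNIV)"

definition alt_coeffs :: "('n::finite, 'm::finite, 'k::finite) alt_form \<Rightarrow> real^'m^('k \<Rightarrow> 'n)" where
  "alt_coeffs h = (\<chi> s. Rep_alt_form h (map (\<lambda>i. axis (s i) 1) (index_list :: 'k list)))"

lemma index_list: "distinct (index_list :: 'k::finite list)" "set (index_list :: 'k list) = UNIV"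
proof -
  have "\<exists>ks :: 'k list. distinct ks \<and> set ks = UNIV"
    by (metis finite_distinct_list finite)
  from someI_ex[OF this]
  show "distinct (index_list :: 'k::finite list)" "set (index_list :: 'k list) = UNIV"
    unfolding index_list_def by auto
qed

lemma length_index_list: "length (index_list :: 'k::finite list) = CARD('k)"
  by (metis index_list distinct_card)

lemma alt_maps_lincomb:
  assumes "h \<in> alt_maps k V" "g \<in> alt_maps k V"
  shows "a *\<^sub>R h + b *\<^sub>R g \<in> alt_maps k V"
proof -
  have "(a *\<^sub>R h + b *\<^sub>R g) (vs[i := r *\<^sub>R u + s *\<^sub>R w])
      = r *\<^sub>R (a *\<^sub>R h + b *\<^sub>R g) (vs[i := u]) + s *\<^sub>R (a *\<^sub>R h + b *\<^sub>R g) (vs[i := w])"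
    if "length vs = k \<and> set vs \<subseteq> V \<and> i < k \<and> u \<in> V \<and> w \<in> V" for vs i u w r s
  proof -
    have "h (vs[i := r *\<^sub>R u + s *\<^sub>R w]) = r *\<^sub>R h (vs[i := u]) + s *\<^sub>R h (vs[i := w])"
      "g (vs[i := r *\<^sub>R u + s *\<^sub>R w]) = r *\<^sub>R g (vs[i := u]) + s *\<^sub>R g (vs[i := w])"
      using assms that unfolding alt_maps_def mem_Collect_eq by metis+
    then show ?thesis
      by (simp add: scaleR_fun_def algebra_simps)
  qed
  moreover have "(a *\<^sub>R h + b *\<^sub>R g) vs = 0" if "h vs = 0" "g vs = 0" for vs
    using that by (simp add: scaleR_fun_def)
  ultimately show ?thesis
    using assms unfolding alt_maps_def by simp
qed

lemma alt_maps_UNIV_linear: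
  assumes "h \<in> alt_maps k UNIV" "length vs = k" "i < k"
  shows "linear (\<lambda>u. h (vs[i := u]))"
proof -
  have *: "h (vs[i := a *\<^sub>R u + b *\<^sub>R w]) = a *\<^sub>R h (vs[i := u]) + b *\<^sub>R h (vs[i := w])" for a u b w
    using assms unfolding alt_maps_def by blast
  show ?thesis
  proof (rule linearI)
    show "h (vs[i := u + w]) = h (vs[i := u]) + h (vs[i := w])" for u w
      using *[of 1 u 1 w] by simp
    show "h (vs[i := r *\<^sub>R u]) = r *\<^sub>R h (vs[i := u])" for r u
      using *[of r u 0 u] by simp
  qed
qed

lemma alt_maps_zero_if_zero_on_basis:
  fixes h :: "(real^'n) list \<Rightarrow> real^'m"
  assumes h: "h \<in> alt_maps k UNIV"
    and z: "\<And>js. length js = k \<Longrightarrow> h (map (\<lambda>j. axis j 1) js) = 0"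
  shows "h = 0"
proof -
  have "h vs = 0" if "length vs = k" "i \<le> k" "\<forall>l. i \<le> l \<and> l < k \<longrightarrow> (\<exists>j. vs ! l = axis j 1)" for i vs
    using that
  proof (induction i arbitrary: vs)
    case 0
    then have "\<forall>l. \<exists>j. l < k \<longrightarrow> vs ! l = axis j 1" by blast
    then obtain J where J: "\<And>l. l < k \<Longrightarrow> vs ! l = axis (J l) 1" by metis
    have "vs = map (\<lambda>j. axis j 1) (map J [0..<k])"
      using 0(1) J by (intro nth_equalityI) auto
    then show ?case using z[of "map J [0..<k]"] by simp
  next
    case (Suc i)
    have lin: "linear (\<lambda>u. h (vs[i := u]))"
      using alt_maps_UNIV_linear[OF h] Suc.prems by simp
    have "vs ! i = (\<Sum>j\<in>UNIV. (vs ! i $ j) *\<^sub>R axis j 1)"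
      using basis_expansion[of "vs ! i"] by (simp add: scalar_mult_eq_scaleR)
    then have "h vs = h (vs[i := (\<Sum>j\<in>UNIV. (vs ! i $ j) *\<^sub>R axis j 1)])"
      by (metis list_update_id)
    also have "\<dots> = (\<Sum>j\<in>UNIV. h (vs[i := (vs ! i $ j) *\<^sub>R axis j 1]))"
      using linear_sum[OF lin] by simp
    also have "\<dots> = (\<Sum>j\<in>UNIV. (vs ! i $ j) *\<^sub>R h (vs[i := axis j 1]))"
      using linear_cmul[OF lin] by simp
    also have "\<dots> = 0"
    proof (intro sum.neutral ballI)
      fix j
      have "\<exists>j'. vs[i := axis j 1] ! l = axis j' 1" if "i \<le> l" "l < k" for l
        using Suc.prems that by (cases "l = i") auto
      then have "h (vs[i := axis j 1]) = 0"
        using Suc.IH[of "vs[i := axis j 1]"] Suc.prems by simp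
      then show "(vs ! i $ j) *\<^sub>R h (vs[i := axis j 1]) = 0" by simp
    qed
    finally show ?case .
  qed
  then have "h vs = 0" if "length vs = k" for vs
    using that by (metis le_refl not_le)
  moreover have "h vs = 0" if "length vs \<noteq> k" for vs
    using h that unfolding alt_maps_def by blast
  ultimately show ?thesis by (auto simp: fun_eq_iff)
qed

instantiation alt_form :: (finite, finite, finite) real_inner
begin

definition "0 = Abs_alt_form 0"
definition "h + g = Abs_alt_form (Rep_alt_form h + Rep_alt_form g)"
definition "- h = Abs_alt_form (- Rep_alt_form h)"
definition "h - g = Abs_alt_form (Rep_alt_form h - Rep_alt_form g)"
definition "a *\<^sub>R h = Abs_alt_form (a *\<^sub>R Rep_alt_form h)"
definition "inner h g = inner (alt_coeffs h) (alt_coeffs g)"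
definition norm_alt_form_def: "norm (h :: ('a, 'b, 'c) alt_form) = sqrt (inner h h)"
definition dist_alt_form_def: "dist h g = norm (h - g :: ('a, 'b, 'c) alt_form)"
definition sgn_alt_form_def: "sgn h = inverse (norm h) *\<^sub>R (h :: ('a, 'b, 'c) alt_form)"
definition uniformity_alt_form_def:
  "(uniformity :: (('a, 'b, 'c) alt_form \<times> ('a, 'b, 'c) alt_form) filter) =
     (INF e\<in>{0<..}. principal {(x, y). dist x y < e})"
definition open_alt_form_def:
  "open (U :: ('a, 'b, 'c) alt_form set) \<longleftrightarrow>
     (\<forall>x\<in>U. eventually (\<lambda>(x', y). x' = x \<longrightarrow> y \<in> U) uniformity)"

instance
proof
  have zero_mem: "0 \<in> alt_maps CARD('c) (UNIV :: (real^'a) set)"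
    by (simp add: alt_maps_def)
  have Rep_zero: "Rep_alt_form (0 :: ('a, 'b, 'c) alt_form) = 0"
    unfolding zero_alt_form_def by (rule Abs_alt_form_inverse[OF zero_mem])
  have Rep_scale: "Rep_alt_form (r *\<^sub>R h) = r *\<^sub>R Rep_alt_form h" for r and h :: "('a, 'b, 'c) alt_form"
    unfolding scaleR_alt_form_def
    using alt_maps_lincomb[OF Rep_alt_form[of h] Rep_alt_form[of h], of r 0]
    by (simp add: Abs_alt_form_inverse)
  have Rep_plus: "Rep_alt_form (h + g) = Rep_alt_form h + Rep_alt_form g"
    for h g :: "('a, 'b, 'c) alt_form"
    unfolding plus_alt_form_def
    using alt_maps_lincomb[OF Rep_alt_form[of h] Rep_alt_form[of g], of 1 1]
    by (simp add: Abs_alt_form_inverse)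
  have Rep_minus: "Rep_alt_form (- h) = - Rep_alt_form h" for h :: "('a, 'b, 'c) alt_form"
    unfolding uminus_alt_form_def
    using alt_maps_lincomb[OF Rep_alt_form[of h] Rep_alt_form[of h], of "-1" 0]
    by (simp add: Abs_alt_form_inverse)
  have Rep_diff: "Rep_alt_form (h - g) = Rep_alt_form h - Rep_alt_form g"
    for h g :: "('a, 'b, 'c) alt_form"
    unfolding minus_alt_form_def
    using alt_maps_lincomb[OF Rep_alt_form[of h] Rep_alt_form[of g], of 1 "-1"]
    by (simp add: Abs_alt_form_inverse)
  note Rep = Rep_zero Rep_scale Rep_plus Rep_minus Rep_diff
  have c_plus: "alt_coeffs (h + g) = alt_coeffs h + alt_coeffs g" for h g :: "('a, 'b, 'c) alt_form"
    unfolding alt_coeffs_def by (simp add: Rep vec_eq_iff)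
  have c_scale: "alt_coeffs (r *\<^sub>R h) = r *\<^sub>R alt_coeffs h" for r and h :: "('a, 'b, 'c) alt_form"
    unfolding alt_coeffs_def by (simp add: Rep vec_eq_iff scaleR_fun_def)
  have c_zero: "alt_coeffs h = 0 \<longleftrightarrow> h = 0" for h :: "('a, 'b, 'c) alt_form"
  proof
    assume 0: "alt_coeffs h = 0"
    have "Rep_alt_form h = 0"
    proof (rule alt_maps_zero_if_zero_on_basis[OF Rep_alt_form])
      fix js :: "'a list" assume len: "length js = CARD('c)"
      let ?ks = "index_list :: 'c list"
      define s where "s i = js ! (THE l. l < CARD('c) \<and> ?ks ! l = i)" for i
      have "s (?ks ! l) = js ! l" if "l < CARD('c)" for l
      proof -
        have "(THE l'. l' < CARD('c) \<and> ?ks ! l' = ?ks ! l) = l"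
          using that index_list(1) length_index_list[where 'k='c]
          by (intro the_equality) (auto dest: nth_eq_iff_index_eq[THEN iffD1, rotated 3])
        then show ?thesis unfolding s_def by simp
      qed
      then have "map (\<lambda>j. axis j 1) js = map (\<lambda>i. axis (s i) 1 :: real^'a) ?ks"
        using len length_index_list[where 'k='c] by (intro nth_equalityI) auto
      then show "Rep_alt_form h (map (\<lambda>j. axis j 1) js) = 0"
        using 0 unfolding alt_coeffs_def by (simp add: vec_eq_iff)
    qed
    then show "h = 0" by (metis Rep_alt_form_inject Rep_zero)
  next
    assume "h = 0"
    then show "alt_coeffs h = 0"
      unfolding alt_coeffs_def by (simp add: Rep vec_eq_iff)
  qed
  fix x y z :: "('a, 'b, 'c) alt_form" and a b :: real
  show "x + y + z = x + (y + z)" "x + y = y + x" "0 + x = x" "- x + x = 0" "x - y = x + - y"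
    "a *\<^sub>R (x + y) = a *\<^sub>R x + a *\<^sub>R y" "(a + b) *\<^sub>R x = a *\<^sub>R x + b *\<^sub>R x"
    "a *\<^sub>R b *\<^sub>R x = (a * b) *\<^sub>R x" "1 *\<^sub>R x = x"
    by (simp_all add: Rep_alt_form_inject[symmetric] Rep algebra_simps)
  show "inner x y = inner y x"
    by (simp add: inner_alt_form_def inner_commute)
  show "inner (x + y) z = inner x z + inner y z"
    by (simp add: inner_alt_form_def c_plus inner_add_left)
  show "inner (a *\<^sub>R x) y = a * inner x y"
    by (simp add: inner_alt_form_def c_scale)
  show "0 \<le> inner x x"
    by (simp add: inner_alt_form_def)
  show "inner x x = 0 \<longleftrightarrow> x = 0"
    by (simp add: inner_alt_form_def c_zero)
  show "norm x = sqrt (inner x x)" by (rule norm_alt_form_def)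
  show "dist x y = norm (x - y)" by (rule dist_alt_form_def)
  show "sgn x = inverse (norm x) *\<^sub>R x" by (rule sgn_alt_form_def)
  show "uniformity = (INF e\<in>{0<..}. principal {(x, y :: ('a, 'b, 'c) alt_form). dist x y < e})"
    by (rule uniformity_alt_form_def)
  show "open U \<longleftrightarrow> (\<forall>x\<in>U. \<forall>\<^sub>F (x', y) in uniformity. x' = x \<longrightarrow> y \<in> U)"
    for U :: "('a, 'b, 'c) alt_form set"
    by (rule open_alt_form_def)
qed

end


section \<open>Smooth manifolds\<close>

text \<open>The two notions below are meant for open sets \<open>S\<close> and finite-dimensional spaces.\<close>

primrec Ck_on :: "nat \<Rightarrow> ('e::real_normed_vector \<Rightarrow> 'f::real_normed_vector) \<Rightarrow> 'e set \<Rightarrow> bool" where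
  "Ck_on 0 f S \<longleftrightarrow> continuous_on S f"
| "Ck_on (Suc j) f S \<longleftrightarrow> (\<forall>x\<in>S. f differentiable at x) \<and>
     (\<forall>v. Ck_on j (\<lambda>x. frechet_derivative f (at x) v) S)"

definition smooth_on :: "'e::real_normed_vector set \<Rightarrow> ('e \<Rightarrow> 'f::real_normed_vector) \<Rightarrow> bool" where
  "smooth_on S f \<longleftrightarrow> (\<forall>j. Ck_on j f S)"

text \<open>A chart is a pair of its domain and its coordinate map; the values of the coordinate map outside
  the domain are irrelevant.\<close>

type_synonym ('a, 'e) chart = "'a set \<times> ('a \<Rightarrow> 'e)"

definition chart_inv :: "('a, 'e) chart \<Rightarrow> 'e \<Rightarrow> 'a" where
  "chart_inv c = inv_into (fst c) (snd c)"

definition coord_map :: "('a, 'e) chart \<Rightarrow> ('b, 'f) chart \<Rightarrow> ('a \<Rightarrow> 'b) \<Rightarrow> 'e \<Rightarrow> 'f" where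
  "coord_map c d f = snd d \<circ> f \<circ> chart_inv c"

text \<open>The smooth structure of a manifold is given by an arbitrary smooth atlas \<open>A\<close> (not necessarily
  maximal). The dimension is that of the model space \<open>'e\<close>.\<close>

definition smooth_manifold :: "'a topology \<Rightarrow> ('a, 'e::real_normed_vector) chart set \<Rightarrow> bool" where
  "smooth_manifold T A \<longleftrightarrow>
     Hausdorff_space T \<and> second_countable T \<and>
     (\<Union>c\<in>A. fst c) = topspace T \<and>
     (\<forall>c\<in>A. openin T (fst c) \<and> open (snd c ` fst c) \<and>
        homeomorphic_map (subtopology T (fst c)) (top_of_set (snd c ` fst c)) (snd c)) \<and>
     (\<forall>c\<in>A. \<forall>d\<in>A. smooth_on (snd c ` (fst c \<inter> fst d)) (coord_map c d id))"

definition charts_at :: "('a, 'e) chart set \<Rightarrow> 'a \<Rightarrow> ('a, 'e) chart set" where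
  "charts_at A p = {c \<in> A. p \<in> fst c}"

definition chart_at :: "('a, 'e) chart set \<Rightarrow> 'a \<Rightarrow> ('a, 'e) chart" where
  "chart_at A p = (SOME c. c \<in> charts_at A p)"

text \<open>A tangent vector at \<open>p\<close> is the family of its coordinate vectors in all charts around \<open>p\<close>, related
  by the derivatives of the coordinate changes (and 0 at all other charts).\<close>

type_synonym ('a, 'e) tangent = "('a, 'e) chart \<Rightarrow> 'e"

definition tangent_space ::
    "('a, 'e::real_normed_vector) chart set \<Rightarrow> 'a \<Rightarrow> ('a, 'e) tangent set" where
  "tangent_space A p = {v.
     (\<forall>c\<in>charts_at A p. \<forall>d\<in>charts_at A p.
        v d = frechet_derivative (coord_map c d id) (at (snd c p)) (v c)) \<and>
     (\<forall>c. c \<notin> charts_at A p \<longrightarrow> v c = 0)}"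

text \<open>The tangent vector at \<open>p\<close> whose coordinate vector in the chart \<open>c\<close> is \<open>u\<close>.\<close>

definition chart_vec ::
    "('a, 'e::real_normed_vector) chart set \<Rightarrow> ('a, 'e) chart \<Rightarrow> 'a \<Rightarrow> 'e \<Rightarrow> ('a, 'e) tangent" where
  "chart_vec A c p u = (\<lambda>d. if d \<in> charts_at A p
     then frechet_derivative (coord_map c d id) (at (snd c p)) u else 0)"

text \<open>The differential of \<open>f\<close> at \<open>p\<close>; by the chain rule it does not depend on the chart chosen at \<open>p\<close>.\<close>

definition pushforward ::
    "('a, 'e::real_normed_vector) chart set \<Rightarrow> ('b, 'f::real_normed_vector) chart set \<Rightarrow>
     ('a \<Rightarrow> 'b) \<Rightarrow> 'a \<Rightarrow> ('a, 'e) tangent \<Rightarrow> ('b, 'f) tangent" where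
  "pushforward A B f p v = (\<lambda>d. if d \<in> charts_at B (f p)
     then frechet_derivative (coord_map (chart_at A p) d f) (at (snd (chart_at A p) p)) (v (chart_at A p))
     else 0)"

text \<open>In the following two definitions the source is the open subset \<open>U\<close> of the manifold \<open>(T, A)\<close>,
  whose tangent spaces are identified with those of \<open>(T, A)\<close>.\<close>

definition smooth_map_on ::
    "'a topology \<Rightarrow> ('a, 'e::real_normed_vector) chart set \<Rightarrow> 'a set \<Rightarrow>
     'b topology \<Rightarrow> ('b, 'f::real_normed_vector) chart set \<Rightarrow> ('a \<Rightarrow> 'b) \<Rightarrow> bool" where
  "smooth_map_on T A U T' B f \<longleftrightarrow>
     continuous_map (subtopology T U) T' f \<and>
     (\<forall>c\<in>A. \<forall>d\<in>B. smooth_on (snd c ` {p \<in> U \<inter> fst c. f p \<in> fst d}) (coord_map c d f))"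

definition smooth_embedding_on ::
    "'a topology \<Rightarrow> ('a, 'e::real_normed_vector) chart set \<Rightarrow> 'a set \<Rightarrow>
     'b topology \<Rightarrow> ('b, 'f::real_normed_vector) chart set \<Rightarrow> ('a \<Rightarrow> 'b) \<Rightarrow> bool" where
  "smooth_embedding_on T A U T' B f \<longleftrightarrow>
     smooth_map_on T A U T' B f \<and>
     (\<forall>p\<in>U. inj_on (pushforward A B f p) (tangent_space A p)) \<and>
     embedding_map (subtopology T U) T' f"


section \<open>Differential forms\<close>

definition local_rep ::
    "('a, 'e::real_normed_vector) chart set \<Rightarrow> ('a, 'e) chart \<Rightarrow> ('a \<Rightarrow> ('a, 'e) tangent list \<Rightarrow> real) \<Rightarrow>
     'e list \<Rightarrow> 'e \<Rightarrow> real" where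
  "local_rep A c \<alpha> us = (\<lambda>y. \<alpha> (chart_inv c y) (map (chart_vec A c (chart_inv c y)) us))"

definition diff_form ::
    "'a topology \<Rightarrow> ('a, 'e::real_normed_vector) chart set \<Rightarrow> nat \<Rightarrow>
     ('a \<Rightarrow> ('a, 'e) tangent list \<Rightarrow> real) \<Rightarrow> bool" where
  "diff_form T A k \<alpha> \<longleftrightarrow>
     (\<forall>p\<in>topspace T. \<alpha> p \<in> alt_maps k (tangent_space A p)) \<and>
     (\<forall>c\<in>A. \<forall>us. length us = k \<longrightarrow> smooth_on (snd c ` fst c) (local_rep A c \<alpha> us))"

text \<open>The exterior derivative of a \<open>k\<close>-form, given in a chart around \<open>p\<close> by
  \<open>(d\<alpha>)(u\<^sub>0, \<dots>, u\<^sub>k) = \<Sum>\<^sub>i (-1)\<^sup>i D\<alpha>(u\<^sub>i)(u\<^sub>0, \<dots>, u\<^sub>i\<^sub>-\<^sub>1, u\<^sub>i\<^sub>+\<^sub>1, \<dots>, u\<^sub>k)\<close>. For smooth forms this does not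
  depend on the chart.\<close>

definition ext_deriv ::
    "('a, 'e::real_normed_vector) chart set \<Rightarrow> nat \<Rightarrow> ('a \<Rightarrow> ('a, 'e) tangent list \<Rightarrow> real) \<Rightarrow>
     'a \<Rightarrow> ('a, 'e) tangent list \<Rightarrow> real" where
  "ext_deriv A k \<alpha> p = restr (Suc k) (tangent_space A p) (\<lambda>vs.
     let c = chart_at A p; us = map (\<lambda>v. v c) vs
     in \<Sum>i\<le>k. (-1) ^ i *
          frechet_derivative (local_rep A c \<alpha> (take i us @ drop (Suc i) us)) (at (snd c p)) (us ! i))"

definition closed_form ::
    "'a topology \<Rightarrow> ('a, 'e::real_normed_vector) chart set \<Rightarrow> nat \<Rightarrow>
     ('a \<Rightarrow> ('a, 'e) tangent list \<Rightarrow> real) \<Rightarrow> bool" where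
  "closed_form T A k \<alpha> \<longleftrightarrow> (\<forall>p\<in>topspace T. ext_deriv A k \<alpha> p = 0)"

definition pullback_form ::
    "('a, 'e::real_normed_vector) chart set \<Rightarrow> ('b, 'f::real_normed_vector) chart set \<Rightarrow>
     ('a \<Rightarrow> 'b) \<Rightarrow> nat \<Rightarrow> ('b \<Rightarrow> ('b, 'f) tangent list \<Rightarrow> 'v::zero) \<Rightarrow>
     'a \<Rightarrow> ('a, 'e) tangent list \<Rightarrow> 'v" where
  "pullback_form A B f k \<beta> p =
     restr k (tangent_space A p) (\<lambda>vs. \<beta> (f p) (map (pushforward A B f p) vs))"

definition component :: "'m \<Rightarrow> ('a \<Rightarrow> 'w list \<Rightarrow> real^'m) \<Rightarrow> 'a \<Rightarrow> 'w list \<Rightarrow> real" where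
  "component i \<omega> = (\<lambda>p vs. \<omega> p vs $ i)"

definition vec_ext_deriv ::
    "('a, 'e::real_normed_vector) chart set \<Rightarrow> nat \<Rightarrow> ('a \<Rightarrow> ('a, 'e) tangent list \<Rightarrow> real^'m) \<Rightarrow>
     'a \<Rightarrow> ('a, 'e) tangent list \<Rightarrow> real^'m" where
  "vec_ext_deriv A k \<omega> = (\<lambda>p vs. \<chi> i. ext_deriv A k (component i \<omega>) p vs)"

definition nondegenerate ::
    "'a topology \<Rightarrow> ('a, 'e::real_normed_vector) chart set \<Rightarrow> nat \<Rightarrow>
     ('a \<Rightarrow> ('a, 'e) tangent list \<Rightarrow> real^'m) \<Rightarrow> bool" where
  "nondegenerate T A k \<omega> \<longleftrightarrow>
     (\<forall>p\<in>topspace T. \<forall>v\<in>tangent_space A p.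
        (\<forall>us. length us = k \<and> set us \<subseteq> tangent_space A p \<longrightarrow> \<omega> p (v # us) = 0) \<longrightarrow> v = 0)"

text \<open>Note that a \<open>k\<close>-plectic form has degree \<open>k + 1\<close>.\<close>

definition plectic_form ::
    "'a topology \<Rightarrow> ('a, 'e::real_normed_vector) chart set \<Rightarrow> nat \<Rightarrow>
     ('a \<Rightarrow> ('a, 'e) tangent list \<Rightarrow> real^'m) \<Rightarrow> bool" where
  "plectic_form T A k \<omega> \<longleftrightarrow>
     (\<forall>i. diff_form T A (Suc k) (component i \<omega>) \<and> closed_form T A (Suc k) (component i \<omega>)) \<and>
     nondegenerate T A k \<omega>"


section \<open>The bundle of vector-valued alternating forms\<close>

text \<open>Throughout this section \<open>k = CARD('k)\<close>, and \<open>(T, A)\<close> is a manifold modelled on \<open>\<real>\<^sup>n\<close>.\<close>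

type_synonym ('a, 'n, 'm) bundle_point = "'a \<times> (('a, real^'n) tangent list \<Rightarrow> real^'m)"

definition form_bundle ::
    "nat \<Rightarrow> ('a, real^'n) chart set \<Rightarrow> 'a set \<Rightarrow> ('a, 'n::finite, 'm::finite) bundle_point set" where
  "form_bundle k A U = {(p, \<eta>). p \<in> U \<and> \<eta> \<in> alt_maps k (tangent_space A p)}"

text \<open>The chart of the bundle over a chart \<open>c\<close> of the base expresses \<open>\<eta>\<close> in the coordinates given by \<open>c\<close>.\<close>

definition bundle_chart ::
    "'k::finite itself \<Rightarrow> ('a, real^'n) chart set \<Rightarrow> ('a, real^'n) chart \<Rightarrow>
     (('a, 'n::finite, 'm::finite) bundle_point, (real^'n) \<times> ('n, 'm, 'k) alt_form) chart" where
  "bundle_chart K A c =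
     (form_bundle CARD('k) A (fst c),
      \<lambda>(p, \<eta>). (snd c p, Abs_alt_form (\<lambda>us. \<eta> (map (chart_vec A c p) us))))"

definition bundle_atlas ::
    "'k::finite itself \<Rightarrow> ('a, real^'n) chart set \<Rightarrow>
     (('a, 'n::finite, 'm::finite) bundle_point, (real^'n) \<times> ('n, 'm, 'k) alt_form) chart set" where
  "bundle_atlas K A = bundle_chart K A ` A"

text \<open>The coarsest topology in which the charts of the bundle are continuous with open domains. Its
  underlying set is the total space of the bundle, since \<open>open UNIV\<close>.\<close>

definition bundle_topology ::
    "'k::finite itself \<Rightarrow> ('a, real^'n) chart set \<Rightarrow>
     ('a, 'n::finite, 'm::finite) bundle_point topology" where
  "bundle_topology K A = topology_generated_by
     {{z \<in> fst c. snd c z \<in> W} | c W.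
        c \<in> (bundle_atlas K A ::
               (('a, 'n, 'm) bundle_point, (real^'n) \<times> ('n, 'm, 'k) alt_form) chart set) \<and> open W}"

definition canonical_form ::
    "'k::finite itself \<Rightarrow> ('a, real^'n) chart set \<Rightarrow> ('a, 'n::finite, 'm::finite) bundle_point \<Rightarrow>
     (('a, 'n, 'm) bundle_point, (real^'n) \<times> ('n, 'm, 'k) alt_form) tangent list \<Rightarrow> real^'m" where
  "canonical_form K A z = restr CARD('k) (tangent_space (bundle_atlas K A) z)
     (\<lambda>vs. snd z (map (pushforward (bundle_atlas K A) A fst z) vs))"

definition canonical_plectic_form ::
    "'k::finite itself \<Rightarrow> ('a, real^'n) chart set \<Rightarrow> ('a, 'n::finite, 'm::finite) bundle_point \<Rightarrow>
     (('a, 'n, 'm) bundle_point, (real^'n) \<times> ('n, 'm, 'k) alt_form) tangent list \<Rightarrow> real^'m" where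
  "canonical_plectic_form K A = vec_ext_deriv (bundle_atlas K A) CARD('k) (canonical_form K A)"

end

theory Submission
  imports Defs
begin

text \<open>By the Poincare lemma, \<open>\<omega> = d\<theta>\<close> near a given point for some \<open>\<real>\<^sup>m\<close>-valued \<open>k\<close>-form \<open>\<theta>\<close>.
  A \<open>k\<close>-form is the same as a section \<open>f\<close> of the bundle, and \<open>f\<^sup>* \<Theta> = \<theta>\<close> by definition of \<open>\<Theta>\<close>; hence
  \<open>f\<^sup>* \<Omega> = d (f\<^sup>* \<Theta>) = \<omega>\<close>. A section is an embedding, because the projection is a left inverse. The
  exterior derivative at a point is defined by an unspecified chart there, so everything rests on
  the naturality of \<open>d\<close> under changes of coordinates.\<close>

section \<open>Calculus of smooth functions\<close>

text \<open>Naturality of \<open>d\<close> is used only for transitions of the base, never for maps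
  into the total space. In a bundle chart the canonical form does not involve the base coordinate
  and is linear in the fibre coordinate, so its derivative along \<open>(u, g)\<close> merely
  evaluates \<open>g\<close>. Along a section, \<open>g\<close> is a derivative of the coordinate
  expression of \<theta>; hence the summands of \<open>d\<Theta>\<close> turn directly into those of
  \<open>d\<theta>\<close>, in whichever base chart underlies the unspecified chart of the bundle.
  Naturality is needed a second time: the Poincare lemma wants closedness in one chart over a whole
  ball, whereas the definition tests each point in a chart of its own. Identities between coordinate
  expressions hold only on images of chart domains and overlaps, the coordinate maps being arbitrary
  elsewhere; derivatives are therefore compared through open sets. For the total space it suffices
  that transitions are differentiable once, as tangent vectors and differentials involve no higher
  derivatives.\<close>

lemma frechet_derivative_eqI: "(f has_derivative f') (at x) \<Longrightarrow> frechet_derivative f (at x) = f'"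
  using frechet_derivative_at by metis

lemma Ck_on_subset: "Ck_on j f S \<Longrightarrow> S' \<subseteq> S \<Longrightarrow> Ck_on j f S'"
  by (induction j arbitrary: f) (auto intro: continuous_on_subset)

lemma differentiable_cong_open:
  assumes "open S" "x \<in> S" "\<And>y. y \<in> S \<Longrightarrow> f y = g y"
  shows "f differentiable at x \<longleftrightarrow> g differentiable at x"
  using assms unfolding differentiable_def
  by (metis has_derivative_transform_within_open)

lemma frechet_derivative_cong_open:
  assumes "open S" "x \<in> S" "\<And>y. y \<in> S \<Longrightarrow> f y = g y"
  shows "frechet_derivative f (at x) = frechet_derivative g (at x)"
proof -
  have "(f has_derivative f') (at x) \<longleftrightarrow> (g has_derivative f') (at x)" for f'
    using assms by (metis has_derivative_transform_within_open)
  then show ?thesis unfolding frechet_derivative_def by simp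
qed

lemma Ck_on_cong:
  assumes "open S" "\<And>y. y \<in> S \<Longrightarrow> f y = g y"
  shows "Ck_on j f S \<longleftrightarrow> Ck_on j g S"
  using assms(2)
proof (induction j arbitrary: f g)
  case 0 then show ?case by (auto intro: continuous_on_cong)
next
  case (Suc j)
  have "Ck_on j (\<lambda>x. frechet_derivative f (at x) v) S \<longleftrightarrow> Ck_on j (\<lambda>x. frechet_derivative g (at x) v) S" for v
    by (rule Suc.IH) (metis frechet_derivative_cong_open assms(1) Suc.prems)
  then show ?case
    using differentiable_cong_open[OF assms(1) _ Suc.prems] by auto
qed

lemma Ck_on_transform:
  "Ck_on j f S \<Longrightarrow> (\<And>y. y \<in> S \<Longrightarrow> f y = g y) \<Longrightarrow> open S \<Longrightarrow> Ck_on j g S"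
  using Ck_on_cong by blast

lemma Ck_on_Suc_imp: "Ck_on (Suc j) f S \<Longrightarrow> Ck_on j f S"
proof (induction j arbitrary: f)
  case 0
  then show ?case
    by (simp add: continuous_at_imp_continuous_on differentiable_imp_continuous_within)
next
  case (Suc j)
  then show ?case by (metis Ck_on.simps(2))
qed

lemma Ck_on_mono:
  assumes "Ck_on j f S" "i \<le> j"
  shows "Ck_on i f S"
  using assms(2,1) by (induction rule: inc_induct) (blast intro: Ck_on_Suc_imp)+

lemma Ck_on_const: "Ck_on j (\<lambda>x. c) S"
  by (induction j arbitrary: c) simp_all

lemma Ck_on_add:
  assumes "open S" "Ck_on j f S" "Ck_on j g S"
  shows "Ck_on j (\<lambda>x. f x + g x) S"
  using assms(2,3)
proof (induction j arbitrary: f g)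
  case 0 then show ?case by (auto intro: continuous_intros)
next
  case (Suc j)
  have "Ck_on j (\<lambda>x. frechet_derivative (\<lambda>x. f x + g x) (at x) v) S" for v
  proof -
    have "frechet_derivative (\<lambda>x. f x + g x) (at x) v
        = frechet_derivative f (at x) v + frechet_derivative g (at x) v" if "x \<in> S" for x
      using Suc.prems that
      by (subst frechet_derivative_eqI[OF has_derivative_add])
         (auto simp: frechet_derivative_works[symmetric])
    moreover have "Ck_on j (\<lambda>x. frechet_derivative f (at x) v + frechet_derivative g (at x) v) S"
      using Suc by simp
    ultimately show ?thesis using Ck_on_cong[OF assms(1)] by (metis (no_types, lifting))
  qed
  then show ?case using Suc.prems by simp
qed

lemma Ck_on_sum:
  assumes "open S" "\<And>i. i \<in> I \<Longrightarrow> Ck_on j (f i) S"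
  shows "Ck_on j (\<lambda>x. \<Sum>i\<in>I. f i x) S"
  using assms(2)
  by (induction I rule: infinite_finite_induct) (auto intro: Ck_on_const Ck_on_add[OF assms(1)])

lemma Ck_on_bounded_linear:
  assumes "open S" "bounded_linear L" "Ck_on j f S"
  shows "Ck_on j (\<lambda>x. L (f x)) S"
  using assms(3)
proof (induction j arbitrary: f)
  case 0 then show ?case by (auto intro: bounded_linear.continuous_on[OF assms(2)])
next
  case (Suc j)
  have D: "((\<lambda>x. L (f x)) has_derivative (\<lambda>v. L (frechet_derivative f (at x) v))) (at x)" if "x \<in> S" for x
    using Suc.prems that
    by (intro bounded_linear.has_derivative[OF assms(2)]) (auto simp: frechet_derivative_works[symmetric])
  have "Ck_on j (\<lambda>x. frechet_derivative (\<lambda>x. L (f x)) (at x) v) S" for v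
    by (subst Ck_on_cong[OF assms(1), where g = "\<lambda>x. L (frechet_derivative f (at x) v)"])
       (use Suc D in \<open>auto simp: frechet_derivative_eqI[OF D]\<close>)
  then show ?case using D by (auto simp: differentiable_def)
qed

lemma Ck_on_scaleR:
  assumes "open S" "Ck_on j f S" "Ck_on j g S"
  shows "Ck_on j (\<lambda>x. f x *\<^sub>R g x) S"
  using assms(2,3)
proof (induction j arbitrary: f g)
  case 0 then show ?case by (auto intro: continuous_intros)
next
  case (Suc j)
  have D: "((\<lambda>x. f x *\<^sub>R g x) has_derivative
      (\<lambda>v. f x *\<^sub>R frechet_derivative g (at x) v + frechet_derivative f (at x) v *\<^sub>R g x)) (at x)"
    if "x \<in> S" for x
    using Suc.prems that
    by (intro has_derivative_scaleR) (auto simp: frechet_derivative_works[symmetric])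
  have "Ck_on j (\<lambda>x. frechet_derivative (\<lambda>x. f x *\<^sub>R g x) (at x) v) S" for v
  proof (subst Ck_on_cong[OF assms(1)])
    show "frechet_derivative (\<lambda>x. f x *\<^sub>R g x) (at y) v =
      f y *\<^sub>R frechet_derivative g (at y) v + frechet_derivative f (at y) v *\<^sub>R g y" if "y \<in> S" for y
      using frechet_derivative_eqI[OF D[OF that]] by simp
    show "Ck_on j (\<lambda>y. f y *\<^sub>R frechet_derivative g (at y) v + frechet_derivative f (at y) v *\<^sub>R g y) S"
      using Suc.prems Ck_on_Suc_imp[OF Suc.prems(1)] Ck_on_Suc_imp[OF Suc.prems(2)]
      by (intro Ck_on_add[OF assms(1)] Suc.IH) auto
  qed
  then show ?case using D by (auto simp: differentiable_def)
qed

lemma Ck_on_mult: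
  fixes f g :: "'e::real_normed_vector \<Rightarrow> real"
  assumes "open S" "Ck_on j f S" "Ck_on j g S"
  shows "Ck_on j (\<lambda>x. f x * g x) S"
  using Ck_on_scaleR[OF assms] by simp

lemma Ck_on_componentwise:
  fixes f :: "'e::real_normed_vector \<Rightarrow> 'f::euclidean_space"
  assumes "open S" "\<And>b. b \<in> Basis \<Longrightarrow> Ck_on j (\<lambda>x. f x \<bullet> b) S"
  shows "Ck_on j f S"
proof -
  have "Ck_on j (\<lambda>x. \<Sum>b\<in>Basis. (f x \<bullet> b) *\<^sub>R b) S"
    by (intro Ck_on_sum Ck_on_scaleR assms Ck_on_const)
  then show ?thesis by (simp add: euclidean_representation)
qed

lemma Ck_on_linear:
  assumes "bounded_linear L"
  shows "Ck_on j L S"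
proof (cases j)
  case 0
  then show ?thesis using assms by (simp add: linear_continuous_on)
next
  case (Suc i)
  have D: "(L has_derivative L) (at x)" for x
    using assms by (rule bounded_linear_imp_has_derivative)
  then show ?thesis
    unfolding Suc using frechet_derivative_eqI[OF D] by (auto simp: differentiable_def Ck_on_const)
qed

text \<open>\<open>Ck_on\<close> differentiates in fixed directions, but the chain rule applies the
  derivative of \<open>g\<close> to the varying vector \<open>frechet_derivative f (at y) v\<close>.
  Expanding that vector in \<open>Basis\<close> leaves scalar factors times derivatives of
  \<open>g\<close> in fixed directions, to which the induction hypothesis applies with the same
  \<open>f\<close>.\<close>

lemma Ck_on_compose:
  fixes f :: "'e::real_normed_vector \<Rightarrow> 'f::euclidean_space" and g :: "'f \<Rightarrow> 'g::real_normed_vector"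
  assumes "open S" "Ck_on j f S" "Ck_on j g S'" "f ` S \<subseteq> S'"
  shows "Ck_on j (\<lambda>x. g (f x)) S"
  using assms(2,3)
proof (induction j arbitrary: g)
  case 0 then show ?case by (auto intro: continuous_on_compose2[OF _ _ assms(4)])
next
  case (Suc j)
  have D: "((\<lambda>x. g (f x)) has_derivative
      (\<lambda>v. frechet_derivative g (at (f x)) (frechet_derivative f (at x) v))) (at x)"
    if "x \<in> S" for x
    using Suc.prems that assms(4)
    by (intro has_derivative_compose[where f=f and g=g]) (auto simp: frechet_derivative_works[symmetric])
  have "Ck_on j (\<lambda>x. frechet_derivative (\<lambda>x. g (f x)) (at x) v) S" for v
  proof (subst Ck_on_cong[OF assms(1)])
    show "frechet_derivative (\<lambda>x. g (f x)) (at y) v =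
      (\<Sum>b\<in>Basis. (frechet_derivative f (at y) v \<bullet> b) *\<^sub>R frechet_derivative g (at (f y)) b)"
      if "y \<in> S" for y
    proof -
      have "linear (frechet_derivative g (at (f y)))"
        using Suc.prems that assms(4) by (auto intro!: linear_frechet_derivative)
      then have "frechet_derivative g (at (f y)) (\<Sum>b\<in>Basis. (frechet_derivative f (at y) v \<bullet> b) *\<^sub>R b)
        = (\<Sum>b\<in>Basis. (frechet_derivative f (at y) v \<bullet> b) *\<^sub>R frechet_derivative g (at (f y)) b)"
        by (simp add: linear_sum linear_cmul)
      then show ?thesis
        using frechet_derivative_eqI[OF D[OF that]] by (simp add: euclidean_representation)
    qed
    show "Ck_on j (\<lambda>y. \<Sum>b\<in>Basis. (frechet_derivative f (at y) v \<bullet> b) *\<^sub>R frechet_derivative g (at (f y)) b) S"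
    proof (intro Ck_on_sum Ck_on_scaleR assms(1))
      fix b
      show "Ck_on j (\<lambda>x. frechet_derivative f (at x) v \<bullet> b) S"
        using Suc.prems by (auto intro: Ck_on_bounded_linear[OF assms(1) bounded_linear_inner_left])
      show "Ck_on j (\<lambda>x. frechet_derivative g (at (f x)) b) S"
        using Suc.prems Ck_on_Suc_imp[OF Suc.prems(1)] by (intro Suc.IH) auto
    qed
  qed
  then show ?case using D by (auto simp: differentiable_def)
qed

lemma Ck_on_Pair:
  fixes f :: "'e::real_normed_vector \<Rightarrow> 'f::real_normed_vector" and g :: "'e \<Rightarrow> 'g::real_normed_vector"
  assumes "open S" "Ck_on j f S" "Ck_on j g S"
  shows "Ck_on j (\<lambda>x. (f x, g x)) S"
proof -
  have bl: "bounded_linear (\<lambda>x::'f. (x, 0::'g))" "bounded_linear (\<lambda>x::'g. (0::'f, x))"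
    by (intro bounded_linear_Pair bounded_linear_ident bounded_linear_zero)+
  show ?thesis
    using Ck_on_add[OF assms(1) Ck_on_bounded_linear[OF assms(1) bl(1) assms(2)]
        Ck_on_bounded_linear[OF assms(1) bl(2) assms(3)]] by simp
qed

lemma smooth_on_frechet_derivative:
  "smooth_on S f \<Longrightarrow> smooth_on S (\<lambda>x. frechet_derivative f (at x) v)"
  unfolding smooth_on_def by (metis Ck_on.simps(2))

lemma smooth_on_differentiable: "smooth_on S f \<Longrightarrow> x \<in> S \<Longrightarrow> f differentiable at x"
  unfolding smooth_on_def by (metis Ck_on.simps(2))

lemma smooth_on_subset: "smooth_on S f \<Longrightarrow> S' \<subseteq> S \<Longrightarrow> smooth_on S' f"
  unfolding smooth_on_def by (blast intro: Ck_on_subset)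

lemma smooth_on_compose:
  fixes f :: "'e::real_normed_vector \<Rightarrow> 'f::euclidean_space"
  shows "open S \<Longrightarrow> smooth_on S f \<Longrightarrow> smooth_on S' g \<Longrightarrow> f ` S \<subseteq> S' \<Longrightarrow> smooth_on S (\<lambda>x. g (f x))"
  unfolding smooth_on_def using Ck_on_compose by blast

lemma smooth_on_frechet_derivative_along:
  fixes f :: "'e::real_normed_vector \<Rightarrow> 'f::euclidean_space"
  assumes "open S" "smooth_on S f" "smooth_on R g" "f ` S \<subseteq> R"
  shows "smooth_on S (\<lambda>y. frechet_derivative g (at (f y)) u)"
  by (rule smooth_on_compose[OF assms(1,2) smooth_on_frechet_derivative[OF assms(3)] assms(4)])

lemma differentiable_Pair:
  "f differentiable at x \<Longrightarrow> g differentiable at x \<Longrightarrow> (\<lambda>x. (f x, g x)) differentiable at x"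
  unfolding differentiable_def by (elim exE) (rule exI, rule has_derivative_Pair)

section \<open>Symmetry of second derivatives\<close>

lemma has_derivative_along_line:
  assumes "(g has_derivative g') (at (y + s *\<^sub>R u))"
  shows "((\<lambda>s. g (y + s *\<^sub>R u)) has_vector_derivative g' u) (at s)"
proof -
  have "((\<lambda>s. y + s *\<^sub>R u) has_derivative (\<lambda>h. h *\<^sub>R u)) (at s)"
    by (auto intro!: derivative_eq_intros)
  from has_derivative_compose[OF this assms]
  have "((\<lambda>s. g (y + s *\<^sub>R u)) has_derivative (\<lambda>h. g' (h *\<^sub>R u))) (at s)" .
  moreover have "g' (h *\<^sub>R u) = h *\<^sub>R g' u" for h
    using assms has_derivative_linear linear_cmul by blast
  ultimately show ?thesis by (simp add: has_vector_derivative_def)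
qed

text \<open>Two applications of the mean value theorem to the second difference of \<open>f\<close>.\<close>

lemma second_difference:
  fixes f :: "'e::real_normed_vector \<Rightarrow> real"
  assumes B: "\<And>a b. 0 \<le> a \<Longrightarrow> a \<le> t \<Longrightarrow> 0 \<le> b \<Longrightarrow> b \<le> t \<Longrightarrow> x + a *\<^sub>R u + b *\<^sub>R v \<in> S"
    and d1: "\<And>y. y \<in> S \<Longrightarrow> f differentiable at y"
    and d2: "\<And>y. y \<in> S \<Longrightarrow> (\<lambda>y. frechet_derivative f (at y) u) differentiable at y"
    and t: "t > 0"
  shows "\<exists>a b. 0 \<le> a \<and> a \<le> t \<and> 0 \<le> b \<and> b \<le> t \<and>
    f (x + t *\<^sub>R u + t *\<^sub>R v) - f (x + t *\<^sub>R u) - f (x + t *\<^sub>R v) + f x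
      = t * t * frechet_derivative (\<lambda>y. frechet_derivative f (at y) u) (at (x + a *\<^sub>R u + b *\<^sub>R v)) v"
proof -
  let ?D = "\<lambda>y. frechet_derivative f (at y) u"
  define \<phi> where "\<phi> a = f (x + t *\<^sub>R v + a *\<^sub>R u) - f (x + a *\<^sub>R u)" for a
  have "(\<phi> has_real_derivative (?D (x + t *\<^sub>R v + a *\<^sub>R u) - ?D (x + a *\<^sub>R u))) (at a)"
    if "0 \<le> a" "a \<le> t" for a
  proof -
    have "x + t *\<^sub>R v + a *\<^sub>R u \<in> S" "x + a *\<^sub>R u \<in> S"
      using B[of a t] B[of a 0] that t by (simp_all add: algebra_simps)
    then have "f differentiable at (x + t *\<^sub>R v + a *\<^sub>R u)" "f differentiable at (x + a *\<^sub>R u)"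
      using d1 by auto
    then show ?thesis
      unfolding \<phi>_def has_real_derivative_iff_has_vector_derivative
      by (intro has_vector_derivative_diff has_derivative_along_line) (simp_all add: frechet_derivative_works)
  qed
  from MVT2[OF t this] obtain a where a: "0 < a" "a < t"
    "\<phi> t - \<phi> 0 = (t - 0) * (?D (x + t *\<^sub>R v + a *\<^sub>R u) - ?D (x + a *\<^sub>R u))" by auto
  define \<psi> where "\<psi> b = ?D (x + a *\<^sub>R u + b *\<^sub>R v)" for b
  have "(\<psi> has_real_derivative (frechet_derivative ?D (at (x + a *\<^sub>R u + b *\<^sub>R v)) v)) (at b)"
    if "0 \<le> b" "b \<le> t" for b
    unfolding \<psi>_def has_real_derivative_iff_has_vector_derivative
    using B[of a b] that a d2
    by (intro has_derivative_along_line) (auto simp: frechet_derivative_works[symmetric])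
  from MVT2[OF t this] obtain b where b: "0 < b" "b < t"
    "\<psi> t - \<psi> 0 = (t - 0) * frechet_derivative ?D (at (x + a *\<^sub>R u + b *\<^sub>R v)) v" by auto
  have "f (x + t *\<^sub>R u + t *\<^sub>R v) - f (x + t *\<^sub>R u) - f (x + t *\<^sub>R v) + f x = \<phi> t - \<phi> 0"
    unfolding \<phi>_def by (simp add: algebra_simps)
  also have "\<dots> = t * (\<psi> t - \<psi> 0)"
    using a(3) unfolding \<psi>_def by (simp add: algebra_simps)
  finally show ?thesis using a b by (intro exI[of _ a] exI[of _ b]) auto
qed

text \<open>The second difference of \<open>f\<close> over the parallelogram spanned by
  \<open>t u\<close> and \<open>t v\<close> is symmetric in \<open>u\<close> and \<open>v\<close>.
  It equals \<open>t * t\<close> times the mixed derivative in either order, each taken at some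
  nearby point; continuity of the second derivatives moves both points to \<open>x\<close> up to an
  error \<open>e\<close>.\<close>

lemma second_derivative_symmetric_real:
  fixes f :: "'e::real_normed_vector \<Rightarrow> real"
  assumes "open S" "x \<in> S" "Ck_on 2 f S"
  shows "frechet_derivative (\<lambda>y. frechet_derivative f (at y) u) (at x) v
       = frechet_derivative (\<lambda>y. frechet_derivative f (at y) v) (at x) u"
proof -
  let ?D = "\<lambda>u v y. frechet_derivative (\<lambda>y. frechet_derivative f (at y) u) (at y) v"
  have C: "Ck_on (Suc (Suc 0)) f S" using assms(3) by (simp add: numeral_2_eq_2)
  have d1: "\<And>y. y \<in> S \<Longrightarrow> f differentiable at y"
    and d2: "\<And>y u. y \<in> S \<Longrightarrow> (\<lambda>y. frechet_derivative f (at y) u) differentiable at y"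
    and cont: "\<And>u v. continuous_on S (?D u v)"
    using C by simp_all
  have "\<bar>?D u v x - ?D v u x\<bar> \<le> e" if "e > 0" for e
  proof -
    have lim: "(?D u v \<longlongrightarrow> ?D u v x) (at x within S)" for u v
      using cont assms by (auto simp: continuous_on_def)
    then have "\<forall>\<^sub>F y in at x within S. dist (?D u v y) (?D u v x) < e / 2" for u v
      using tendstoD half_gt_zero[OF \<open>e > 0\<close>] by blast
    then have ev: "\<forall>\<^sub>F y in nhds x. dist (?D u v y) (?D u v x) < e / 2" for u v
      using assms(1,2) \<open>e > 0\<close> at_within_open[OF assms(2,1)]
      by (auto simp: eventually_nhds_conv_at)
    have "\<forall>\<^sub>F y in nhds x. y \<in> S" using assms eventually_nhds by blast
    then have "\<forall>\<^sub>F y in nhds x. y \<in> S \<and> dist (?D u v y) (?D u v x) < e / 2 \<and> dist (?D v u y) (?D v u x) < e / 2"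
      using ev by (intro eventually_conj) auto
    then obtain r where r: "r > 0" "\<And>y. dist y x < r \<Longrightarrow>
        y \<in> S \<and> dist (?D u v y) (?D u v x) < e / 2 \<and> dist (?D v u y) (?D v u x) < e / 2"
      unfolding eventually_nhds_metric by blast
    \<comment> \<open>Keeps the whole parallelogram within \<open>r / 2\<close> of \<open>x\<close>;
      the summand 1 makes the denominator positive even if \<open>u = v = 0\<close>.\<close>
    define t where "t = r / (2 * (norm u + norm v + 1))"
    have nn: "norm u + norm v + 1 > 0" by (smt (verit) norm_ge_zero)
    then have t: "t > 0" unfolding t_def using r by simp
    have small: "dist (x + a *\<^sub>R u + b *\<^sub>R v) x < r" if "0 \<le> a" "a \<le> t" "0 \<le> b" "b \<le> t" for a b
    proof -
      have "dist (x + a *\<^sub>R u + b *\<^sub>R v) x = norm (a *\<^sub>R u + b *\<^sub>R v)"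
        by (simp add: dist_norm algebra_simps)
      also have "\<dots> \<le> a * norm u + b * norm v"
        using that by (intro norm_triangle_le) simp
      also have "\<dots> \<le> t * norm u + t * norm v"
        using that by (intro add_mono mult_right_mono) auto
      also have "\<dots> \<le> t * (norm u + norm v + 1)"
        using t by (simp add: algebra_simps)
      also have "\<dots> = r / 2" unfolding t_def using nn by (simp add: field_simps)
      also have "\<dots> < r" using r by simp
      finally show ?thesis .
    qed
    let ?\<Delta> = "f (x + t *\<^sub>R u + t *\<^sub>R v) - f (x + t *\<^sub>R u) - f (x + t *\<^sub>R v) + f x"
    obtain a b where ab: "0 \<le> a" "a \<le> t" "0 \<le> b" "b \<le> t" "?\<Delta> = t * t * ?D u v (x + a *\<^sub>R u + b *\<^sub>R v)"
      using second_difference[where S=S and x=x and u=u and v=v and f=f and t=t] small r(2) d1 d2 t by blast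
    have small': "dist (x + a *\<^sub>R v + b *\<^sub>R u) x < r" if "0 \<le> a" "a \<le> t" "0 \<le> b" "b \<le> t" for a b
      using small[of b a] that by (simp add: algebra_simps)
    obtain a' b' where ab': "0 \<le> a'" "a' \<le> t" "0 \<le> b'" "b' \<le> t"
       "f (x + t *\<^sub>R v + t *\<^sub>R u) - f (x + t *\<^sub>R v) - f (x + t *\<^sub>R u) + f x = t * t * ?D v u (x + a' *\<^sub>R v + b' *\<^sub>R u)"
      using second_difference[where S=S and x=x and u=v and v=u and f=f and t=t] small' r(2) d1 d2 t by blast
    have "t * t * ?D u v (x + a *\<^sub>R u + b *\<^sub>R v) = t * t * ?D v u (x + a' *\<^sub>R v + b' *\<^sub>R u)"
      using ab(5) ab'(5) by (simp add: algebra_simps)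
    then have eq: "?D u v (x + a *\<^sub>R u + b *\<^sub>R v) = ?D v u (x + a' *\<^sub>R v + b' *\<^sub>R u)"
      using t by simp
    have "dist (?D u v (x + a *\<^sub>R u + b *\<^sub>R v)) (?D u v x) < e / 2"
      "dist (?D v u (x + a' *\<^sub>R v + b' *\<^sub>R u)) (?D v u x) < e / 2"
      using r(2) small small' ab ab' by blast+
    then show ?thesis using eq unfolding dist_real_def by linarith
  qed
  then have "\<bar>?D u v x - ?D v u x\<bar> \<le> 0" by (rule field_le_epsilon) auto
  then show ?thesis by simp
qed

lemma frechet_derivative_bounded_linear:
  assumes "bounded_linear L" "f differentiable at x"
  shows "frechet_derivative (\<lambda>y. L (f y)) (at x) v = L (frechet_derivative f (at x) v)"
  using assms by (metis bounded_linear.has_derivative frechet_derivative_eqI frechet_derivative_works)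

text \<open>Pairing with a basis vector is bounded linear, so it commutes with both derivatives and
  reduces the claim to real values.\<close>

lemma second_derivative_symmetric:
  fixes f :: "'e::real_normed_vector \<Rightarrow> 'f::euclidean_space"
  assumes "open S" "x \<in> S" "Ck_on 2 f S"
  shows "frechet_derivative (\<lambda>y. frechet_derivative f (at y) u) (at x) v
       = frechet_derivative (\<lambda>y. frechet_derivative f (at y) v) (at x) u"
proof (rule euclidean_eqI)
  fix b :: 'f
  have C: "Ck_on (Suc (Suc 0)) f S" using assms(3) by (simp add: numeral_2_eq_2)
  have bl: "bounded_linear (\<lambda>y. y \<bullet> b)" by (rule bounded_linear_inner_left)
  have d1: "\<And>y. y \<in> S \<Longrightarrow> f differentiable at y"
    and d2: "\<And>u. (\<lambda>y. frechet_derivative f (at y) u) differentiable at x"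
    using C assms(2) by simp_all
  have "frechet_derivative (\<lambda>y. frechet_derivative f (at y) u) (at x) v \<bullet> b
      = frechet_derivative (\<lambda>y. frechet_derivative (\<lambda>y. f y \<bullet> b) (at y) u) (at x) v" for u v
  proof -
    have "frechet_derivative (\<lambda>y. frechet_derivative (\<lambda>y. f y \<bullet> b) (at y) u) (at x)
      = frechet_derivative (\<lambda>y. frechet_derivative f (at y) u \<bullet> b) (at x)"
      by (rule frechet_derivative_cong_open[OF assms(1,2)])
         (rule frechet_derivative_bounded_linear[OF bl d1])
    then show ?thesis using frechet_derivative_bounded_linear[OF bl d2] by metis
  qed
  moreover have "Ck_on 2 (\<lambda>y. f y \<bullet> b) S"
    by (rule Ck_on_bounded_linear[OF assms(1) bl assms(3)])
  ultimately show "frechet_derivative (\<lambda>y. frechet_derivative f (at y) u) (at x) v \<bullet> b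
      = frechet_derivative (\<lambda>y. frechet_derivative f (at y) v) (at x) u \<bullet> b"
    using second_derivative_symmetric_real[OF assms(1,2), of "\<lambda>y. f y \<bullet> b"] by presburger
qed

section \<open>Multilinear maps and the exterior derivative in a vector space\<close>

text \<open>Splitting the list around the varying entry suits inductions along an argument list.
  Unlike \<open>alt_maps\<close>, this says nothing about lists of other lengths, so the derivative
  of a family of multilinear maps, known only on lists of length \<open>k\<close>,
  qualifies.\<close>

definition multilinear_list :: "nat \<Rightarrow> ('w::real_vector list \<Rightarrow> 'v::real_vector) \<Rightarrow> bool" where
  "multilinear_list k h \<longleftrightarrow> (\<forall>ps qs u w a b. Suc (length ps + length qs) = k \<longrightarrow>
     h (ps @ (a *\<^sub>R u + b *\<^sub>R w) # qs) = a *\<^sub>R h (ps @ u # qs) + b *\<^sub>R h (ps @ w # qs))"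

lemma multilinear_list_linear:
  assumes "multilinear_list k h" "Suc (length ps + length qs) = k"
  shows "linear (\<lambda>u. h (ps @ u # qs))"
proof (rule linearI)
  have *: "h (ps @ (a *\<^sub>R u + b *\<^sub>R w) # qs) = a *\<^sub>R h (ps @ u # qs) + b *\<^sub>R h (ps @ w # qs)" for a b u w
    using assms unfolding multilinear_list_def by blast
  show "h (ps @ (u + w) # qs) = h (ps @ u # qs) + h (ps @ w # qs)" for u w
    using *[of 1 u 1 w] by simp
  show "h (ps @ (r *\<^sub>R u) # qs) = r *\<^sub>R h (ps @ u # qs)" for r u
    using *[of r u 0 u] by simp
qed

lemma multilinear_list_expand:
  fixes u :: "'w::euclidean_space"
  assumes "multilinear_list k h" "Suc (length ps + length qs) = k"
  shows "h (ps @ u # qs) = (\<Sum>b\<in>Basis. (u \<bullet> b) *\<^sub>R h (ps @ b # qs))"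
proof -
  note lin = multilinear_list_linear[OF assms]
  have "h (ps @ (\<Sum>b\<in>Basis. (u \<bullet> b) *\<^sub>R b) # qs) = (\<Sum>b\<in>Basis. (u \<bullet> b) *\<^sub>R h (ps @ b # qs))"
    by (simp only: linear_sum[OF lin] linear_cmul[OF lin])
  then show ?thesis by (simp add: euclidean_representation)
qed

lemma alt_maps_multilinear: "h \<in> alt_maps k UNIV \<Longrightarrow> multilinear_list k h"
  unfolding multilinear_list_def
proof (intro allI impI)
  fix ps qs :: "'a list" and u w a b
  assume h: "h \<in> alt_maps k UNIV" and len: "Suc (length ps + length qs) = k"
  have "h ((ps @ u # qs)[length ps := a *\<^sub>R u + b *\<^sub>R w])
      = a *\<^sub>R h ((ps @ u # qs)[length ps := u]) + b *\<^sub>R h ((ps @ u # qs)[length ps := w])"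
    using h len unfolding alt_maps_def mem_Collect_eq by (metis (no_types, lifting) UNIV_I
      add_Suc_right le_add1 length_Cons length_append less_Suc_eq_le subset_UNIV)
  then show "h (ps @ (a *\<^sub>R u + b *\<^sub>R w) # qs) = a *\<^sub>R h (ps @ u # qs) + b *\<^sub>R h (ps @ w # qs)"
    by simp
qed

text \<open>Polarization: the value with \<open>u + v\<close> in both places vanishes, and so do the
  two diagonal terms of its expansion.\<close>

lemma alt_maps_swap:
  assumes h: "h \<in> alt_maps k UNIV" and len: "Suc (Suc (length ps + length qs)) = k"
  shows "h (ps @ u # v # qs) = - h (ps @ v # u # qs)"
proof -
  note ml = alt_maps_multilinear[OF h]
  have lin1: "linear (\<lambda>x. h (ps @ x # y # qs))" for y
    using multilinear_list_linear[OF ml, of ps "y # qs"] len by simp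
  have lin2: "linear (\<lambda>x. h (ps @ y # x # qs))" for y
    using multilinear_list_linear[OF ml, of "ps @ [y]" qs] len by simp
  have eq0: "h (ps @ x # x # qs) = 0" for x
  proof -
    have "(ps @ x # x # qs) ! length ps = (ps @ x # x # qs) ! Suc (length ps)"
      by (simp add: nth_append)
    moreover have "length (ps @ x # x # qs) = k" "Suc (length ps) < k" using len by auto
    ultimately show ?thesis using h unfolding alt_maps_def mem_Collect_eq
      by (metis lessI subset_UNIV)
  qed
  have "h (ps @ (u + v) # (u + v) # qs)
      = h (ps @ u # u # qs) + h (ps @ u # v # qs) + (h (ps @ v # u # qs) + h (ps @ v # v # qs))"
    by (simp only: linear_add[OF lin1] linear_add[OF lin2] ac_simps)
  then show ?thesis unfolding eq0 by (simp add: eq_neg_iff_add_eq_0)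
qed

text \<open>One adjacent swap for each entry of \<open>ms\<close>.\<close>

lemma alt_maps_move:
  assumes h: "h \<in> alt_maps k UNIV" and len: "Suc (length ps + length ms + length rs) = k"
  shows "h (ps @ u # ms @ rs) = (- 1) ^ length ms *\<^sub>R h (ps @ ms @ u # rs)"
  using len
proof (induction ms arbitrary: ps)
  case (Cons m ms)
  have "h (ps @ u # m # ms @ rs) = - h (ps @ m # u # ms @ rs)"
    using Cons.prems by (intro alt_maps_swap[OF h]) simp
  also have "h (ps @ m # u # ms @ rs) = (- 1) ^ length ms *\<^sub>R h (ps @ m # ms @ u # rs)"
    using Cons.IH[of "ps @ [m]"] Cons.prems by simp
  finally show ?case by simp
qed simp

section \<open>Omitting one argument of an alternating map\<close>

definition delete_nth :: "nat \<Rightarrow> 'w list \<Rightarrow> 'w list" where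
  "delete_nth i xs = take i xs @ drop (Suc i) xs"

lemma length_delete_nth: "i < length xs \<Longrightarrow> length (delete_nth i xs) = length xs - 1"
  by (simp add: delete_nth_def)

lemma delete_nth_append: "delete_nth (length ps) (ps @ x # qs) = ps @ qs"
  by (simp add: delete_nth_def)

lemma map_delete_nth: "map g (delete_nth i xs) = delete_nth i (map g xs)"
  by (simp add: delete_nth_def take_map drop_map)

lemma nth_delete_nth:
  assumes "i < length xs" "l < length xs - 1"
  shows "delete_nth i xs ! l = (if l < i then xs ! l else xs ! Suc l)"
  using assms by (auto simp: delete_nth_def nth_append)

lemma delete_nth_update:
  assumes "i < length xs" "j < length xs" "i \<noteq> j"
  shows "delete_nth i (xs[j := q]) = (delete_nth i xs)[(if j < i then j else j - 1) := q]"
proof (rule nth_equalityI)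
  show "length (delete_nth i (xs[j := q])) = length ((delete_nth i xs)[(if j < i then j else j - 1) := q])"
    using assms by (simp add: length_delete_nth)
  fix l assume "l < length (delete_nth i (xs[j := q]))"
  then have l: "l < length xs - 1" using assms by (simp add: length_delete_nth)
  then show "delete_nth i (xs[j := q]) ! l = (delete_nth i xs)[(if j < i then j else j - 1) := q] ! l"
    using assms by (auto simp: nth_delete_nth nth_list_update length_delete_nth)
qed

text \<open>Carrying the first argument back to position \<open>i\<close> takes \<open>i\<close>
  adjacent swaps. In the Poincare lemma this makes all terms that differentiate the radial vector
  equal.\<close>

lemma alt_maps_nth_delete:
  assumes "h \<in> alt_maps (length xs) UNIV" "i < length xs"
  shows "(- 1) ^ i *\<^sub>R h (xs ! i # delete_nth i xs) = h xs"
proof -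
  have "h ([] @ xs ! i # take i xs @ drop (Suc i) xs)
      = (- 1) ^ length (take i xs) *\<^sub>R h ([] @ take i xs @ xs ! i # drop (Suc i) xs)"
    using assms by (intro alt_maps_move[OF assms(1)]) simp
  then have "h (xs ! i # delete_nth i xs) = (- 1) ^ i *\<^sub>R h xs"
    using assms(2) by (simp add: delete_nth_def id_take_nth_drop[symmetric])
  then show ?thesis by (simp add: power_add[symmetric] flip: power_mult_distrib)
qed

text \<open>With \<open>ms\<close> the entries strictly between positions \<open>i\<close> and
  \<open>j\<close>, both lists arise from \<open>ps @ ms @ rs\<close> by inserting \<open>q\<close>,
  once behind \<open>ms\<close> and once in front of it. Passing \<open>q\<close> across
  \<open>ms\<close> takes \<open>j - i - 1\<close> swaps, which together with the signs of
  \<open>i\<close> and \<open>j\<close> is odd. This is the sign by which second-derivative terms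
  cancel in a pullback.\<close>

lemma alt_maps_delete_update:
  assumes h: "h \<in> alt_maps k UNIV" and len: "length xs = Suc k" and ij: "i < j" "j \<le> k"
  shows "(- 1) ^ i *\<^sub>R h (delete_nth i (xs[j := q])) = - ((- 1) ^ j *\<^sub>R h (delete_nth j (xs[i := q])))"
proof -
  define ps ms rs where "ps = take i xs" and "ms = take (j - Suc i) (drop (Suc i) xs)" and "rs = drop (Suc j) xs"
  have "xs = ps @ xs ! i # drop (Suc i) xs"
    unfolding ps_def using len ij by (simp add: id_take_nth_drop)
  moreover have "drop (Suc i) xs = ms @ xs ! j # rs"
    using id_take_nth_drop[of "j - Suc i" "drop (Suc i) xs"] len ij unfolding ms_def rs_def by simp
  ultimately have xs: "xs = ps @ xs ! i # ms @ xs ! j # rs" by simp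
  have lp: "length ps = i" and lm: "length ms = j - Suc i" unfolding ps_def ms_def using len ij by auto
  have j: "j = length (ps @ xs ! i # ms)" using lp lm ij by simp
  have "xs[j := q] = ps @ xs ! i # ms @ q # rs"
    by (subst xs) (use j in \<open>simp add: list_update_append\<close>)
  then have d1: "delete_nth i (xs[j := q]) = ps @ ms @ q # rs"
    using delete_nth_append lp by metis
  have "xs[i := q] = (ps @ q # ms) @ xs ! j # rs"
    by (subst xs) (use lp in \<open>simp add: list_update_append\<close>)
  moreover have "j = length (ps @ q # ms)" using j by simp
  ultimately have d2: "delete_nth j (xs[i := q]) = ps @ q # ms @ rs"
    using delete_nth_append[of "ps @ q # ms"] by simp
  have "Suc (length ps + length ms + length rs) = k"
    using len lp lm ij unfolding rs_def by simp
  from alt_maps_move[OF h this]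
  have "h (delete_nth j (xs[i := q])) = (- 1) ^ (j - Suc i) *\<^sub>R h (delete_nth i (xs[j := q]))"
    unfolding d1 d2 lm .
  moreover have "(- 1 :: real) ^ j * (- 1) ^ (j - Suc i) = - ((- 1) ^ i)"
  proof -
    obtain m where "j = Suc (i + m)" using ij less_imp_Suc_add by blast
    then show ?thesis by (simp add: power_add mult.assoc flip: power_mult_distrib)
  qed
  ultimately show ?thesis by simp
qed

text \<open>Multilinearity is a set of linear identities between the functions
  \<open>\<lambda>y. h y ws\<close>, valid on the open set \<open>S\<close>; by uniqueness of
  derivatives they pass to \<open>h'\<close>.\<close>

lemma multilinear_list_has_derivative:
  fixes h :: "'x::real_normed_vector \<Rightarrow> 'e::real_vector list \<Rightarrow> real"
  assumes S: "open S" "y0 \<in> S" and ml: "\<And>y. y \<in> S \<Longrightarrow> multilinear_list k (h y)"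
    and hd: "\<And>ws. length ws = k \<Longrightarrow> ((\<lambda>y. h y ws) has_derivative (\<lambda>w. h' w ws)) (at y0)"
  shows "multilinear_list k (h' w)"
  unfolding multilinear_list_def
proof (intro allI impI)
  fix ps qs :: "'e list" and u v c d assume len: "Suc (length ps + length qs) = k"
  have "((\<lambda>y. h y (ps @ (c *\<^sub>R u + d *\<^sub>R v) # qs)) has_derivative
    (\<lambda>w. c *\<^sub>R h' w (ps @ u # qs) + d *\<^sub>R h' w (ps @ v # qs))) (at y0)"
  proof (rule has_derivative_transform_within_open[OF _ S])
    show "((\<lambda>y. c *\<^sub>R h y (ps @ u # qs) + d *\<^sub>R h y (ps @ v # qs)) has_derivative
      (\<lambda>w. c *\<^sub>R h' w (ps @ u # qs) + d *\<^sub>R h' w (ps @ v # qs))) (at y0)"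
      using len by (intro has_derivative_add has_derivative_scaleR_right hd) auto
  qed (use ml len in \<open>auto simp: multilinear_list_def\<close>)
  moreover have "((\<lambda>y. h y (ps @ (c *\<^sub>R u + d *\<^sub>R v) # qs)) has_derivative
    (\<lambda>w. h' w (ps @ (c *\<^sub>R u + d *\<^sub>R v) # qs))) (at y0)"
    using len by (intro hd) simp
  ultimately show "h' w (ps @ (c *\<^sub>R u + d *\<^sub>R v) # qs) = c *\<^sub>R h' w (ps @ u # qs) + d *\<^sub>R h' w (ps @ v # qs)"
    using has_derivative_unique by metis
qed

text \<open>The product rule when both the multilinear map and its arguments vary: one term for
  \<open>h\<close> and one for each argument. The induction collects constant arguments in
  \<open>ps\<close>; expanding the first varying argument in \<open>Basis\<close> replaces it by
  constants \<open>b\<close> with scalar coefficients.\<close>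

lemma has_derivative_multilinear_list:
  fixes h :: "'x::real_normed_vector \<Rightarrow> 'e::euclidean_space list \<Rightarrow> real"
  assumes S: "open S" "y0 \<in> S" and ml: "\<And>y. y \<in> S \<Longrightarrow> multilinear_list k (h y)"
    and hd: "\<And>ws. length ws = k \<Longrightarrow> ((\<lambda>y. h y ws) has_derivative (\<lambda>w. h' w ws)) (at y0)"
    and as: "\<And>a. a \<in> set as \<Longrightarrow> (a has_derivative a' a) (at y0)"
    and len: "length ps + length as = k"
  shows "((\<lambda>y. h y (ps @ map (\<lambda>a. a y) as)) has_derivative
    (\<lambda>w. h' w (ps @ map (\<lambda>a. a y0) as)
       + (\<Sum>l<length as. h y0 (ps @ (map (\<lambda>a. a y0) as)[l := a' (as ! l) w])))) (at y0)"
  using as len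
proof (induction as arbitrary: ps)
  case Nil
  then show ?case using hd by simp
next
  case (Cons a as)
  have ml': "multilinear_list k (h' w)" for w
    using multilinear_list_has_derivative[OF S ml hd] by blast
  let ?as0 = "map (\<lambda>a. a y0) as"
  have len: "Suc (length ps + length as) = k" using Cons.prems by simp
  have IH: "((\<lambda>y. h y (ps @ b # map (\<lambda>a. a y) as)) has_derivative
    (\<lambda>w. h' w (ps @ b # ?as0) + (\<Sum>l<length as. h y0 (ps @ b # ?as0[l := a' (as ! l) w])))) (at y0)" for b
    using Cons.IH[of "ps @ [b]"] Cons.prems by simp
  have a: "(a has_derivative a' a) (at y0)" using Cons.prems by simp
  have sum: "((\<lambda>y. \<Sum>b\<in>Basis. (a y \<bullet> b) *\<^sub>R h y (ps @ b # map (\<lambda>a. a y) as)) has_derivative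
     (\<lambda>w. \<Sum>b\<in>Basis. (a y0 \<bullet> b) *\<^sub>R (h' w (ps @ b # ?as0) + (\<Sum>l<length as. h y0 (ps @ b # ?as0[l := a' (as ! l) w])))
        + (a' a w \<bullet> b) *\<^sub>R h y0 (ps @ b # ?as0))) (at y0)"
    by (intro has_derivative_sum has_derivative_scaleR IH has_derivative_inner_left a)
  \<comment> \<open>The sums over \<open>Basis\<close> are folded back by multilinearity of
    \<open>h'\<close> and of \<open>h y0\<close>. Differentiating the coefficient
    \<open>a y \<bullet> b\<close> supplies the summand \<open>l = 0\<close>.\<close>
  have eq: "(\<Sum>b\<in>Basis. (a y0 \<bullet> b) *\<^sub>R (h' w (ps @ b # ?as0) + (\<Sum>l<length as. h y0 (ps @ b # ?as0[l := a' (as ! l) w])))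
        + (a' a w \<bullet> b) *\<^sub>R h y0 (ps @ b # ?as0))
     = h' w (ps @ map (\<lambda>a. a y0) (a # as))
       + (\<Sum>l<length (a # as). h y0 (ps @ (map (\<lambda>a. a y0) (a # as))[l := a' ((a # as) ! l) w]))" for w
  proof -
    have 1: "h' w (ps @ a y0 # ?as0) = (\<Sum>b\<in>Basis. (a y0 \<bullet> b) *\<^sub>R h' w (ps @ b # ?as0))"
      using len by (intro multilinear_list_expand[OF ml']) simp
    have 2: "h y0 (ps @ a' a w # ?as0) = (\<Sum>b\<in>Basis. (a' a w \<bullet> b) *\<^sub>R h y0 (ps @ b # ?as0))"
      using len by (intro multilinear_list_expand[OF ml[OF S(2)]]) simp
    have 3: "h y0 (ps @ a y0 # ?as0[l := q]) = (\<Sum>b\<in>Basis. (a y0 \<bullet> b) *\<^sub>R h y0 (ps @ b # ?as0[l := q]))" for l q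
      using len by (intro multilinear_list_expand[OF ml[OF S(2)]]) simp
    have "(\<Sum>l<length (a # as). h y0 (ps @ (map (\<lambda>a. a y0) (a # as))[l := a' ((a # as) ! l) w]))
       = h y0 (ps @ a' a w # ?as0) + (\<Sum>l<length as. h y0 (ps @ a y0 # ?as0[l := a' (as ! l) w]))"
      by (simp add: sum.lessThan_Suc_shift del: sum.lessThan_Suc)
    also have "(\<Sum>l<length as. h y0 (ps @ a y0 # ?as0[l := a' (as ! l) w]))
       = (\<Sum>b\<in>Basis. (a y0 \<bullet> b) *\<^sub>R (\<Sum>l<length as. h y0 (ps @ b # ?as0[l := a' (as ! l) w])))"
      unfolding 3 by (subst sum.swap) (simp add: sum_distrib_left)
    finally show ?thesis
      by (simp only: list.map 1 2 sum.distrib scaleR_add_right ac_simps)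
  qed
  have D: "((\<lambda>y. \<Sum>b\<in>Basis. (a y \<bullet> b) *\<^sub>R h y (ps @ b # map (\<lambda>a. a y) as)) has_derivative
     (\<lambda>w. h' w (ps @ map (\<lambda>a. a y0) (a # as))
       + (\<Sum>l<length (a # as). h y0 (ps @ (map (\<lambda>a. a y0) (a # as))[l := a' ((a # as) ! l) w])))) (at y0)"
    by (rule has_derivative_eq_rhs[OF sum ext[OF eq]])
  show ?case
  proof (rule has_derivative_transform_within_open[OF D S])
    fix y assume "y \<in> S"
    then show "(\<Sum>b\<in>Basis. (a y \<bullet> b) *\<^sub>R h y (ps @ b # map (\<lambda>a. a y) as)) = h y (ps @ map (\<lambda>a. a y) (a # as))"
      using multilinear_list_expand[OF ml[OF \<open>y \<in> S\<close>], of ps "map (\<lambda>a. a y) as" "a y"] len by simp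
  qed
qed

lemma differentiable_multilinear_list:
  fixes h :: "'x::real_normed_vector \<Rightarrow> 'e::euclidean_space list \<Rightarrow> real"
  assumes S: "open S" "y0 \<in> S" and ml: "\<And>y. y \<in> S \<Longrightarrow> multilinear_list k (h y)"
    and h: "\<And>ws. length ws = k \<Longrightarrow> (\<lambda>y. h y ws) differentiable at y0"
    and L: "\<And>u. L u differentiable at y0" and len: "length us = k"
  shows "(\<lambda>y. h y (map (\<lambda>u. L u y) us)) differentiable at y0"
proof -
  let ?as = "map L us"
  have "((\<lambda>y. h y ([] @ map (\<lambda>a. a y) ?as)) has_derivative
    (\<lambda>w. frechet_derivative (\<lambda>y. h y ([] @ map (\<lambda>a. a y0) ?as)) (at y0) w
       + (\<Sum>l<length ?as. h y0 ([] @ (map (\<lambda>a. a y0) ?as)[l := frechet_derivative (?as ! l) (at y0) w])))) (at y0)"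
    by (rule has_derivative_multilinear_list[OF S ml,
          where h' = "\<lambda>w us. frechet_derivative (\<lambda>y. h y us) (at y0) w"])
       (use h L len in \<open>auto simp: frechet_derivative_works[symmetric]\<close>)
  then show ?thesis unfolding differentiable_def by (auto simp: o_def)
qed

text \<open>As in the product rule, expanding the varying arguments one by one in
  \<open>Basis\<close> leaves sums of products of scalar \<open>Ck_on\<close> functions.\<close>

lemma Ck_on_multilinear_list:
  fixes h :: "'x::real_normed_vector \<Rightarrow> 'e::euclidean_space list \<Rightarrow> real"
  assumes S: "open S" and ml: "\<And>y. y \<in> S \<Longrightarrow> multilinear_list k (h y)"
    and h: "\<And>ws. length ws = k \<Longrightarrow> Ck_on j (\<lambda>y. h y ws) S"
    and as: "\<And>a. a \<in> set as \<Longrightarrow> Ck_on j a S" and len: "length ps + length as = k"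
  shows "Ck_on j (\<lambda>y. h y (ps @ map (\<lambda>a. a y) as)) S"
  using as len
proof (induction as arbitrary: ps)
  case Nil then show ?case using h by simp
next
  case (Cons a as)
  have "Ck_on j (\<lambda>y. h y ((ps @ [b]) @ map (\<lambda>a. a y) as)) S" for b
    by (rule Cons.IH) (use Cons.prems in auto)
  moreover have "Ck_on j (\<lambda>y. a y \<bullet> b) S" for b
    by (rule Ck_on_bounded_linear[OF S bounded_linear_inner_left]) (use Cons.prems in auto)
  ultimately have "Ck_on j (\<lambda>y. \<Sum>b\<in>Basis. (a y \<bullet> b) *\<^sub>R h y (ps @ b # map (\<lambda>a. a y) as)) S"
    by (intro Ck_on_sum[OF S] Ck_on_scaleR[OF S]) auto
  moreover have "h y (ps @ a y # map (\<lambda>a. a y) as) = (\<Sum>b\<in>Basis. (a y \<bullet> b) *\<^sub>R h y (ps @ b # map (\<lambda>a. a y) as))"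
    if "y \<in> S" for y
    by (rule multilinear_list_expand[OF ml[OF that]]) (use Cons.prems in auto)
  ultimately show ?case using Ck_on_cong[OF S] by (simp cong: Ck_on_cong[OF S])
qed

section \<open>Naturality of the exterior derivative in a vector space\<close>

definition flat_ext_deriv :: "nat \<Rightarrow> ('e::real_normed_vector \<Rightarrow> 'e list \<Rightarrow> real) \<Rightarrow> 'e \<Rightarrow> 'e list \<Rightarrow> real" where
  "flat_ext_deriv k \<beta> y us =
     (\<Sum>i\<le>k. (- 1) ^ i * frechet_derivative (\<lambda>z. \<beta> z (delete_nth i us)) (at y) (us ! i))"

lemma flat_ext_deriv_cong:
  assumes "open S" "y \<in> S" "\<And>z. z \<in> S \<Longrightarrow> \<beta> z = \<gamma> z"
  shows "flat_ext_deriv k \<beta> y us = flat_ext_deriv k \<gamma> y us"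
proof -
  have "frechet_derivative (\<lambda>z. \<beta> z vs) (at y) = frechet_derivative (\<lambda>z. \<gamma> z vs) (at y)" for vs
    by (rule frechet_derivative_cong_open[OF assms(1,2)]) (simp add: assms(3))
  then show ?thesis unfolding flat_ext_deriv_def by simp
qed

definition flat_pullback :: "('e::real_normed_vector \<Rightarrow> 'f::real_normed_vector) \<Rightarrow> ('f \<Rightarrow> 'f list \<Rightarrow> 'v) \<Rightarrow> 'e \<Rightarrow> 'e list \<Rightarrow> 'v" where
  "flat_pullback \<sigma> \<beta> y us = \<beta> (\<sigma> y) (map (frechet_derivative \<sigma> (at y)) us)"

text \<open>The terms of \<open>d (\<sigma>\<^sup>* \<beta>)\<close> that involve second derivatives of \<open>\<sigma>\<close> cancel in pairs, since these
  are symmetric and \<open>\<beta>\<close> is alternating.\<close>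

lemma flat_ext_deriv_pullback:
  fixes \<sigma> :: "'e::euclidean_space \<Rightarrow> 'f::euclidean_space"
  assumes S: "open S" "y0 \<in> S" and \<sigma>: "Ck_on 2 \<sigma> S"
    and R: "open R" "\<sigma> y0 \<in> R" and alt: "\<And>z. z \<in> R \<Longrightarrow> \<beta> z \<in> alt_maps k UNIV"
    and diff: "\<And>us. length us = k \<Longrightarrow> (\<lambda>z. \<beta> z us) differentiable at (\<sigma> y0)"
    and len: "length ws = Suc k"
  shows "flat_ext_deriv k (flat_pullback \<sigma> \<beta>) y0 ws
       = flat_ext_deriv k \<beta> (\<sigma> y0) (map (frechet_derivative \<sigma> (at y0)) ws)"
proof -
  define L where "L = frechet_derivative \<sigma> (at y0)"
  define Q where "Q w u = frechet_derivative (\<lambda>y. frechet_derivative \<sigma> (at y) u) (at y0) w" for w u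
  have \<sigma>': "Ck_on (Suc (Suc 0)) \<sigma> S" using \<sigma> by (simp add: numeral_2_eq_2)
  have d1: "\<And>y. y \<in> S \<Longrightarrow> \<sigma> differentiable at y"
    and d2: "\<And>u. (\<lambda>y. frechet_derivative \<sigma> (at y) u) differentiable at y0"
    using \<sigma>' S by auto
  have Qsym: "Q w u = Q u w" for u w
    unfolding Q_def by (rule second_derivative_symmetric[OF S \<sigma>])
  have "continuous_on S \<sigma>"
    using d1 by (simp add: continuous_at_imp_continuous_on differentiable_imp_continuous_within)
  then have S': "open (S \<inter> \<sigma> -` R)" "y0 \<in> S \<inter> \<sigma> -` R"
    using S R by (auto intro: continuous_open_preimage)
  let ?b = "\<lambda>us. frechet_derivative (\<lambda>z. \<beta> z us) (at (\<sigma> y0))"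
  let ?h = "\<beta> (\<sigma> y0)"
  let ?xs = "map L ws"
  have h: "?h \<in> alt_maps k UNIV" using alt R by blast
  have "frechet_derivative (\<lambda>y. flat_pullback \<sigma> \<beta> y us) (at y0) w
      = ?b (map L us) (L w) + (\<Sum>l<k. ?h ((map L us)[l := Q w (us ! l)]))"
    if us: "length us = k" for us w
  proof -
    let ?as = "map (\<lambda>u y. frechet_derivative \<sigma> (at y) u) us"
    have "((\<lambda>y. \<beta> (\<sigma> y) ([] @ map (\<lambda>a. a y) ?as)) has_derivative
      (\<lambda>w. ?b ([] @ map (\<lambda>a. a y0) ?as) (L w)
         + (\<Sum>l<length ?as. ?h ([] @ (map (\<lambda>a. a y0) ?as)[l := frechet_derivative (?as ! l) (at y0) w])))) (at y0)"
    proof (rule has_derivative_multilinear_list[OF S', where k = k and h' = "\<lambda>w us. ?b us (L w)"])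
      show "multilinear_list k (\<beta> (\<sigma> y))" if "y \<in> S \<inter> \<sigma> -` R" for y
        using that alt alt_maps_multilinear by blast
      show "((\<lambda>y. \<beta> (\<sigma> y) vs) has_derivative (\<lambda>w. ?b vs (L w))) (at y0)" if "length vs = k" for vs
        unfolding L_def using d1[OF S(2)] diff[OF that]
        by (rule has_derivative_compose[where f = \<sigma> and g = "\<lambda>z. \<beta> z vs",
            OF frechet_derivative_works[THEN iffD1] frechet_derivative_works[THEN iffD1]])
      show "(a has_derivative frechet_derivative a (at y0)) (at y0)" if "a \<in> set ?as" for a
        using that d2 by (auto simp: frechet_derivative_works[symmetric])
    qed (use us in auto)
    from frechet_derivative_eqI[OF this]
    show ?thesis using us
      by (simp add: flat_pullback_def o_def L_def Q_def)
  qed note D = this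
  \<comment> \<open>The second-derivative term in summand \<open>i\<close> of \<open>d\<close> for
    which argument \<open>j\<close> is differentiated. Letting \<open>j\<close> count positions in
    the full list, not in the list without entry \<open>i\<close>, makes the array square and
    antisymmetric. Entry \<open>i\<close> is deleted, hence 0 on the diagonal.\<close>
  define t where "t i j = (if i = j then 0 else (- 1) ^ i * ?h (delete_nth i (?xs[j := Q (ws ! i) (ws ! j)])))" for i j
  have anti: "t i j = - t j i" if "i \<le> k" "j \<le> k" for i j
  proof -
    have *: "t i j = - t j i" if "i < j" "j \<le> k" for i j
      using alt_maps_delete_update[OF h _ that, of ?xs "Q (ws ! i) (ws ! j)"] len that
      unfolding t_def by (simp add: Qsym)
    show ?thesis using *[of i j] *[of j i] that by (cases i j rule: linorder_cases) (auto simp: t_def)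
  qed
  have inner: "(\<Sum>l<k. ?h ((map L (delete_nth i ws))[l := Q (ws ! i) (delete_nth i ws ! l)])) * (- 1) ^ i
      = (\<Sum>j\<le>k. t i j)" if "i \<le> k" for i
  proof -
    have "(\<Sum>l<k. (- 1) ^ i * ?h ((map L (delete_nth i ws))[l := Q (ws ! i) (delete_nth i ws ! l)]))
      = (\<Sum>j\<in>{..k} - {i}. t i j)"
    \<comment> \<open>Position \<open>l\<close> of the shortened list is position \<open>l\<close>
      or \<open>Suc l\<close> of the full one, depending on the side of \<open>i\<close>.\<close>
    proof (rule sum.reindex_bij_witness[where j = "\<lambda>l. if l < i then l else Suc l"
          and i = "\<lambda>j. if j < i then j else j - 1"])
      fix l assume l: "l \<in> {..<k}"
      let ?j = "if l < i then l else Suc l"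
      have "delete_nth i (?xs[?j := q]) = (delete_nth i ?xs)[l := q]" for q
        using len that l by (subst delete_nth_update) auto
      moreover have "delete_nth i ws ! l = ws ! ?j"
        using len that l by (subst nth_delete_nth) auto
      ultimately show "t i ?j = (- 1) ^ i * ?h ((map L (delete_nth i ws))[l := Q (ws ! i) (delete_nth i ws ! l)])"
        unfolding t_def by (auto simp: map_delete_nth)
    qed (use that in \<open>auto split: if_splits\<close>)
    also have "\<dots> = (\<Sum>j\<le>k. t i j)"
      using that by (subst (2) sum.remove[of _ i]) (auto simp: t_def)
    finally show ?thesis by (simp add: sum_distrib_left mult.commute)
  qed
  have "(\<Sum>i\<le>k. \<Sum>j\<le>k. t i j) = (\<Sum>j\<le>k. \<Sum>i\<le>k. t i j)" by (rule sum.swap)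
  also have "\<dots> = (\<Sum>j\<le>k. \<Sum>i\<le>k. - t j i)"
    by (rule sum.cong[OF refl], rule sum.cong[OF refl]) (use anti in blast)
  also have "\<dots> = - (\<Sum>i\<le>k. \<Sum>j\<le>k. t i j)" by (simp add: sum_negf)
  finally have 0: "(\<Sum>i\<le>k. \<Sum>j\<le>k. t i j) = 0" by simp
  have "flat_ext_deriv k (flat_pullback \<sigma> \<beta>) y0 ws
     = (\<Sum>i\<le>k. (- 1) ^ i * ?b (map L (delete_nth i ws)) (L (ws ! i)) + (\<Sum>j\<le>k. t i j))"
    unfolding flat_ext_deriv_def
  proof (rule sum.cong[OF refl])
    fix i assume "i \<in> {..k}"
    then have "length (delete_nth i ws) = k" using len by (simp add: length_delete_nth)
    from D[OF this] inner[of i] \<open>i \<in> {..k}\<close>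
    show "(- 1) ^ i * frechet_derivative (\<lambda>z. flat_pullback \<sigma> \<beta> z (delete_nth i ws)) (at y0) (ws ! i)
      = (- 1) ^ i * ?b (map L (delete_nth i ws)) (L (ws ! i)) + (\<Sum>j\<le>k. t i j)"
      by (simp add: distrib_left mult.commute)
  qed
  also have "\<dots> = flat_ext_deriv k \<beta> (\<sigma> y0) (map L ws)"
    unfolding flat_ext_deriv_def using 0 len by (simp add: sum.distrib map_delete_nth)
  finally show ?thesis unfolding L_def .
qed

section \<open>The Poincare lemma\<close>

text \<open>The homotopy operator on coefficients. Contracting to \<open>y0\<close> along rays
  scales \<open>k\<close> arguments of a \<open>(k + 1)\<close>-form by \<open>t\<close>, the
  remaining argument being the radial vector; this accounts for the weight
  \<open>t ^ k\<close>.\<close>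

definition ray_integral :: "nat \<Rightarrow> 'e::real_normed_vector \<Rightarrow> ('e \<Rightarrow> real) \<Rightarrow> 'e \<Rightarrow> real" where
  "ray_integral k y0 g y = integral (cbox 0 1) (\<lambda>t. t ^ k * g (y0 + t *\<^sub>R (y - y0)))"

lemma ray_in_convex:
  assumes "convex B" "y0 \<in> B" "y \<in> B" "t \<in> cbox 0 1"
  shows "y0 + t *\<^sub>R (y - y0) \<in> B"
proof -
  have "(1 - t) *\<^sub>R y0 + t *\<^sub>R y \<in> B"
    using assms by (intro convexD) auto
  then show ?thesis by (simp add: algebra_simps)
qed

context
  fixes B :: "'e::euclidean_space set" and y0 :: 'e
  assumes B: "open B" "convex B" "y0 \<in> B"
begin

lemma continuous_on_ray_integrand:
  assumes "continuous_on B g"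
  shows "continuous_on (B \<times> cbox 0 1) (\<lambda>(y, t). t ^ k * g (y0 + t *\<^sub>R (y - y0)))"
proof -
  have "continuous_on (B \<times> cbox (0::real) 1) (\<lambda>x. g (y0 + snd x *\<^sub>R (fst x - y0)))"
    by (rule continuous_on_compose2[OF assms])
       (use ray_in_convex[OF B(2,3)] in \<open>auto intro!: continuous_intros\<close>)
  then show ?thesis by (auto intro!: continuous_intros simp: case_prod_unfold)
qed

lemma ray_integrand_integrable:
  assumes "continuous_on B g" "y \<in> B"
  shows "(\<lambda>t. t ^ k * g (y0 + t *\<^sub>R (y - y0))) integrable_on cbox 0 1"
proof (rule integrable_continuous)
  have "continuous_on (cbox (0::real) 1) (\<lambda>t. g (y0 + t *\<^sub>R (y - y0)))"
    by (rule continuous_on_compose2[OF assms(1)])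
       (use ray_in_convex[OF B(2,3) assms(2)] in \<open>auto intro!: continuous_intros\<close>)
  then show "continuous_on (cbox 0 1) (\<lambda>t. t ^ k * g (y0 + t *\<^sub>R (y - y0)))"
    by (auto intro!: continuous_intros)
qed

lemma ray_integral_cong:
  assumes "\<And>z. z \<in> B \<Longrightarrow> f z = g z" "y \<in> B"
  shows "ray_integral k y0 f y = ray_integral k y0 g y"
  unfolding ray_integral_def
  by (rule integral_cong) (use assms ray_in_convex[OF B(2,3)] in auto)

lemma ray_integral_lincomb:
  assumes "continuous_on B f" "continuous_on B g" "y \<in> B"
  shows "ray_integral k y0 (\<lambda>z. a * f z + b * g z) y = a * ray_integral k y0 f y + b * ray_integral k y0 g y"
proof -
  note I = ray_integrand_integrable[OF assms(1,3), of k] ray_integrand_integrable[OF assms(2,3), of k]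
  have "ray_integral k y0 (\<lambda>z. a * f z + b * g z) y
    = integral (cbox 0 1) (\<lambda>t. a * (t ^ k * f (y0 + t *\<^sub>R (y - y0))) + b * (t ^ k * g (y0 + t *\<^sub>R (y - y0))))"
    unfolding ray_integral_def by (simp add: algebra_simps)
  also have "\<dots> = a * ray_integral k y0 f y + b * ray_integral k y0 g y"
    unfolding ray_integral_def using I
    by (subst integral_add) (auto intro!: integrable_on_mult_right)
  finally show ?thesis .
qed

lemma ray_integral_sum:
  assumes "\<And>i. i \<in> I \<Longrightarrow> continuous_on B (f i)" "y \<in> B" "finite I"
  shows "ray_integral k y0 (\<lambda>z. \<Sum>i\<in>I. c i * f i z) y = (\<Sum>i\<in>I. c i * ray_integral k y0 (f i) y)"
  using assms(3,1)
proof (induction I rule: finite_induct)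
  case empty
  then show ?case by (simp add: ray_integral_def)
next
  case (insert i I)
  have "continuous_on B (\<lambda>z. \<Sum>i\<in>I. c i * f i z)"
    using insert.prems by (intro continuous_intros) auto
  then have "ray_integral k y0 (\<lambda>z. c i * f i z + 1 * (\<Sum>i\<in>I. c i * f i z)) y
     = c i * ray_integral k y0 (f i) y + 1 * ray_integral k y0 (\<lambda>z. \<Sum>i\<in>I. c i * f i z) y"
    using insert.prems assms(2) by (intro ray_integral_lincomb) auto
  then show ?case using insert by simp
qed

text \<open>Differentiation under the integral. The derivative of
  \<open>y0 + t *\<^sub>R (y - y0)\<close> in \<open>y\<close> is \<open>t\<close> times the
  identity, which raises the weight from \<open>k\<close> to \<open>Suc k\<close>.\<close>

lemma ray_integral_has_derivative:
  assumes g: "Ck_on (Suc 0) g B" and y: "y \<in> B"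
  shows "(ray_integral k y0 g has_derivative
    (\<lambda>v. ray_integral (Suc k) y0 (\<lambda>z. frechet_derivative g (at z) v) y)) (at y)"
proof -
  let ?D = "\<lambda>z. frechet_derivative g (at z)"
  have diff: "g differentiable at z" if "z \<in> B" for z using g that by simp
  have cont: "continuous_on B (\<lambda>z. ?D z v)" for v using g by simp
  \<comment> \<open>\<open>leibniz_rule\<close> takes the derivative of the integrand as a bounded
    linear map, jointly continuous in \<open>(y, t)\<close>. In finite dimension this continuity can
    be checked on basis vectors.\<close>
  define gx where "gx y t = Blinfun (\<lambda>v. t ^ Suc k * ?D (y0 + t *\<^sub>R (y - y0)) v)" for y and t :: real
  have gx: "blinfun_apply (gx y t) = (\<lambda>v. t ^ Suc k * ?D (y0 + t *\<^sub>R (y - y0)) v)"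
    if "y \<in> B" "t \<in> cbox 0 1" for y t
    unfolding gx_def
  proof (rule bounded_linear_Blinfun_apply)
    have "linear (?D (y0 + t *\<^sub>R (y - y0)))"
      using diff ray_in_convex[OF B(2,3) that] linear_frechet_derivative by blast
    then show "bounded_linear (\<lambda>v. t ^ Suc k * ?D (y0 + t *\<^sub>R (y - y0)) v)"
      by (intro bounded_linear_const_mult) (simp add: linear_conv_bounded_linear)
  qed
  have cont_gx: "continuous_on (B \<times> cbox 0 1) (\<lambda>(y, t). gx y t)"
  proof (rule continuous_on_blinfun_componentwise)
    fix b :: 'e
    have "continuous_on (B \<times> cbox 0 1) (\<lambda>(y, t). t ^ Suc k * ?D (y0 + t *\<^sub>R (y - y0)) b)"
      by (rule continuous_on_ray_integrand[OF cont])
    then show "continuous_on (B \<times> cbox 0 1) (\<lambda>x. blinfun_apply (case x of (y, t) \<Rightarrow> gx y t) b)"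
      by (rule continuous_on_eq) (auto simp: gx)
  qed
  have "((\<lambda>y. integral (cbox 0 1) (\<lambda>t. t ^ k * g (y0 + t *\<^sub>R (y - y0)))) has_derivative
     blinfun_apply (integral (cbox 0 1) (gx y))) (at y within B)"
  proof (rule leibniz_rule[OF _ _ cont_gx y B(2)])
    fix x and t :: real assume xt: "x \<in> B" "t \<in> cbox 0 1"
    let ?z = "y0 + t *\<^sub>R (x - y0)"
    have z: "?z \<in> B" by (rule ray_in_convex[OF B(2,3) xt])
    have "((\<lambda>x. y0 + t *\<^sub>R (x - y0)) has_derivative (\<lambda>v. t *\<^sub>R v)) (at x within B)"
      by (auto intro!: derivative_eq_intros)
    moreover have "(g has_derivative ?D ?z) (at ?z)"
      using diff[OF z] by (simp add: frechet_derivative_works[symmetric])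
    ultimately have "((\<lambda>x. g (y0 + t *\<^sub>R (x - y0))) has_derivative (\<lambda>v. ?D ?z (t *\<^sub>R v))) (at x within B)"
      by (rule has_derivative_compose)
    then have "((\<lambda>x. t ^ k * g (y0 + t *\<^sub>R (x - y0))) has_derivative (\<lambda>v. t ^ k * ?D ?z (t *\<^sub>R v))) (at x within B)"
      by (rule has_derivative_mult_right)
    moreover have "t ^ k * ?D ?z (t *\<^sub>R v) = t ^ Suc k * ?D ?z v" for v
      using linear_cmul[OF linear_frechet_derivative[OF diff[OF z]]] by simp
    ultimately show "((\<lambda>x. t ^ k * g (y0 + t *\<^sub>R (x - y0))) has_derivative blinfun_apply (gx x t)) (at x within B)"
      using xt by (simp add: gx)
  next
    have "continuous_on B g"
      using diff by (simp add: continuous_at_imp_continuous_on differentiable_imp_continuous_within)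
    then show "(\<lambda>t. t ^ k * g (y0 + t *\<^sub>R (x - y0))) integrable_on cbox 0 1" if "x \<in> B" for x
      using that by (rule ray_integrand_integrable)
  qed
  then have "(ray_integral k y0 g has_derivative blinfun_apply (integral (cbox 0 1) (gx y))) (at y)"
    using y B(1) at_within_open[OF y B(1)] by (simp add: ray_integral_def[abs_def])
  moreover have "blinfun_apply (integral (cbox 0 1) (gx y)) v
      = ray_integral (Suc k) y0 (\<lambda>z. frechet_derivative g (at z) v) y" for v
  proof -
    have "continuous_on (cbox 0 1) (\<lambda>t. (\<lambda>(y, t). gx y t) (y, t))"
      by (rule continuous_on_compose2[OF cont_gx]) (use y in \<open>auto intro!: continuous_intros\<close>)
    then have "gx y integrable_on cbox 0 1" by (intro integrable_continuous) simp
    then have "blinfun_apply (integral (cbox 0 1) (gx y)) v = integral (cbox 0 1) (\<lambda>t. blinfun_apply (gx y t) v)"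
      by (rule blinfun_apply_integral)
    also have "\<dots> = ray_integral (Suc k) y0 (\<lambda>z. frechet_derivative g (at z) v) y"
      unfolding ray_integral_def by (rule integral_cong) (simp only: gx[OF y])
    finally show ?thesis .
  qed
  ultimately show ?thesis by (metis (no_types, lifting) ext)
qed

text \<open>Generalized over the weight, since each derivative raises \<open>k\<close> by one while
  replacing \<open>g\<close> by a directional derivative.\<close>

lemma Ck_on_ray_integral: "Ck_on j g B \<Longrightarrow> Ck_on j (ray_integral k y0 g) B"
proof (induction j arbitrary: g k)
  case 0
  then show ?case
    unfolding ray_integral_def[abs_def] Ck_on.simps
    by (intro integral_continuous_on_param continuous_on_ray_integrand) simp
next
  case (Suc j)
  then have "Ck_on (Suc 0) g B" by (elim Ck_on_mono) simp
  from ray_integral_has_derivative[OF this]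
  have D: "(ray_integral k y0 g has_derivative
    (\<lambda>v. ray_integral (Suc k) y0 (\<lambda>z. frechet_derivative g (at z) v) y)) (at y)" if "y \<in> B" for y
    using that .
  have "Ck_on j (\<lambda>y. frechet_derivative (ray_integral k y0 g) (at y) v) B" for v
  proof (subst Ck_on_cong[OF B(1)])
    show "frechet_derivative (ray_integral k y0 g) (at y) v
      = ray_integral (Suc k) y0 (\<lambda>z. frechet_derivative g (at z) v) y" if "y \<in> B" for y
      using frechet_derivative_eqI[OF D[OF that]] by simp
    show "Ck_on j (ray_integral (Suc k) y0 (\<lambda>z. frechet_derivative g (at z) v)) B"
      using Suc by simp
  qed
  then show ?case using D by (auto simp: differentiable_def)
qed

text \<open>Integrates the \<open>t\<close>-derivative of
  \<open>t ^ Suc k * g (y0 + t *\<^sub>R (y - y0))\<close> over the unit interval. The exponent is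
  positive even for \<open>k = 0\<close>, so the boundary term at 0 vanishes and only
  \<open>g y\<close> remains.\<close>

lemma ray_integral_fundamental_theorem:
  assumes g: "Ck_on (Suc 0) g B" and y: "y \<in> B"
  shows "real (Suc k) * ray_integral k y0 g y
      + ray_integral (Suc k) y0 (\<lambda>z. frechet_derivative g (at z) (y - y0)) y = g y"
proof -
  let ?z = "\<lambda>t. y0 + t *\<^sub>R (y - y0)" and ?D = "\<lambda>z. frechet_derivative g (at z) (y - y0)"
  have "((\<lambda>t. real (Suc k) * (t ^ k * g (?z t)) + t ^ Suc k * ?D (?z t)) has_integral
      (1 ^ Suc k * g (?z 1) - 0 ^ Suc k * g (?z 0))) {0..1}"
  proof (rule fundamental_theorem_of_calculus)
    fix t :: real assume t: "t \<in> {0..1}"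
    have "g differentiable at (?z t)" using g ray_in_convex[OF B(2,3) y] t by simp
    then have "((\<lambda>t. g (?z t)) has_real_derivative ?D (?z t)) (at t)"
      unfolding has_real_derivative_iff_has_vector_derivative
      by (intro has_derivative_along_line) (simp add: frechet_derivative_works[symmetric])
    from DERIV_mult[OF DERIV_pow[of "Suc k"] this]
    have "((\<lambda>t. t ^ Suc k * g (?z t)) has_real_derivative
       real (Suc k) * (t ^ k * g (?z t)) + t ^ Suc k * ?D (?z t)) (at t)"
      by (simp add: mult_ac del: of_nat_Suc power_Suc)
    then show "((\<lambda>t. t ^ Suc k * g (?z t)) has_vector_derivative
       real (Suc k) * (t ^ k * g (?z t)) + t ^ Suc k * ?D (?z t)) (at t within {0..1})"
      by (simp add: has_real_derivative_iff_has_vector_derivative has_vector_derivative_at_within)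
  qed simp
  from integral_unique[OF this]
  have "integral (cbox 0 1) (\<lambda>t. real (Suc k) * (t ^ k * g (?z t)) + t ^ Suc k * ?D (?z t)) = g y"
    by simp
  moreover have "continuous_on B g" "continuous_on B ?D"
    using g Ck_on_Suc_imp[OF g] by simp_all
  then have "integral (cbox 0 1) (\<lambda>t. real (Suc k) * (t ^ k * g (?z t)) + t ^ Suc k * ?D (?z t))
     = real (Suc k) * ray_integral k y0 g y + ray_integral (Suc k) y0 ?D y"
    unfolding ray_integral_def using ray_integrand_integrable[OF _ y]
    by (subst integral_add) (auto intro!: integrable_on_mult_right simp del: power_Suc of_nat_Suc)
  ultimately show ?thesis by simp
qed

lemma multilinear_list_ray_integral:
  fixes F :: "'e \<Rightarrow> 'w::real_vector list \<Rightarrow> real"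
  assumes "\<And>z. z \<in> B \<Longrightarrow> multilinear_list k (F z)"
    and "\<And>vs. length vs = k \<Longrightarrow> continuous_on B (\<lambda>z. F z vs)" and "y \<in> B"
  shows "multilinear_list k (\<lambda>vs. ray_integral m y0 (\<lambda>z. F z vs) y)"
  unfolding multilinear_list_def
proof (intro allI impI)
  fix ps qs :: "'w list" and u w and a b :: real assume len: "Suc (length ps + length qs) = k"
  have "ray_integral m y0 (\<lambda>z. F z (ps @ (a *\<^sub>R u + b *\<^sub>R w) # qs)) y
      = ray_integral m y0 (\<lambda>z. a * F z (ps @ u # qs) + b * F z (ps @ w # qs)) y"
    by (rule ray_integral_cong[OF _ assms(3)])
       (use assms(1) len in \<open>auto simp: multilinear_list_def\<close>)
  also have "\<dots> = a * ray_integral m y0 (\<lambda>z. F z (ps @ u # qs)) y + b * ray_integral m y0 (\<lambda>z. F z (ps @ w # qs)) y"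
    using len assms by (intro ray_integral_lincomb) auto
  finally show "ray_integral m y0 (\<lambda>z. F z (ps @ (a *\<^sub>R u + b *\<^sub>R w) # qs)) y
    = a *\<^sub>R ray_integral m y0 (\<lambda>z. F z (ps @ u # qs)) y + b *\<^sub>R ray_integral m y0 (\<lambda>z. F z (ps @ w # qs)) y"
    by simp
qed

text \<open>The primitive is the contraction of \<open>W\<close> with the radial vector field, integrated along rays.\<close>

lemma poincare_lemma:
  fixes W :: "'e \<Rightarrow> 'e list \<Rightarrow> real"
  assumes alt: "\<And>y. y \<in> B \<Longrightarrow> W y \<in> alt_maps (Suc k) UNIV"
    and smooth: "\<And>us. length us = Suc k \<Longrightarrow> smooth_on B (\<lambda>y. W y us)"
    and closed: "\<And>y us. y \<in> B \<Longrightarrow> length us = Suc (Suc k) \<Longrightarrow> flat_ext_deriv (Suc k) W y us = 0"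
  obtains \<theta> where "\<And>y. y \<in> B \<Longrightarrow> \<theta> y \<in> alt_maps k UNIV"
    and "\<And>us. length us = k \<Longrightarrow> smooth_on B (\<lambda>y. \<theta> y us)"
    and "\<And>y us. y \<in> B \<Longrightarrow> length us = Suc k \<Longrightarrow> flat_ext_deriv k \<theta> y us = W y us"
proof
  define \<theta> where "\<theta> y us = ray_integral k y0 (\<lambda>z. W z ((y - y0) # us)) y" for y us
  define G where "G us y = ray_integral k y0 (\<lambda>z. W z us) y" for us y
  define W' where "W' w z us = frechet_derivative (\<lambda>z. W z us) (at z) w" for w z us
  define G' where "G' w us y = ray_integral (Suc k) y0 (\<lambda>z. W' w z us) y" for w us y
  have C: "Ck_on j (\<lambda>z. W z us) B" if "length us = Suc k" for us j
    using smooth[OF that] unfolding smooth_on_def by blast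
  have contW: "continuous_on B (\<lambda>z. W z us)" if "length us = Suc k" for us
    using C[OF that, of 0] by simp
  have contW': "continuous_on B (\<lambda>z. W' w z us)" if "length us = Suc k" for us w
    using C[OF that, of "Suc 0"] unfolding W'_def by simp
  have mlW: "multilinear_list (Suc k) (W z)" if "z \<in> B" for z
    using alt[OF that] by (rule alt_maps_multilinear)
  have derW: "((\<lambda>z. W z us) has_derivative (\<lambda>w. W' w z us)) (at z)" if "length us = Suc k" "z \<in> B" for us z
    unfolding W'_def using C[OF that(1), of "Suc 0"] that(2)
    by (simp add: frechet_derivative_works[symmetric])
  have mlW': "multilinear_list (Suc k) (W' w z)" if "z \<in> B" for w z
    by (rule multilinear_list_has_derivative[OF B(1) that mlW derW]) (use that in auto)
  have mlG: "multilinear_list (Suc k) (\<lambda>us. G us y)" if "y \<in> B" for y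
    unfolding G_def by (rule multilinear_list_ray_integral[OF mlW contW that])
  have mlG': "multilinear_list (Suc k) (\<lambda>us. G' w us y)" if "y \<in> B" for y w
    unfolding G'_def by (rule multilinear_list_ray_integral[OF mlW' contW' that])
  \<comment> \<open>The point \<open>y\<close> enters \<theta> twice, through the radial vector and
    through the ray. Expanding the radial vector separates the two dependencies into products, to
    which the product rule applies.\<close>
  have \<theta>_sum: "\<theta> y us = (\<Sum>b\<in>Basis. ((y - y0) \<bullet> b) * G (b # us) y)" if "y \<in> B" "length us = k" for y us
    using multilinear_list_expand[OF mlG[OF that(1)], of "[]" us "y - y0"] that(2)
    unfolding \<theta>_def G_def by simp
  show "\<theta> y \<in> alt_maps k UNIV" if y: "y \<in> B" for y
    unfolding alt_maps_def mem_Collect_eq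
  proof (intro conjI allI impI)
    fix vs :: "'e list" assume "\<not> (length vs = k \<and> set vs \<subseteq> UNIV)"
    then have "ray_integral k y0 (\<lambda>z. W z ((y - y0) # vs)) y = ray_integral k y0 (\<lambda>z. 0) y"
      using alt by (intro ray_integral_cong y) (auto simp: alt_maps_def)
    then show "\<theta> y vs = 0" by (simp add: \<theta>_def ray_integral_def)
  next
    fix vs :: "'e list" and i and u w :: 'e and a b :: real
    assume as: "length vs = k \<and> set vs \<subseteq> UNIV \<and> i < k \<and> u \<in> UNIV \<and> w \<in> UNIV"
    then have "vs[i := x] = take i vs @ x # drop (Suc i) vs" for x
      by (simp add: upd_conv_take_nth_drop)
    then show "\<theta> y (vs[i := a *\<^sub>R u + b *\<^sub>R w]) = a *\<^sub>R \<theta> y (vs[i := u]) + b *\<^sub>R \<theta> y (vs[i := w])"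
      using as mlG[OF y, unfolded multilinear_list_def, rule_format,
          of "(y - y0) # take i vs" "drop (Suc i) vs" a u b w]
      unfolding \<theta>_def G_def by simp
  next
    fix vs :: "'e list" and i j
    assume as: "length vs = k \<and> set vs \<subseteq> UNIV \<and> i < j \<and> j < k \<and> vs ! i = vs ! j"
    have "W z ((y - y0) # vs) = 0" if "z \<in> B" for z
    proof -
      have "length ((y - y0) # vs) = Suc k" "Suc i < Suc j" "Suc j < Suc k"
        "((y - y0) # vs) ! Suc i = ((y - y0) # vs) ! Suc j" using as by auto
      then show ?thesis using alt[OF that] unfolding alt_maps_def mem_Collect_eq by blast
    qed
    then have "ray_integral k y0 (\<lambda>z. W z ((y - y0) # vs)) y = ray_integral k y0 (\<lambda>z. 0) y"
      by (intro ray_integral_cong y) auto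
    then show "\<theta> y vs = 0" by (simp add: \<theta>_def ray_integral_def)
  qed
  show "smooth_on B (\<lambda>y. \<theta> y us)" if us: "length us = k" for us
    unfolding smooth_on_def
  proof
    fix j
    have lin: "Ck_on j (\<lambda>y. (y - y0) \<bullet> b) B" for b
    proof -
      have "Ck_on j (\<lambda>y. y \<bullet> b + - (y0 \<bullet> b)) B"
        by (intro Ck_on_add[OF B(1)] Ck_on_const Ck_on_linear bounded_linear_inner_left)
      then show ?thesis by (simp add: inner_diff_left)
    qed
    have "Ck_on j (G (b # us)) B" for b
      unfolding G_def[abs_def] using us by (intro Ck_on_ray_integral C) simp
    then have "Ck_on j (\<lambda>y. \<Sum>b\<in>Basis. ((y - y0) \<bullet> b) * G (b # us) y) B"
      using lin by (intro Ck_on_sum[OF B(1)] Ck_on_mult[OF B(1)]) auto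
    then show "Ck_on j (\<lambda>y. \<theta> y us) B"
      by (subst Ck_on_cong[OF B(1) \<theta>_sum[OF _ us]])
  qed
  \<comment> \<open>\<open>G\<close> stems from differentiating the radial vector, \<open>G'\<close>
    from differentiating the integral along the ray.\<close>
  have D\<theta>: "frechet_derivative (\<lambda>y. \<theta> y us) (at y) w = G (w # us) y + G' w ((y - y0) # us) y"
    if y: "y \<in> B" and us: "length us = k" for y us w
  proof -
    have DG: "(G (b # us) has_derivative (\<lambda>w. G' w (b # us) y)) (at y)" for b
      unfolding G_def[abs_def] G'_def W'_def
      using us by (intro ray_integral_has_derivative y C) simp
    have "((\<lambda>y. \<Sum>b\<in>Basis. ((y - y0) \<bullet> b) * G (b # us) y) has_derivative
      (\<lambda>w. \<Sum>b\<in>Basis. ((y - y0) \<bullet> b) * G' w (b # us) y + (w \<bullet> b) * G (b # us) y)) (at y)"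
      by (intro has_derivative_sum has_derivative_mult DG) (auto intro!: derivative_eq_intros)
    then have "((\<lambda>y. \<theta> y us) has_derivative
      (\<lambda>w. \<Sum>b\<in>Basis. ((y - y0) \<bullet> b) * G' w (b # us) y + (w \<bullet> b) * G (b # us) y)) (at y)"
      by (rule has_derivative_transform_within_open[OF _ B(1) y]) (simp add: \<theta>_sum us)
    from frechet_derivative_eqI[OF this] show ?thesis
      using multilinear_list_expand[OF mlG[OF y], of "[]" us w]
        multilinear_list_expand[OF mlG'[OF y, of w], where ps = "[]" and qs = us and u = "y - y0"] us
      by (simp add: sum.distrib)
  qed
  show "flat_ext_deriv k \<theta> y us = W y us" if y: "y \<in> B" and us: "length us = Suc k" for y us
  proof -
    have len: "length (delete_nth i us) = k" if "i \<le> k" for i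
      using us that by (simp add: length_delete_nth)
    have "flat_ext_deriv k \<theta> y us = (\<Sum>i\<le>k. (- 1) ^ i * G (us ! i # delete_nth i us) y)
       + (\<Sum>i\<le>k. (- 1) ^ i * G' (us ! i) ((y - y0) # delete_nth i us) y)"
      unfolding flat_ext_deriv_def sum.distrib[symmetric]
      by (rule sum.cong) (auto simp: D\<theta> y len distrib_left)
    \<comment> \<open>All \<open>k + 1\<close> summands agree: the sign of summand \<open>i\<close>
      is the cost of moving its first argument back to position \<open>i\<close>.\<close>
    also have "(\<Sum>i\<le>k. (- 1) ^ i * G (us ! i # delete_nth i us) y) = real (Suc k) * G us y"
    proof -
      have "(- 1) ^ i * G (us ! i # delete_nth i us) y = G us y" if "i \<le> k" for i
      proof -
        \<comment> \<open>The summand \<open>0 * W z us\<close> only brings the scaling into the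
          shape of \<open>ray_integral_lincomb\<close>.\<close>
        have "(- 1) ^ i * G (us ! i # delete_nth i us) y
          = ray_integral k y0 (\<lambda>z. (- 1) ^ i * W z (us ! i # delete_nth i us) + 0 * W z us) y"
          unfolding G_def using contW len[OF that] us y by (subst ray_integral_lincomb) auto
        also have "\<dots> = G us y"
          unfolding G_def using alt_maps_nth_delete[of "W z" us i for z] alt us that
          by (intro ray_integral_cong[OF _ y]) auto
        finally show ?thesis .
      qed
      then show ?thesis by simp
    qed
    also have "(\<Sum>i\<le>k. (- 1) ^ i * G' (us ! i) ((y - y0) # delete_nth i us) y)
        = ray_integral (Suc k) y0 (\<lambda>z. W' (y - y0) z us) y"
    proof -
      have "(\<Sum>i\<le>k. (- 1) ^ i * G' (us ! i) ((y - y0) # delete_nth i us) y)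
        = ray_integral (Suc k) y0 (\<lambda>z. \<Sum>i\<le>k. (- 1) ^ i * W' (us ! i) z ((y - y0) # delete_nth i us)) y"
        unfolding G'_def using contW' len y by (subst ray_integral_sum) auto
      also have "\<dots> = ray_integral (Suc k) y0 (\<lambda>z. W' (y - y0) z us) y"
      proof (rule ray_integral_cong[OF _ y])
        fix z assume "z \<in> B"
        \<comment> \<open>Closedness at \<open>z\<close>, with the vector \<open>y - y0\<close>,
          constant in \<open>z\<close>, as first argument. Summand 0 of \<open>dW\<close> is the
          derivative along the ray; the others, shifted by one, form the sum in question with
          opposite sign.\<close>
        have "flat_ext_deriv (Suc k) W z ((y - y0) # us) = 0"
          using closed[OF \<open>z \<in> B\<close>] us by simp
        then have "W' (y - y0) z us - (\<Sum>i\<le>k. (- 1) ^ i * W' (us ! i) z ((y - y0) # delete_nth i us)) = 0"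
          unfolding flat_ext_deriv_def W'_def
          by (simp add: sum.atMost_Suc_shift delete_nth_def sum_negf del: sum.atMost_Suc)
        then show "(\<Sum>i\<le>k. (- 1) ^ i * W' (us ! i) z ((y - y0) # delete_nth i us)) = W' (y - y0) z us"
          by simp
      qed
      finally show ?thesis .
    qed
    also have "real (Suc k) * G us y + \<dots> = W y us"
      unfolding G_def W'_def by (rule ray_integral_fundamental_theorem[OF C[OF us] y])
    finally show ?thesis .
  qed
qed

end

section \<open>Alternating maps as a normed space\<close>

text \<open>Pullback along a map that is linear on \<open>U\<close> only; \<open>restr\<close>
  restores the value 0 that \<open>alt_maps\<close> demands on lists outside
  \<open>U\<close>.\<close>

lemma alt_maps_compose_restr:
  assumes h: "h \<in> alt_maps k V"
    and U: "\<And>u w a b. u \<in> U \<Longrightarrow> w \<in> U \<Longrightarrow> a *\<^sub>R u + b *\<^sub>R w \<in> U"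
    and L: "\<And>u. u \<in> U \<Longrightarrow> L u \<in> V"
      "\<And>u w a b. u \<in> U \<Longrightarrow> w \<in> U \<Longrightarrow> L (a *\<^sub>R u + b *\<^sub>R w) = a *\<^sub>R L u + b *\<^sub>R L w"
  shows "restr k U (\<lambda>us. h (map L us)) \<in> alt_maps k U"
  unfolding alt_maps_def mem_Collect_eq
proof (intro conjI allI impI)
  fix vs i u w and a b :: real
  assume as: "length vs = k \<and> set vs \<subseteq> U \<and> i < k \<and> u \<in> U \<and> w \<in> U"
  have sub: "set (vs[i := x]) \<subseteq> U" if "x \<in> U" for x
    using as that set_update_subset_insert[of vs i x] by auto
  have "h ((map L vs)[i := a *\<^sub>R L u + b *\<^sub>R L w])
      = a *\<^sub>R h ((map L vs)[i := L u]) + b *\<^sub>R h ((map L vs)[i := L w])"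
  proof -
    have "length (map L vs) = k" "set (map L vs) \<subseteq> V" "i < k" "L u \<in> V" "L w \<in> V"
      using as L(1) by auto
    then show ?thesis using h unfolding alt_maps_def mem_Collect_eq by blast
  qed
  then show "restr k U (\<lambda>us. h (map L us)) (vs[i := a *\<^sub>R u + b *\<^sub>R w])
    = a *\<^sub>R restr k U (\<lambda>us. h (map L us)) (vs[i := u]) + b *\<^sub>R restr k U (\<lambda>us. h (map L us)) (vs[i := w])"
    using as sub U L(2) by (simp add: restr_def map_update)
next
  fix vs i j
  assume as: "length vs = k \<and> set vs \<subseteq> U \<and> i < j \<and> j < k \<and> vs ! i = vs ! j"
  have "length (map L vs) = k" "set (map L vs) \<subseteq> V" "map L vs ! i = map L vs ! j" "i < j" "j < k"
    using as L(1) by auto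
  then have "h (map L vs) = 0" using h unfolding alt_maps_def mem_Collect_eq by blast
  then show "restr k U (\<lambda>us. h (map L us)) vs = 0" by (simp add: restr_def)
qed (auto simp: restr_def)

lemma alt_maps_wrong_length: "h \<in> alt_maps k V \<Longrightarrow> length vs \<noteq> k \<Longrightarrow> h vs = 0"
  unfolding alt_maps_def by blast

lemma alt_maps_outside: "h \<in> alt_maps k V \<Longrightarrow> \<not> (length vs = k \<and> set vs \<subseteq> V) \<Longrightarrow> h vs = 0"
  unfolding alt_maps_def by blast

lemma alt_maps_compose:
  assumes h: "h \<in> alt_maps k V" and L: "\<And>u. L u \<in> V"
    "\<And>u w a b. L (a *\<^sub>R u + b *\<^sub>R w) = a *\<^sub>R L u + b *\<^sub>R L w"
  shows "(\<lambda>us. h (map L us)) \<in> alt_maps k UNIV"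
proof -
  have "restr k UNIV (\<lambda>us. h (map L us)) = (\<lambda>us. h (map L us))"
    by (auto simp: restr_def fun_eq_iff alt_maps_wrong_length[OF h])
  then show ?thesis using alt_maps_compose_restr[OF h, of UNIV L] L by simp
qed

lemma alt_maps_component: "h \<in> alt_maps k V \<Longrightarrow> (\<lambda>us. h us $ i) \<in> alt_maps k V"
  unfolding alt_maps_def by auto

lemma alt_maps_vec: "(\<And>i. h i \<in> alt_maps k V) \<Longrightarrow> (\<lambda>us. \<chi> i. h i us) \<in> alt_maps k V"
  unfolding alt_maps_def by (auto simp: vec_eq_iff)

lemma Rep_alt_form_add:
  "Rep_alt_form (h + g :: ('n::finite, 'm::finite, 'k::finite) alt_form) = Rep_alt_form h + Rep_alt_form g"
  unfolding plus_alt_form_def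
  using alt_maps_lincomb[OF Rep_alt_form[of h] Rep_alt_form[of g], of 1 1]
  by (simp add: Abs_alt_form_inverse)

lemma Rep_alt_form_scaleR:
  "Rep_alt_form (r *\<^sub>R h :: ('n::finite, 'm::finite, 'k::finite) alt_form) = r *\<^sub>R Rep_alt_form h"
  unfolding scaleR_alt_form_def
  using alt_maps_lincomb[OF Rep_alt_form[of h] Rep_alt_form[of h], of r 0]
  by (simp add: Abs_alt_form_inverse)

lemma alt_coeffs_isometry: "norm (alt_coeffs h) = norm h"
  by (simp add: norm_eq_sqrt_inner inner_alt_form_def)

lemma alt_coeffs_linear: "linear alt_coeffs"
  by (rule linearI) (simp_all add: alt_coeffs_def vec_eq_iff Rep_alt_form_add Rep_alt_form_scaleR scaleR_fun_def)

text \<open>\<open>alt_coeffs\<close> embeds \<open>alt_form\<close> isometrically into a Euclidean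
  space. The left inverse carries what is proved there componentwise back to
  \<open>alt_form\<close>.\<close>

lemma alt_coeffs_left_inverse:
  "\<exists>g. bounded_linear g \<and> (\<forall>h :: ('n::finite, 'm::finite, 'k::finite) alt_form. g (alt_coeffs h) = h)"
proof -
  have "inj (alt_coeffs :: ('n, 'm, 'k) alt_form \<Rightarrow> _)"
    unfolding linear_injective_0[OF alt_coeffs_linear] by (metis alt_coeffs_isometry norm_eq_zero)
  from linear_injective_left_inverse[OF alt_coeffs_linear this]
  obtain g where "linear g" "g \<circ> (alt_coeffs :: ('n, 'm, 'k) alt_form \<Rightarrow> _) = id" by blast
  then show ?thesis by (metis comp_apply id_apply linear_conv_bounded_linear)
qed

text \<open>Finite-dimensionality enters through the factorization of \<open>L\<close> into
  \<open>alt_coeffs\<close>, an isometry onto its image, followed by the linear map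
  \<open>L \<circ> g\<close> on a Euclidean space.\<close>

lemma bounded_linear_alt_form:
  fixes L :: "('n::finite, 'm::finite, 'k::finite) alt_form \<Rightarrow> 'v::real_normed_vector"
  assumes "linear L"
  shows "bounded_linear L"
proof -
  obtain g where g: "bounded_linear g" "\<And>h :: ('n, 'm, 'k) alt_form. g (alt_coeffs h) = h"
    using alt_coeffs_left_inverse by blast
  have "linear (L \<circ> g)" using g(1) assms by (simp add: linear_compose bounded_linear.linear)
  then have 1: "bounded_linear (L \<circ> g)" by (simp add: linear_conv_bounded_linear)
  have 2: "bounded_linear (alt_coeffs :: ('n, 'm, 'k) alt_form \<Rightarrow> _)"
    by (rule bounded_linear_intro[where K = 1])
       (simp_all add: linear_add[OF alt_coeffs_linear] linear_cmul[OF alt_coeffs_linear] alt_coeffs_isometry)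
  show ?thesis using bounded_linear_compose[OF 1 2] g(2) by (simp add: o_def)
qed

lemma bounded_linear_Rep_alt_form: "bounded_linear (\<lambda>h. Rep_alt_form h us $ i)"
  by (rule bounded_linear_alt_form, rule linearI)
     (simp_all add: Rep_alt_form_add Rep_alt_form_scaleR scaleR_fun_def)

lemma Ck_on_alt_form:
  fixes F :: "'x::real_normed_vector \<Rightarrow> ('n::finite, 'm::finite, 'k::finite) alt_form"
  assumes S: "open S" and F: "\<And>us i. length us = CARD('k) \<Longrightarrow> Ck_on j (\<lambda>x. Rep_alt_form (F x) us $ i) S"
  shows "Ck_on j F S"
proof -
  obtain g where g: "bounded_linear g" "\<And>h :: ('n, 'm, 'k) alt_form. g (alt_coeffs h) = h"
    using alt_coeffs_left_inverse by blast
  have "Ck_on j (\<lambda>x. alt_coeffs (F x)) S"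
  proof (rule Ck_on_componentwise[OF S])
    fix b :: "real^'m^('k \<Rightarrow> 'n)" assume "b \<in> Basis"
    then obtain s i where b: "b = axis s (axis i 1)" by (auto simp: Basis_vec_def)
    show "Ck_on j (\<lambda>x. alt_coeffs (F x) \<bullet> b) S"
      unfolding b inner_axis alt_coeffs_def
      using F[of "map (\<lambda>i. axis (s i) 1) (index_list :: 'k list)" i] by (simp add: length_index_list)
  qed
  from Ck_on_bounded_linear[OF S g(1) this] show ?thesis by (simp add: g(2))
qed

lemma differentiable_alt_form:
  fixes F :: "'x::real_normed_vector \<Rightarrow> ('n::finite, 'm::finite, 'k::finite) alt_form"
  assumes F: "\<And>us i. length us = CARD('k) \<Longrightarrow> (\<lambda>x. Rep_alt_form (F x) us $ i) differentiable at x"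
  shows "F differentiable at x"
proof -
  obtain g where g: "bounded_linear g" "\<And>h :: ('n, 'm, 'k) alt_form. g (alt_coeffs h) = h"
    using alt_coeffs_left_inverse by blast
  have "(\<lambda>x. alt_coeffs (F x) \<bullet> b) differentiable at x" if "b \<in> Basis" for b
  proof -
    obtain s i where b: "b = axis s (axis i 1)" using \<open>b \<in> Basis\<close> by (auto simp: Basis_vec_def)
    show ?thesis
      unfolding b inner_axis alt_coeffs_def
      using F[of "map (\<lambda>i. axis (s i) 1) (index_list :: 'k list)" i] by (simp add: length_index_list)
  qed
  then have "(\<lambda>x. \<Sum>b\<in>Basis. (alt_coeffs (F x) \<bullet> b) *\<^sub>R b) differentiable at x"
    by (intro differentiable_sum differentiable_scaleR) auto
  then have "(\<lambda>x. alt_coeffs (F x)) differentiable at x" by (simp add: euclidean_representation)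
  then have "(\<lambda>x. g (alt_coeffs (F x))) differentiable at x"
    using bounded_linear.has_derivative[OF g(1)] unfolding differentiable_def by blast
  then show ?thesis by (simp add: g(2))
qed

section \<open>Tangent vectors of manifolds\<close>

lemma linear_lincomb: "linear L \<Longrightarrow> L (a *\<^sub>R u + b *\<^sub>R w) = a *\<^sub>R L u + b *\<^sub>R L w"
  by (simp add: linear_add linear_cmul)

lemma charts_atI: "c \<in> A \<Longrightarrow> p \<in> fst c \<Longrightarrow> c \<in> charts_at A p"
  and charts_atD: "c \<in> charts_at A p \<Longrightarrow> c \<in> A" "c \<in> charts_at A p \<Longrightarrow> p \<in> fst c"
  by (simp_all add: charts_at_def)

lemma chart_at_in: "c \<in> charts_at A p \<Longrightarrow> chart_at A p \<in> charts_at A p"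
  unfolding chart_at_def by (rule someI)

abbreviation transition_deriv :: "('a, 'e::real_normed_vector) chart \<Rightarrow> ('a, 'e) chart \<Rightarrow> 'a \<Rightarrow> 'e \<Rightarrow> 'e" where
  "transition_deriv c d p \<equiv> frechet_derivative (coord_map c d id) (at (snd c p))"

text \<open>The part of an atlas on which the calculus of tangent vectors rests. It mentions no
  topology on the points and differentiates transitions once, which makes it easy to establish for
  the bundle atlas as well.\<close>

locale diff_atlas =
  fixes A :: "('a, 'e::real_normed_vector) chart set"
  assumes chart_inj: "c \<in> A \<Longrightarrow> inj_on (snd c) (fst c)"
    and open_overlap: "c \<in> A \<Longrightarrow> d \<in> A \<Longrightarrow> open (snd c ` (fst c \<inter> fst d))"
    and differentiable_transition:
      "c \<in> A \<Longrightarrow> d \<in> A \<Longrightarrow> p \<in> fst c \<Longrightarrow> p \<in> fst d \<Longrightarrow> coord_map c d id differentiable at (snd c p)"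
begin

lemma chart_inv_chart: "c \<in> A \<Longrightarrow> p \<in> fst c \<Longrightarrow> chart_inv c (snd c p) = p"
  unfolding chart_inv_def using chart_inj by (rule inv_into_f_f)

lemma coord_map_chart: "c \<in> A \<Longrightarrow> p \<in> fst c \<Longrightarrow> coord_map c d f (snd c p) = snd d (f p)"
  by (simp add: coord_map_def chart_inv_chart)

lemma open_chart_image: "c \<in> A \<Longrightarrow> open (snd c ` fst c)"
  using open_overlap[of c c] by simp

lemma linear_transition_deriv: "c \<in> charts_at A p \<Longrightarrow> d \<in> charts_at A p \<Longrightarrow> linear (transition_deriv c d p)"
  by (intro linear_frechet_derivative differentiable_transition) (auto simp: charts_at_def)

lemma transition_deriv_self: "c \<in> charts_at A p \<Longrightarrow> transition_deriv c c p u = u"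
proof -
  assume c: "c \<in> charts_at A p"
  have "transition_deriv c c p = frechet_derivative (\<lambda>y. y) (at (snd c p))"
    by (rule frechet_derivative_cong_open[OF open_chart_image])
       (use c in \<open>auto simp: charts_at_def coord_map_chart\<close>)
  then show ?thesis by simp
qed

end

text \<open>The set \<open>S\<close> makes sure that the coordinate representation near \<open>p\<close> does not involve the
  arbitrary values of the coordinate maps outside their domains.\<close>

definition chart_differentiable ::
    "('a, 'e::real_normed_vector) chart set \<Rightarrow> ('b, 'f::real_normed_vector) chart set \<Rightarrow> ('a \<Rightarrow> 'b) \<Rightarrow> 'a \<Rightarrow> bool" where
  "chart_differentiable A B f p \<longleftrightarrow> (\<forall>c\<in>charts_at A p. \<forall>d\<in>charts_at B (f p).
     coord_map c d f differentiable at (snd c p) \<and>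
     (\<exists>S. open S \<and> snd c p \<in> S \<and> S \<subseteq> snd c ` fst c \<and> (\<forall>y\<in>S. f (chart_inv c y) \<in> fst d)))"

text \<open>The chain rule for the transition from \<open>d\<close> to \<open>d'\<close>. The
  expression \<open>coord_map c d' f\<close> factors through \<open>d\<close> only where
  \<open>f\<close> stays in the domain of \<open>d\<close>; \<open>S\<close> is an open set around
  the point where it does.\<close>

lemma frechet_derivative_coord_map_target:
  assumes "diff_atlas A" "diff_atlas B" and f: "chart_differentiable A B f p"
    and c: "c \<in> charts_at A p" and d: "d \<in> charts_at B (f p)" "d' \<in> charts_at B (f p)"
  shows "frechet_derivative (coord_map c d' f) (at (snd c p)) v
       = transition_deriv d d' (f p) (frechet_derivative (coord_map c d f) (at (snd c p)) v)"
proof -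
  interpret A: diff_atlas A by fact
  interpret B: diff_atlas B by fact
  obtain S where S: "open S" "snd c p \<in> S" "\<And>y. y \<in> S \<Longrightarrow> f (chart_inv c y) \<in> fst d"
    using f[unfolded chart_differentiable_def, rule_format, OF c d(1)] by (elim conjE exE) auto
  have fp: "coord_map c d f (snd c p) = snd d (f p)"
    using c by (simp add: A.coord_map_chart charts_atD)
  have "frechet_derivative (coord_map c d' f) (at (snd c p))
      = frechet_derivative (coord_map d d' id \<circ> coord_map c d f) (at (snd c p))"
    by (rule frechet_derivative_cong_open[OF S(1,2)])
       (use S(3) d in \<open>simp add: coord_map_def B.chart_inv_chart charts_atD\<close>)
  also have "\<dots> = transition_deriv d d' (f p) \<circ> frechet_derivative (coord_map c d f) (at (snd c p))"
    using f c d B.differentiable_transition[of d d' "f p"] fp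
    by (subst frechet_derivative_compose) (auto simp: chart_differentiable_def charts_atD)
  finally show ?thesis by simp
qed

text \<open>Here the factorization holds on the image of the overlap of \<open>c\<close> and
  \<open>c'\<close>, which is open. Hence a differential may be computed in any chart of the
  source.\<close>

lemma frechet_derivative_coord_map_source:
  assumes "diff_atlas A" "diff_atlas B" and f: "chart_differentiable A B f p"
    and c: "c \<in> charts_at A p" "c' \<in> charts_at A p" and d: "d \<in> charts_at B (f p)"
  shows "frechet_derivative (coord_map c d f) (at (snd c p)) v
       = frechet_derivative (coord_map c' d f) (at (snd c' p)) (transition_deriv c c' p v)"
proof -
  interpret A: diff_atlas A by fact
  have cA: "c \<in> A" "c' \<in> A" "p \<in> fst c" "p \<in> fst c'" using c by (auto simp: charts_atD)
  have "frechet_derivative (coord_map c d f) (at (snd c p))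
      = frechet_derivative (coord_map c' d f \<circ> coord_map c c' id) (at (snd c p))"
    by (rule frechet_derivative_cong_open[OF A.open_overlap[OF cA(1,2)]])
       (use cA in \<open>auto simp: coord_map_def A.chart_inv_chart\<close>)
  also have "\<dots> = frechet_derivative (coord_map c' d f) (at (snd c' p)) \<circ> transition_deriv c c' p"
    using f c d A.differentiable_transition[of c c' p] A.coord_map_chart[of c p c' id] cA
    by (subst frechet_derivative_compose) (auto simp: chart_differentiable_def)
  finally show ?thesis by simp
qed

context diff_atlas
begin

lemma chart_differentiable_id: "chart_differentiable A A id p"
  unfolding chart_differentiable_def
proof (intro ballI conjI)
  fix c d assume cd: "c \<in> charts_at A p" "d \<in> charts_at A (id p)"
  then show "coord_map c d id differentiable at (snd c p)"
    by (simp add: differentiable_transition charts_atD)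
  show "\<exists>S. open S \<and> snd c p \<in> S \<and> S \<subseteq> snd c ` fst c \<and> (\<forall>y\<in>S. id (chart_inv c y) \<in> fst d)"
    by (rule exI[of _ "snd c ` (fst c \<inter> fst d)"])
       (use cd in \<open>auto simp: charts_at_def open_overlap chart_inv_chart\<close>)
qed

text \<open>The change of target charts, applied to the identity map.\<close>

lemma transition_deriv_cocycle:
  assumes "c \<in> charts_at A p" "d \<in> charts_at A p" "e \<in> charts_at A p"
  shows "transition_deriv d e p (transition_deriv c d p v) = transition_deriv c e p v"
  using frechet_derivative_coord_map_target[OF diff_atlas_axioms diff_atlas_axioms
      chart_differentiable_id assms(1), of d e v] assms
  by simp

lemma tangent_transition:
  "v \<in> tangent_space A p \<Longrightarrow> c \<in> charts_at A p \<Longrightarrow> d \<in> charts_at A p \<Longrightarrow> transition_deriv c d p (v c) = v d"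
proof -
  assume "v \<in> tangent_space A p" "c \<in> charts_at A p" "d \<in> charts_at A p"
  then have "v d = transition_deriv c d p (v c)" unfolding tangent_space_def by blast
  then show ?thesis ..
qed

lemma tangent_outside: "v \<in> tangent_space A p \<Longrightarrow> c \<notin> charts_at A p \<Longrightarrow> v c = 0"
  unfolding tangent_space_def by blast

lemma chart_vec_in_tangent_space:
  "c \<in> charts_at A p \<Longrightarrow> chart_vec A c p u \<in> tangent_space A p"
  unfolding tangent_space_def chart_vec_def by (simp add: transition_deriv_cocycle)

lemma chart_vec_apply: "d \<in> charts_at A p \<Longrightarrow> chart_vec A c p u d = transition_deriv c d p u"
  by (simp add: chart_vec_def)

lemma chart_vec_self: "c \<in> charts_at A p \<Longrightarrow> chart_vec A c p u c = u"
  by (simp add: chart_vec_apply transition_deriv_self)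

lemma chart_vec_of_tangent:
  "v \<in> tangent_space A p \<Longrightarrow> c \<in> charts_at A p \<Longrightarrow> chart_vec A c p (v c) = v"
  by (rule ext) (simp add: chart_vec_def tangent_transition tangent_outside)

lemma chart_vec_change:
  assumes "c \<in> charts_at A p" "d \<in> charts_at A p"
  shows "chart_vec A d p u = chart_vec A c p (transition_deriv d c p u)"
  using chart_vec_of_tangent[OF chart_vec_in_tangent_space[OF assms(2)] assms(1)] assms
  by (simp add: chart_vec_apply)

lemma tangent_space_lincomb:
  "v \<in> tangent_space A p \<Longrightarrow> w \<in> tangent_space A p \<Longrightarrow> a *\<^sub>R v + b *\<^sub>R w \<in> tangent_space A p"
  by (subst tangent_space_def)
     (simp add: scaleR_fun_def linear_lincomb[OF linear_transition_deriv] tangent_transition tangent_outside)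

lemma chart_vec_lincomb:
  "c \<in> charts_at A p \<Longrightarrow> chart_vec A c p (a *\<^sub>R u + b *\<^sub>R w) = a *\<^sub>R chart_vec A c p u + b *\<^sub>R chart_vec A c p w"
  by (rule ext) (auto simp: scaleR_fun_def chart_vec_def linear_lincomb[OF linear_transition_deriv])

end

text \<open>Removes \<open>chart_at\<close> from \<open>pushforward\<close>: its chart is exchanged
  for \<open>c\<close>, and tangency of \<open>v\<close> relates the coordinates of \<open>v\<close>
  in the two.\<close>

lemma pushforward_apply:
  assumes "diff_atlas A" "diff_atlas B" "chart_differentiable A B f p" "v \<in> tangent_space A p"
    and "c \<in> charts_at A p" "d \<in> charts_at B (f p)"
  shows "pushforward A B f p v d = frechet_derivative (coord_map c d f) (at (snd c p)) (v c)"
proof -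
  interpret A: diff_atlas A by fact
  have "chart_at A p \<in> charts_at A p" by (rule chart_at_in) fact
  then show ?thesis
    using frechet_derivative_coord_map_source[OF assms(1-3,5) _ assms(6), of "chart_at A p" "v c"]
      A.tangent_transition[OF assms(4,5)] assms(6)
    by (simp add: pushforward_def)
qed

lemma pushforward_in_tangent_space:
  assumes "diff_atlas A" "diff_atlas B" "chart_differentiable A B f p" "charts_at A p \<noteq> {}"
  shows "pushforward A B f p v \<in> tangent_space B (f p)"
proof -
  obtain c where "c \<in> charts_at A p" using assms(4) by blast
  then have ca: "chart_at A p \<in> charts_at A p" by (rule chart_at_in)
  show ?thesis
    unfolding tangent_space_def mem_Collect_eq
  proof (intro conjI ballI allI impI)
    fix d e assume de: "d \<in> charts_at B (f p)" "e \<in> charts_at B (f p)"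
    then show "pushforward A B f p v e = transition_deriv d e (f p) (pushforward A B f p v d)"
      unfolding pushforward_def
      by (simp only: if_True frechet_derivative_coord_map_target[OF assms(1-3) ca de])
  qed (simp add: pushforward_def)
qed

section \<open>Alternating maps on a tangent space in coordinates\<close>

definition form_in_chart ::
  "('a, 'e::real_normed_vector) chart set \<Rightarrow> ('a, 'e) chart \<Rightarrow> 'a \<Rightarrow> (('a, 'e) tangent list \<Rightarrow> 'v) \<Rightarrow> 'e list \<Rightarrow> 'v" where
  "form_in_chart A c p \<eta> us = \<eta> (map (chart_vec A c p) us)"

text \<open>Inverse to \<open>form_in_chart\<close> between alternating maps in coordinates and on
  the tangent space. The restriction is needed because coordinates in \<open>c\<close> determine
  only tangent vectors.\<close>

definition form_from_chart ::
  "('a, 'e::real_normed_vector) chart set \<Rightarrow> nat \<Rightarrow> ('a, 'e) chart \<Rightarrow> 'a \<Rightarrow> ('e list \<Rightarrow> 'v::zero) \<Rightarrow> ('a, 'e) tangent list \<Rightarrow> 'v" where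
  "form_from_chart A k c p g = restr k (tangent_space A p) (\<lambda>vs. g (map (\<lambda>v. v c) vs))"

context diff_atlas
begin

lemma form_in_chart_alt:
  "c \<in> charts_at A p \<Longrightarrow> \<eta> \<in> alt_maps k (tangent_space A p) \<Longrightarrow> form_in_chart A c p \<eta> \<in> alt_maps k UNIV"
  unfolding form_in_chart_def[abs_def]
  by (erule alt_maps_compose) (simp_all add: chart_vec_in_tangent_space chart_vec_lincomb)

lemma form_from_chart_alt:
  "g \<in> alt_maps k UNIV \<Longrightarrow> form_from_chart A k c p g \<in> alt_maps k (tangent_space A p)"
  unfolding form_from_chart_def
  by (erule alt_maps_compose_restr, rule tangent_space_lincomb, assumption+, simp_all add: scaleR_fun_def)

lemma form_in_chart_from_chart:
  assumes "c \<in> charts_at A p" "d \<in> charts_at A p" "g \<in> alt_maps k UNIV"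
  shows "form_in_chart A d p (form_from_chart A k c p g) us = g (map (transition_deriv d c p) us)"
proof (cases "length us = k")
  case True
  have "set (map (chart_vec A d p) us) \<subseteq> tangent_space A p"
    using assms(2) by (auto simp: chart_vec_in_tangent_space)
  then show ?thesis
    using True assms(1) by (simp add: form_in_chart_def form_from_chart_def restr_def chart_vec_apply o_def)
next
  case False
  then show ?thesis
    using assms(3) by (simp add: form_in_chart_def form_from_chart_def restr_def alt_maps_wrong_length)
qed

lemma form_in_chart_self:
  "c \<in> charts_at A p \<Longrightarrow> g \<in> alt_maps k UNIV \<Longrightarrow> form_in_chart A c p (form_from_chart A k c p g) = g"
  by (rule ext) (simp add: form_in_chart_from_chart transition_deriv_self cong: map_cong)

lemma form_from_chart_in_chart:
  assumes "c \<in> charts_at A p" "\<eta> \<in> alt_maps k (tangent_space A p)"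
  shows "form_from_chart A k c p (form_in_chart A c p \<eta>) = \<eta>"
proof
  fix vs
  have "map (chart_vec A c p) (map (\<lambda>v. v c) vs) = vs" if "set vs \<subseteq> tangent_space A p"
    using that by (induction vs) (auto simp: chart_vec_of_tangent[OF _ assms(1)])
  then show "form_from_chart A k c p (form_in_chart A c p \<eta>) vs = \<eta> vs"
    using alt_maps_outside[OF assms(2), of vs] by (auto simp: form_from_chart_def form_in_chart_def restr_def)
qed

lemma form_in_chart_change:
  assumes "c \<in> charts_at A p" "d \<in> charts_at A p"
  shows "form_in_chart A d p \<eta> us = form_in_chart A c p \<eta> (map (transition_deriv d c p) us)"
proof -
  have "chart_vec A d p = (\<lambda>u. chart_vec A c p (transition_deriv d c p u))"
    by (rule ext) (rule chart_vec_change[OF assms])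
  then show ?thesis unfolding form_in_chart_def by (simp add: o_def)
qed

end

section \<open>Charts of the bundle of forms\<close>

lemma smooth_manifold_chart:
  assumes "smooth_manifold T A" "c \<in> A"
  shows "openin T (fst c)" "fst c \<subseteq> topspace T" "open (snd c ` fst c)"
    "homeomorphic_map (subtopology T (fst c)) (top_of_set (snd c ` fst c)) (snd c)"
    "inj_on (snd c) (fst c)"
proof -
  show o: "openin T (fst c)" "open (snd c ` fst c)" and
    h: "homeomorphic_map (subtopology T (fst c)) (top_of_set (snd c ` fst c)) (snd c)"
    using assms unfolding smooth_manifold_def by blast+
  show sub: "fst c \<subseteq> topspace T" using o(1) by (rule openin_subset)
  show "inj_on (snd c) (fst c)"
    using homeomorphic_imp_injective_map[OF h] sub by (simp add: Int_absorb1)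
qed

lemma open_chart_imageI:
  assumes "smooth_manifold T A" "c \<in> A" "openin T W" "W \<subseteq> fst c"
  shows "open (snd c ` W)"
proof -
  note c = smooth_manifold_chart[OF assms(1,2)]
  have "openin (subtopology T (fst c)) W"
    using assms(3,4) by (metis inf.absorb_iff2 openin_subtopology_Int inf_commute)
  then have "openin (top_of_set (snd c ` fst c)) (snd c ` W)"
    using homeomorphic_imp_open_map[OF c(4)] by (simp add: open_map_def)
  then show ?thesis using c(3) openin_open_trans by blast
qed

lemma openin_chart_preimage:
  assumes "smooth_manifold T A" "c \<in> A" "open R"
  shows "openin T {p \<in> fst c. snd c p \<in> R}"
proof -
  note c = smooth_manifold_chart[OF assms(1,2)]
  have "continuous_map (subtopology T (fst c)) (top_of_set (snd c ` fst c)) (snd c)"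
    using c(4) by (rule homeomorphic_imp_continuous_map)
  then have "continuous_map (subtopology T (fst c)) euclidean (snd c)"
    by (simp add: continuous_map_in_subtopology)
  then have "openin (subtopology T (fst c)) {p \<in> topspace (subtopology T (fst c)). snd c p \<in> R}"
    using assms(3) by (intro openin_continuous_map_preimage) auto
  moreover have "{p \<in> topspace (subtopology T (fst c)). snd c p \<in> R} = {p \<in> fst c. snd c p \<in> R}"
    using c(2) by auto
  ultimately show ?thesis using c(1) openin_trans_full by metis
qed

lemma smooth_transition:
  assumes "smooth_manifold T A" "c \<in> A" "d \<in> A"
  shows "smooth_on (snd c ` (fst c \<inter> fst d)) (coord_map c d id)"
  using assms unfolding smooth_manifold_def by blast

lemma smooth_manifold_diff_atlas:
  assumes "smooth_manifold T A"
  shows "diff_atlas A"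
proof
  fix c d assume cd: "c \<in> A" "d \<in> A"
  show "inj_on (snd c) (fst c)" using smooth_manifold_chart[OF assms cd(1)] by simp
  show "open (snd c ` (fst c \<inter> fst d))"
    by (intro open_chart_imageI[OF assms cd(1)] openin_Int smooth_manifold_chart[OF assms] cd) auto
  show "coord_map c d id differentiable at (snd c p)" if "p \<in> fst c" "p \<in> fst d" for p
    using smooth_on_differentiable[OF smooth_transition[OF assms cd]] that by blast
qed

text \<open>The parameters \<open>K\<close> and \<open>M\<close> only carry the types \<open>'k\<close> and \<open>'m\<close>.\<close>

locale form_bundle_over =
  fixes T :: "'a topology" and A :: "('a, real^'n::finite) chart set"
    and K :: "'k::finite itself" and M :: "'m::finite itself"
  assumes manifold: "smooth_manifold T A"
begin

sublocale diff_atlas A by (rule smooth_manifold_diff_atlas[OF manifold])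

abbreviation bc :: "('a, real^'n) chart \<Rightarrow> (('a, 'n, 'm) bundle_point, (real^'n) \<times> ('n, 'm, 'k) alt_form) chart" where
  "bc c \<equiv> bundle_chart TYPE('k) A c"

abbreviation atl :: "(('a, 'n, 'm) bundle_point, (real^'n) \<times> ('n, 'm, 'k) alt_form) chart set" where
  "atl \<equiv> bundle_atlas TYPE('k) A"

lemma mem_bundle_chart:
  "(p, \<eta>) \<in> fst (bc c) \<longleftrightarrow> p \<in> fst c \<and> \<eta> \<in> alt_maps CARD('k) (tangent_space A p)"
  by (simp add: bundle_chart_def form_bundle_def)

lemma bundle_chart_apply: "snd (bc c) (p, \<eta>) = (snd c p, Abs_alt_form (form_in_chart A c p \<eta>))"
  by (simp add: bundle_chart_def form_in_chart_def[abs_def])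

lemma charts_at_bundleE:
  assumes "D \<in> charts_at atl (p, \<eta>)"
  obtains d where "D = bc d" "d \<in> charts_at A p" "\<eta> \<in> alt_maps CARD('k) (tangent_space A p)"
  using assms unfolding charts_at_def bundle_atlas_def
  by (auto simp: mem_bundle_chart)

lemma charts_at_bundle_iff:
  "d \<in> A \<Longrightarrow> bc d \<in> charts_at atl (p, \<eta>) \<longleftrightarrow> d \<in> charts_at A p \<and> \<eta> \<in> alt_maps CARD('k) (tangent_space A p)"
  unfolding charts_at_def bundle_atlas_def by (auto simp: mem_bundle_chart)

lemma Rep_form_in_chart:
  fixes \<eta> :: "('a, real^'n) tangent list \<Rightarrow> real^'m"
  assumes "c \<in> charts_at A p" "\<eta> \<in> alt_maps CARD('k) (tangent_space A p)"
  shows "Rep_alt_form (Abs_alt_form (form_in_chart A c p \<eta>) :: ('n, 'm, 'k) alt_form) = form_in_chart A c p \<eta>"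
  by (rule Abs_alt_form_inverse[OF form_in_chart_alt[OF assms]])

lemma inj_bundle_chart:
  assumes c: "c \<in> A"
  shows "inj_on (snd (bc c)) (fst (bc c))"
proof (rule inj_onI, clarify)
  fix p \<eta> q \<zeta>
  assume mem: "(p, \<eta>) \<in> fst (bc c)" "(q, \<zeta>) \<in> fst (bc c)" and eq: "snd (bc c) (p, \<eta>) = snd (bc c) (q, \<zeta>)"
  have "p = q" using chart_inj[OF c] mem eq by (auto simp: mem_bundle_chart bundle_chart_apply dest: inj_onD)
  have pc: "c \<in> charts_at A p" using c mem by (simp add: mem_bundle_chart charts_at_def)
  have alt: "\<eta> \<in> alt_maps CARD('k) (tangent_space A p)" "\<zeta> \<in> alt_maps CARD('k) (tangent_space A p)"
    using mem \<open>p = q\<close> by (simp_all add: mem_bundle_chart)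
  have "form_in_chart A c p \<eta> = form_in_chart A c p \<zeta>"
    using eq Rep_form_in_chart[OF pc alt(1)] Rep_form_in_chart[OF pc alt(2)] \<open>p = q\<close>
    by (simp add: bundle_chart_apply)
  then show "p = q \<and> \<eta> = \<zeta>"
    using form_from_chart_in_chart[OF pc alt(1)] form_from_chart_in_chart[OF pc alt(2)] \<open>p = q\<close> by simp
qed

lemma bundle_chart_of_coords:
  assumes "c \<in> A" "p \<in> fst c"
  shows "(p, form_from_chart A CARD('k) c p (Rep_alt_form h)) \<in> fst (bc c)"
    and "snd (bc c) (p, form_from_chart A CARD('k) c p (Rep_alt_form h)) = (snd c p, h)"
proof -
  have c: "c \<in> charts_at A p" using assms by (rule charts_atI)
  show "(p, form_from_chart A CARD('k) c p (Rep_alt_form h)) \<in> fst (bc c)"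
    using assms(2) by (simp add: mem_bundle_chart form_from_chart_alt Rep_alt_form)
  show "snd (bc c) (p, form_from_chart A CARD('k) c p (Rep_alt_form h)) = (snd c p, h)"
    by (simp add: bundle_chart_apply form_in_chart_self[OF c Rep_alt_form] Rep_alt_form_inverse)
qed

lemma chart_inv_bundle:
  assumes "c \<in> A" "p \<in> fst c"
  shows "chart_inv (bc c) (snd c p, h) = (p, form_from_chart A CARD('k) c p (Rep_alt_form h))"
  unfolding chart_inv_def
  using bundle_chart_of_coords[OF assms, of h] inj_bundle_chart[OF assms(1)] inv_into_f_f by metis

lemma bundle_chart_image_overlap:
  assumes "c \<in> A" "d \<in> A"
  shows "snd (bc c) ` (fst (bc c) \<inter> fst (bc d)) = (snd c ` (fst c \<inter> fst d)) \<times> UNIV" (is "?L = ?R")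
proof
  show "?L \<subseteq> ?R" by (auto simp: mem_bundle_chart bundle_chart_apply)
  show "?R \<subseteq> ?L"
  proof (clarify)
    fix p and h :: "('n, 'm, 'k) alt_form" assume p: "p \<in> fst c" "p \<in> fst d"
    let ?z = "(p, form_from_chart A CARD('k) c p (Rep_alt_form h))"
    have "?z \<in> fst (bc c) \<inter> fst (bc d)" "snd (bc c) ?z = (snd c p, h)"
      using bundle_chart_of_coords[OF assms(1) p(1), of h] p(2) by (auto simp: mem_bundle_chart)
    then show "(snd c p, h) \<in> ?L" by (metis imageI)
  qed
qed

text \<open>A form is evaluated on vectors, so passing from \<open>c\<close> to \<open>d\<close> in
  the fibre involves the derivative of the transition from \<open>d\<close> back to
  \<open>c\<close>.\<close>

lemma bundle_transition:
  fixes h :: "('n, 'm, 'k) alt_form"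
  assumes "c \<in> A" "d \<in> A" "p \<in> fst c" "p \<in> fst d"
  shows "coord_map (bc c) (bc d) id (snd c p, h)
    = (snd d p, Abs_alt_form (\<lambda>us. Rep_alt_form h (map (transition_deriv d c p) us)))"
proof -
  have "c \<in> charts_at A p" "d \<in> charts_at A p" using assms by (simp_all add: charts_at_def)
  then have "form_in_chart A d p (form_from_chart A CARD('k) c p (Rep_alt_form h))
    = (\<lambda>us. Rep_alt_form h (map (transition_deriv d c p) us))"
    by (intro ext form_in_chart_from_chart Rep_alt_form)
  then show ?thesis
    using assms by (simp add: coord_map_def chart_inv_bundle bundle_chart_apply)
qed

lemma linear_chart_change_alt:
  fixes h :: "('n, 'm, 'k) alt_form"
  assumes "c \<in> charts_at A p" "d \<in> charts_at A p"
  shows "(\<lambda>us. Rep_alt_form h (map (transition_deriv d c p) us)) \<in> alt_maps CARD('k) UNIV"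
  by (rule alt_maps_compose[OF Rep_alt_form]) (simp_all add: linear_lincomb linear_transition_deriv assms)

text \<open>The new fibre coordinate is linear in \<open>h\<close> and multilinear in the images of
  the arguments under the derivative of the inverse transition. That derivative depends smoothly on
  the base point, so the product rule for multilinear maps applies.\<close>

lemma differentiable_bundle_transition:
  assumes c: "c \<in> A" "d \<in> A" "p \<in> fst c" "p \<in> fst d"
  shows "coord_map (bc c) (bc d) id differentiable at (snd c p, h)"
proof -
  let ?S = "snd c ` (fst c \<inter> fst d)"
  let ?\<tau> = "coord_map c d id"
  \<comment> \<open>The transition back from \<open>d\<close> is differentiated at the
    \<open>d\<close>-coordinates \<open>?\<tau> y\<close> of the point. The total function
    \<open>F\<close> built from it is claimed to be the fibre part of the transition only over
    \<open>?S\<close>.\<close>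
  let ?L = "\<lambda>u y. frechet_derivative (coord_map d c id) (at (?\<tau> y)) u"
  define F :: "(real^'n) \<times> ('n, 'm, 'k) alt_form \<Rightarrow> ('n, 'm, 'k) alt_form" where
    "F z = Abs_alt_form (\<lambda>us. Rep_alt_form (snd z) (map (\<lambda>u. ?L u (fst z)) us))" for z
  have S: "open (?S \<times> (UNIV :: ('n, 'm, 'k) alt_form set))" "(snd c p, h) \<in> ?S \<times> UNIV"
    using c open_overlap[OF c(1,2)] by (auto intro: open_Times)
  have sm: "smooth_on ?S ?\<tau>" "smooth_on (snd d ` (fst d \<inter> fst c)) (coord_map d c id)"
    using smooth_transition[OF manifold] c by auto
  have im: "?\<tau> ` ?S \<subseteq> snd d ` (fst d \<inter> fst c)"
    using c by (auto simp: coord_map_chart)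
  have L: "smooth_on ?S (?L u)" for u
    by (rule smooth_on_frechet_derivative_along[OF open_overlap[OF c(1,2)] sm im])
  have "(\<lambda>z. Rep_alt_form (F z) us $ i) differentiable at (snd c p, h)" if us: "length us = CARD('k)" for us i
  proof -
    have fst: "(fst has_derivative fst) (at (snd c p, h))"
      by (rule bounded_linear_imp_has_derivative[OF bounded_linear_fst])
    have D: "(\<lambda>z. Rep_alt_form (snd z) (map (\<lambda>u. ?L u (fst z)) us) $ i) differentiable at (snd c p, h)"
    proof (rule differentiable_multilinear_list[OF open_UNIV UNIV_I _ _ _ us,
          where h = "\<lambda>z us. Rep_alt_form (snd z) us $ i" and L = "\<lambda>u z. ?L u (fst z)"])
      show "multilinear_list CARD('k) (\<lambda>us. Rep_alt_form (snd z) us $ i)"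
        for z :: "(real^'n) \<times> ('n, 'm, 'k) alt_form"
        by (rule alt_maps_multilinear[OF alt_maps_component[OF Rep_alt_form]])
      show "(\<lambda>z. Rep_alt_form (snd z) ws $ i) differentiable at (snd c p, h)" for ws
        by (rule bounded_linear_imp_differentiable
            [OF bounded_linear_compose[OF bounded_linear_Rep_alt_form bounded_linear_snd]])
      show "(\<lambda>z. ?L u (fst z)) differentiable at (snd c p, h)" for u
      proof -
        have "?L u differentiable at (fst (snd c p, h))"
          using smooth_on_differentiable[OF L] S(2) by auto
        then have "(?L u has_derivative frechet_derivative (?L u) (at (fst (snd c p, h)))) (at (fst (snd c p, h)))"
          by (simp only: frechet_derivative_works)
        from has_derivative_compose[OF fst this] show ?thesis unfolding differentiable_def by blast
      qed
    qed
    have "Rep_alt_form (snd z) (map (\<lambda>u. ?L u (fst z)) us) $ i = Rep_alt_form (F z) us $ i"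
      if z: "z \<in> ?S \<times> UNIV" for z
    proof -
      obtain q where q: "q \<in> fst c" "q \<in> fst d" "fst z = snd c q" using z by auto
      then have "Rep_alt_form (F z) = (\<lambda>us. Rep_alt_form (snd z) (map (transition_deriv d c q) us))"
        unfolding F_def using c
        by (simp add: Abs_alt_form_inverse linear_chart_change_alt charts_at_def coord_map_chart)
      then show ?thesis using q c by (simp add: o_def coord_map_chart)
    qed
    then show ?thesis using D differentiable_cong_open[OF S] by (metis (no_types, lifting))
  qed
  then have "F differentiable at (snd c p, h)" by (rule differentiable_alt_form)
  moreover have "(\<lambda>z. ?\<tau> (fst z)) differentiable at (snd c p, h)"
  proof -
    have "?\<tau> differentiable at (fst (snd c p, h))" using smooth_on_differentiable[OF sm(1)] S(2) by auto
    from differentiable_chain_at[OF bounded_linear_imp_differentiable[OF bounded_linear_fst] this]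
    show ?thesis by (simp add: o_def)
  qed
  ultimately have "(\<lambda>z. (?\<tau> (fst z), F z)) differentiable at (snd c p, h)"
    by (intro differentiable_Pair)
  moreover have "(?\<tau> (fst z), F z) = coord_map (bc c) (bc d) id z" if "z \<in> ?S \<times> UNIV" for z
  proof -
    obtain q g where q: "q \<in> fst c" "q \<in> fst d" "z = (snd c q, g)"
      using \<open>z \<in> ?S \<times> UNIV\<close> by auto
    then show ?thesis
      unfolding F_def using c by (simp add: bundle_transition coord_map_chart)
  qed
  ultimately show ?thesis using differentiable_cong_open[OF S] by (metis (no_types, lifting))
qed

sublocale total: diff_atlas atl
proof
  fix C D :: "(('a, 'n, 'm) bundle_point, (real^'n) \<times> ('n, 'm, 'k) alt_form) chart"
  assume "C \<in> atl" "D \<in> atl"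
  then obtain c d where cd: "C = bc c" "D = bc d" "c \<in> A" "d \<in> A" unfolding bundle_atlas_def by blast
  show "inj_on (snd C) (fst C)" using inj_bundle_chart cd by simp
  show "open (snd C ` (fst C \<inter> fst D))"
    using cd by (simp add: bundle_chart_image_overlap open_Times open_overlap)
  show "coord_map C D id differentiable at (snd C z)" if "z \<in> fst C" "z \<in> fst D" for z
    using that cd by (cases z) (simp add: mem_bundle_chart bundle_chart_apply differentiable_bundle_transition)
qed

end

section \<open>The canonical form and sections of the bundle\<close>

context form_bundle_over
begin

lemma coord_map_bundle_fst:
  assumes "c \<in> A" "p \<in> fst c"
  shows "coord_map (bc c) d fst (snd c p, h) = coord_map c d id (snd c p)"
  using assms by (simp add: coord_map_def chart_inv_bundle chart_inv_chart)

lemma coord_map_bundle_fst_has_derivative: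
  assumes c: "c \<in> charts_at A p" "d \<in> charts_at A p"
  shows "(coord_map (bc c) d fst has_derivative (\<lambda>u. transition_deriv c d p (fst u))) (at (snd c p, h))"
proof -
  have S: "open ((snd c ` fst c) \<times> (UNIV :: ('n, 'm, 'k) alt_form set))" "(snd c p, h) \<in> (snd c ` fst c) \<times> UNIV"
    using c by (auto intro!: open_Times open_chart_image simp: charts_at_def)
  have "(coord_map c d id has_derivative transition_deriv c d p) (at (fst (snd c p, h)))"
    using differentiable_transition c by (simp add: frechet_derivative_works[symmetric] charts_at_def)
  from has_derivative_compose[OF bounded_linear_imp_has_derivative[OF bounded_linear_fst] this]
  have "((\<lambda>z. coord_map c d id (fst z)) has_derivative (\<lambda>u. transition_deriv c d p (fst u))) (at (snd c p, h))" .
  then show ?thesis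
    by (rule has_derivative_transform_within_open[OF _ S])
       (use c in \<open>auto simp: charts_at_def coord_map_bundle_fst\<close>)
qed

lemma chart_differentiable_fst: "chart_differentiable atl A fst z"
  unfolding chart_differentiable_def
proof (intro ballI)
  obtain p \<eta> where z: "z = (p, \<eta>)" by fastforce
  fix C d assume C: "C \<in> charts_at atl z" and d: "d \<in> charts_at A (fst z)"
  obtain c where c: "C = bc c" "c \<in> charts_at A p" using C z charts_at_bundleE by blast
  let ?S = "(snd c ` (fst c \<inter> fst d)) \<times> (UNIV :: ('n, 'm, 'k) alt_form set)"
  have cA: "c \<in> A" "p \<in> fst c" and dA: "d \<in> A" "p \<in> fst d" using c d z by (auto simp: charts_at_def)
  have "open ?S" by (intro open_Times open_overlap cA dA open_UNIV)
  moreover have "snd C z \<in> ?S" using cA dA by (simp add: c(1) z bundle_chart_apply)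
  moreover have "?S \<subseteq> snd C ` fst C"
    using bundle_chart_image_overlap[OF cA(1) cA(1)] unfolding c(1) by auto
  moreover have "\<forall>y\<in>?S. fst (chart_inv C y) \<in> fst d"
    using cA by (auto simp: c(1) chart_inv_bundle)
  moreover have "coord_map C d fst differentiable at (snd C z)"
    using coord_map_bundle_fst_has_derivative[OF c(2), of d] d z c(1)
    unfolding differentiable_def by (auto simp: bundle_chart_apply)
  ultimately show "coord_map C d fst differentiable at (snd C z) \<and>
     (\<exists>S. open S \<and> snd C z \<in> S \<and> S \<subseteq> snd C ` fst C \<and> (\<forall>y\<in>S. fst (chart_inv C y) \<in> fst d))"
    by (intro conjI exI[of _ ?S])
qed

text \<open>In coordinates the projection is \<open>fst\<close> followed by a transition of the
  base.\<close>

lemma pushforward_fst: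
  assumes v: "v \<in> tangent_space atl (p, \<eta>)" and c: "c \<in> charts_at A p"
    and \<eta>: "\<eta> \<in> alt_maps CARD('k) (tangent_space A p)"
  shows "pushforward atl A fst (p, \<eta>) v = chart_vec A c p (fst (v (bc c)))"
proof
  fix d
  show "pushforward atl A fst (p, \<eta>) v d = chart_vec A c p (fst (v (bc c))) d"
  proof (cases "d \<in> charts_at A p")
    case True
    have "bc c \<in> charts_at atl (p, \<eta>)"
      using c \<eta> by (simp add: charts_at_bundle_iff charts_atD)
    then have "pushforward atl A fst (p, \<eta>) v d
      = frechet_derivative (coord_map (bc c) d fst) (at (snd (bc c) (p, \<eta>))) (v (bc c))"
      using True
      by (intro pushforward_apply[OF total.diff_atlas_axioms diff_atlas_axioms chart_differentiable_fst v]) auto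
    then show ?thesis
      using frechet_derivative_eqI[OF coord_map_bundle_fst_has_derivative[OF c True]] True
      by (simp add: bundle_chart_apply chart_vec_apply)
  qed (simp add: pushforward_def chart_vec_def)
qed

text \<open>At a point of the bundle, \<Theta> evaluates the form that is part of the point, and the
  fibre coordinate of \<open>bc c\<close> is this very form expressed in \<open>c\<close>. The
  result is independent of the base coordinate and linear in \<open>h\<close>, which makes
  \<open>d\<Theta>\<close> immediate to compute.\<close>

lemma local_rep_canonical_form:
  fixes h :: "('n, 'm, 'k) alt_form"
  assumes c: "c \<in> A" "p \<in> fst c"
  shows "local_rep atl (bc c) (component i (canonical_form TYPE('k) A)) us (snd c p, h)
    = Rep_alt_form h (map fst us) $ i"
proof -
  define \<eta> where "\<eta> = form_from_chart A CARD('k) c p (Rep_alt_form h)"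
  have cp: "c \<in> charts_at A p" using c by (rule charts_atI)
  have \<eta>: "\<eta> \<in> alt_maps CARD('k) (tangent_space A p)"
    unfolding \<eta>_def by (rule form_from_chart_alt[OF Rep_alt_form])
  have C: "bc c \<in> charts_at atl (p, \<eta>)" using cp c \<eta> by (simp add: charts_at_bundle_iff)
  have "canonical_form TYPE('k) A (p, \<eta>) (map (chart_vec atl (bc c) (p, \<eta>)) us) = Rep_alt_form h (map fst us)"
  proof (cases "length us = CARD('k)")
    case True
    have "set (map (chart_vec atl (bc c) (p, \<eta>)) us) \<subseteq> tangent_space atl (p, \<eta>)"
      using total.chart_vec_in_tangent_space[OF C] by auto
    then have "canonical_form TYPE('k) A (p, \<eta>) (map (chart_vec atl (bc c) (p, \<eta>)) us)
      = \<eta> (map (\<lambda>u. pushforward atl A fst (p, \<eta>) (chart_vec atl (bc c) (p, \<eta>) u)) us)"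
      using True by (simp add: canonical_form_def restr_def o_def)
    also have "(\<lambda>u. pushforward atl A fst (p, \<eta>) (chart_vec atl (bc c) (p, \<eta>) u)) = (\<lambda>u. chart_vec A c p (fst u))"
      using total.chart_vec_in_tangent_space[OF C] total.chart_vec_self[OF C]
      by (intro ext) (simp add: pushforward_fst[OF _ cp \<eta>])
    also have "\<eta> (map (\<lambda>u. chart_vec A c p (fst u)) us) = form_in_chart A c p \<eta> (map fst us)"
      by (simp add: form_in_chart_def o_def)
    also have "\<dots> = Rep_alt_form h (map fst us)"
      unfolding \<eta>_def by (simp add: form_in_chart_self[OF cp Rep_alt_form])
    finally show ?thesis .
  next
    case False
    then show ?thesis
      by (simp add: canonical_form_def restr_def alt_maps_wrong_length[OF Rep_alt_form])
  qed
  then show ?thesis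
    using c by (simp add: local_rep_def component_def chart_inv_bundle \<eta>_def)
qed

end

section \<open>Sections of the bundle and the pullback of the canonical plectic form\<close>

lemma ext_deriv_flat:
  assumes "length vs = Suc k" "set vs \<subseteq> tangent_space A p"
  shows "ext_deriv A k \<alpha> p vs = flat_ext_deriv k (\<lambda>y us. local_rep A (chart_at A p) \<alpha> us y)
    (snd (chart_at A p) p) (map (\<lambda>v. v (chart_at A p)) vs)"
  using assms by (simp add: ext_deriv_def restr_def flat_ext_deriv_def delete_nth_def Let_def)

text \<open>The form is given by coordinates in the single chart \<open>c1\<close>, as the Poincare
  lemma supplies it; every other chart sees it through the transition to \<open>c1\<close>.\<close>

locale form_section = form_bundle_over T A K M
  for T :: "'a topology" and A :: "('a, real^'n::finite) chart set"
    and K :: "'k::finite itself" and M :: "'m::finite itself" +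
  fixes c1 :: "('a, real^'n) chart" and U :: "'a set" and \<theta> :: "real^'n \<Rightarrow> (real^'n) list \<Rightarrow> real^'m"
  assumes c1: "c1 \<in> A" and U: "openin T U" "U \<subseteq> fst c1"
    and \<theta>_alt: "\<And>y. y \<in> snd c1 ` U \<Longrightarrow> \<theta> y \<in> alt_maps CARD('k) UNIV"
    and \<theta>_smooth: "\<And>us i. length us = CARD('k) \<Longrightarrow> smooth_on (snd c1 ` U) (\<lambda>y. \<theta> y us $ i)"
begin

definition sec :: "'a \<Rightarrow> ('a, 'n, 'm) bundle_point" where
  "sec p = (p, form_from_chart A CARD('k) c1 p (\<theta> (snd c1 p)))"

text \<open>The section as seen in the chart \<open>d\<close>; over \<open>U\<close> and for
  \<open>d = c1\<close> this is \<theta> itself.\<close>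

definition sec_form :: "('a, real^'n) chart \<Rightarrow> real^'n \<Rightarrow> (real^'n) list \<Rightarrow> real^'m" where
  "sec_form d = flat_pullback (coord_map d c1 id) \<theta>"

definition sec_coord :: "('a, real^'n) chart \<Rightarrow> real^'n \<Rightarrow> ('n, 'm, 'k) alt_form" where
  "sec_coord d y = Abs_alt_form (sec_form d y)"

lemma fst_sec [simp]: "fst (sec p) = p"
  by (simp add: sec_def)

lemma sec_alt: "p \<in> U \<Longrightarrow> snd (sec p) \<in> alt_maps CARD('k) (tangent_space A p)"
  unfolding sec_def by (simp add: form_from_chart_alt \<theta>_alt)

lemma sec_in_chart: "p \<in> U \<Longrightarrow> sec p \<in> fst (bc d) \<longleftrightarrow> p \<in> fst d"
  using sec_alt[of p] mem_bundle_chart[of p "snd (sec p)" d] by (simp add: sec_def)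

lemma charts_at_U: "p \<in> U \<Longrightarrow> c1 \<in> charts_at A p"
  using c1 U by (auto simp: charts_at_def)

lemma form_in_chart_sec:
  assumes "p \<in> U" "d \<in> charts_at A p"
  shows "form_in_chart A d p (snd (sec p)) = sec_form d (snd d p)"
proof
  fix us
  have "form_in_chart A d p (snd (sec p)) us = \<theta> (snd c1 p) (map (transition_deriv d c1 p) us)"
    unfolding sec_def snd_conv
    by (rule form_in_chart_from_chart) (use assms charts_at_U \<theta>_alt in auto)
  then show "form_in_chart A d p (snd (sec p)) us = sec_form d (snd d p) us"
    using assms by (simp add: sec_form_def flat_pullback_def coord_map_chart charts_atD)
qed

lemma bundle_chart_sec:
  assumes "p \<in> U" "d \<in> charts_at A p"
  shows "snd (bc d) (sec p) = (snd d p, sec_coord d (snd d p))"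
proof -
  have "snd (bc d) (sec p) = snd (bc d) (p, snd (sec p))" by (simp add: sec_def)
  then show ?thesis
    by (simp only: bundle_chart_apply form_in_chart_sec[OF assms] sec_coord_def)
qed

lemma Rep_sec_coord:
  assumes "p \<in> U" "d \<in> charts_at A p"
  shows "Rep_alt_form (sec_coord d (snd d p)) = sec_form d (snd d p)"
  unfolding sec_coord_def form_in_chart_sec[OF assms, symmetric]
  by (rule Rep_form_in_chart[OF assms(2) sec_alt[OF assms(1)]])

lemma coord_map_sec:
  assumes "p \<in> U" "p \<in> fst c" "c \<in> A" "d \<in> charts_at A p"
  shows "coord_map c (bc d) sec (snd c p) = (coord_map c d id (snd c p), sec_coord d (coord_map c d id (snd c p)))"
  using assms by (simp add: coord_map_chart bundle_chart_sec)

lemma open_U_image: "c \<in> A \<Longrightarrow> d \<in> A \<Longrightarrow> open (snd c ` (U \<inter> fst c \<inter> fst d))"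
  by (intro open_chart_imageI[OF manifold] openin_Int U smooth_manifold_chart[OF manifold]) auto

text \<open>In the chart \<open>d\<close> the section is \<theta> along the transition to
  \<open>c1\<close>, applied to derivatives of that transition: a multilinear expression in smooth
  ingredients.\<close>

lemma smooth_on_sec_coord:
  assumes d: "d \<in> A"
  shows "smooth_on (snd d ` (U \<inter> fst d)) (sec_coord d)"
  unfolding smooth_on_def
proof
  fix j
  let ?S = "snd d ` (U \<inter> fst d)" and ?\<sigma> = "coord_map d c1 id"
  have S: "open ?S" using open_U_image[OF d d] by (simp add: Int_assoc)
  have \<sigma>: "smooth_on ?S ?\<sigma>"
    by (rule smooth_on_subset[OF smooth_transition[OF manifold d c1]]) (use U in auto)
  have im: "?\<sigma> ` ?S \<subseteq> snd c1 ` U" using d by (auto simp: coord_map_chart)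
  have inS: "\<exists>p. y = snd d p \<and> p \<in> U \<and> d \<in> charts_at A p" if "y \<in> ?S" for y
    using that d by (auto simp: charts_at_def)
  show "Ck_on j (sec_coord d) ?S"
  proof (rule Ck_on_alt_form[OF S])
    fix us :: "(real^'n) list" and i assume us: "length us = CARD('k)"
    let ?as = "map (\<lambda>u y. frechet_derivative ?\<sigma> (at y) u) us"
    have "Ck_on j (\<lambda>y. \<theta> (?\<sigma> y) ([] @ map (\<lambda>a. a y) ?as) $ i) ?S"
    proof (rule Ck_on_multilinear_list[OF S, where k = "CARD('k)" and h = "\<lambda>y us. \<theta> (?\<sigma> y) us $ i"])
      show "multilinear_list CARD('k) (\<lambda>us. \<theta> (?\<sigma> y) us $ i)" if "y \<in> ?S" for y
        using that im by (intro alt_maps_multilinear alt_maps_component \<theta>_alt) auto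
      show "Ck_on j (\<lambda>y. \<theta> (?\<sigma> y) ws $ i) ?S" if "length ws = CARD('k)" for ws
        using smooth_on_compose[OF S \<sigma> \<theta>_smooth[OF that] im] unfolding smooth_on_def by blast
      show "Ck_on j a ?S" if "a \<in> set ?as" for a
        using that smooth_on_frechet_derivative[OF \<sigma>] unfolding smooth_on_def by auto
    qed (use us in simp)
    then have ck: "Ck_on j (\<lambda>y. sec_form d y us $ i) ?S"
      by (simp add: sec_form_def flat_pullback_def o_def)
    have eq: "sec_form d y us $ i = Rep_alt_form (sec_coord d y) us $ i" if "y \<in> ?S" for y
    proof -
      obtain p where "y = snd d p" "p \<in> U" "d \<in> charts_at A p" using inS[OF \<open>y \<in> ?S\<close>] by blast
      then show ?thesis by (simp add: Rep_sec_coord)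
    qed
    show "Ck_on j (\<lambda>y. Rep_alt_form (sec_coord d y) us $ i) ?S"
      by (rule Ck_on_transform[OF ck eq S])
  qed
qed

lemma smooth_on_coord_map_sec:
  assumes c: "c \<in> A" and d: "d \<in> A"
  shows "smooth_on (snd c ` (U \<inter> fst c \<inter> fst d)) (coord_map c (bc d) sec)"
  unfolding smooth_on_def
proof
  fix j
  let ?S = "snd c ` (U \<inter> fst c \<inter> fst d)" and ?\<tau> = "coord_map c d id"
  have S: "open ?S" by (rule open_U_image[OF c d])
  have \<tau>: "smooth_on ?S ?\<tau>"
    by (rule smooth_on_subset[OF smooth_transition[OF manifold c d]]) auto
  have im: "?\<tau> ` ?S \<subseteq> snd d ` (U \<inter> fst d)" using c by (auto simp: coord_map_chart)
  have ck: "Ck_on j (\<lambda>y. (?\<tau> y, sec_coord d (?\<tau> y))) ?S"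
    using \<tau> smooth_on_compose[OF S \<tau> smooth_on_sec_coord[OF d] im]
    by (intro Ck_on_Pair[OF S]) (auto simp: smooth_on_def)
  have eq: "(?\<tau> y, sec_coord d (?\<tau> y)) = coord_map c (bc d) sec y" if "y \<in> ?S" for y
  proof -
    obtain p where "y = snd c p" "p \<in> U" "p \<in> fst c" "p \<in> fst d" using \<open>y \<in> ?S\<close> by blast
    then show ?thesis using c d by (simp add: coord_map_sec charts_at_def)
  qed
  show "Ck_on j (coord_map c (bc d) sec) ?S"
    by (rule Ck_on_transform[OF ck eq S])
qed

lemma chart_differentiable_sec:
  assumes p: "p \<in> U"
  shows "chart_differentiable A atl sec p"
  unfolding chart_differentiable_def
proof (intro ballI)
  fix c D assume c: "c \<in> charts_at A p" and D: "D \<in> charts_at atl (sec p)"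
  obtain d where d: "D = bc d" "d \<in> charts_at A p"
    using D charts_at_bundleE unfolding sec_def by metis
  let ?S = "snd c ` (U \<inter> fst c \<inter> fst d)"
  have cd: "c \<in> A" "d \<in> A" "p \<in> fst c" "p \<in> fst d" using c d by (auto simp: charts_at_def)
  have "open ?S" by (rule open_U_image[OF cd(1,2)])
  moreover have pS: "snd c p \<in> ?S" using cd p by blast
  moreover have "\<forall>y\<in>?S. sec (chart_inv c y) \<in> fst D"
    using cd d by (auto simp: chart_inv_chart sec_in_chart)
  moreover have "coord_map c D sec differentiable at (snd c p)"
    using smooth_on_differentiable[OF smooth_on_coord_map_sec[OF cd(1,2)] pS] d by simp
  ultimately show "coord_map c D sec differentiable at (snd c p) \<and>
     (\<exists>S. open S \<and> snd c p \<in> S \<and> S \<subseteq> snd c ` fst c \<and> (\<forall>y\<in>S. sec (chart_inv c y) \<in> fst D))"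
    by (intro conjI exI[of _ ?S]) auto
qed

lemma sec_coord_has_derivative:
  assumes "p \<in> U" "d \<in> charts_at A p"
  shows "(sec_coord d has_derivative frechet_derivative (sec_coord d) (at (snd d p))) (at (snd d p))"
  using smooth_on_differentiable[OF smooth_on_sec_coord] assms
  by (simp add: frechet_derivative_works[symmetric] charts_at_def)

text \<open>In the charts \<open>d\<close> and \<open>bc d\<close> the section is the graph map
  \<open>y \<mapsto> (y, sec_coord d y)\<close>.\<close>

lemma pushforward_sec_apply:
  assumes p: "p \<in> U" and d: "d \<in> charts_at A p" and v: "v \<in> tangent_space A p"
  shows "pushforward A atl sec p v (bc d) = (v d, frechet_derivative (sec_coord d) (at (snd d p)) (v d))"
proof -
  have dA: "d \<in> A" "p \<in> fst d" using d by (auto simp: charts_at_def)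
  have D: "bc d \<in> charts_at atl (sec p)"
    using charts_at_bundle_iff[OF dA(1), of p "snd (sec p)"] d sec_alt[OF p] by (simp add: sec_def)
  have S: "open (snd d ` (U \<inter> fst d))" "snd d p \<in> snd d ` (U \<inter> fst d)"
    using open_U_image[OF dA(1,1)] p dA by (auto simp: Int_assoc)
  have "((\<lambda>y. (y, sec_coord d y)) has_derivative
    (\<lambda>u. (u, frechet_derivative (sec_coord d) (at (snd d p)) u))) (at (snd d p))"
    by (intro has_derivative_Pair has_derivative_ident sec_coord_has_derivative p d)
  then have "(coord_map d (bc d) sec has_derivative
    (\<lambda>u. (u, frechet_derivative (sec_coord d) (at (snd d p)) u))) (at (snd d p))"
    by (rule has_derivative_transform_within_open[OF _ S])
       (use dA in \<open>auto simp: coord_map_chart bundle_chart_sec charts_at_def\<close>)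
  from frechet_derivative_eqI[OF this] show ?thesis
    using pushforward_apply[OF diff_atlas_axioms total.diff_atlas_axioms chart_differentiable_sec[OF p] v d D]
    by simp
qed

lemma inj_on_pushforward_sec:
  assumes p: "p \<in> U"
  shows "inj_on (pushforward A atl sec p) (tangent_space A p)"
proof (rule inj_onI)
  fix v w assume vw: "v \<in> tangent_space A p" "w \<in> tangent_space A p"
    and eq: "pushforward A atl sec p v = pushforward A atl sec p w"
  note c = charts_at_U[OF p]
  have "v c1 = w c1"
    using pushforward_sec_apply[OF p c vw(1)] pushforward_sec_apply[OF p c vw(2)] eq by simp
  then show "v = w" using chart_vec_of_tangent[OF vw(1) c] chart_vec_of_tangent[OF vw(2) c] by metis
qed

lemma topspace_U: "topspace (subtopology T U) = U"
  using U(1) openin_subset by auto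

text \<open>Only generating open sets have to be tested, and over a chart \<open>d\<close> their
  preimage is the preimage of \<open>W\<close> under the graph map.\<close>

lemma continuous_map_sec: "continuous_map (subtopology T U) (bundle_topology TYPE('k) A) sec"
  unfolding bundle_topology_def
proof (rule continuous_on_generated_topo)
  fix V assume "V \<in> {{z \<in> fst c. snd c z \<in> W} | c W. c \<in> atl \<and> open W}"
  then obtain d W where V: "V = {z \<in> fst (bc d). snd (bc d) z \<in> W}" and d: "d \<in> A" and W: "open W"
    unfolding bundle_atlas_def by blast
  let ?S = "snd d ` (U \<inter> fst d)"
  have S: "open ?S" using open_U_image[OF d d] by (simp add: Int_assoc)
  have "continuous_on ?S (sec_coord d)"
    using smooth_on_sec_coord[OF d] unfolding smooth_on_def by (metis Ck_on.simps(1))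
  then have "continuous_on ?S (\<lambda>y. (y, sec_coord d y))" by (intro continuous_intros)
  from continuous_open_preimage[OF this S W]
  have R: "open (?S \<inter> (\<lambda>y. (y, sec_coord d y)) -` W)" .
  have "sec -` V \<inter> topspace (subtopology T U) = U \<inter> {p \<in> fst d. snd d p \<in> ?S \<inter> (\<lambda>y. (y, sec_coord d y)) -` W}"
    unfolding topspace_U V using d by (auto simp: sec_in_chart bundle_chart_sec charts_at_def)
  then show "openin (subtopology T U) (sec -` V \<inter> topspace (subtopology T U))"
    using openin_chart_preimage[OF manifold d R] by (auto simp: openin_subtopology)
next
  \<comment> \<open>The generating sets must also cover the image of the section; the full chart
    over \<open>c1\<close> does so alone.\<close>
  have "sec p \<in> {z \<in> fst (bc c1). snd (bc c1) z \<in> UNIV}" if "p \<in> U" for p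
    using that U by (auto simp: sec_in_chart)
  moreover have "bc c1 \<in> atl" using c1 by (simp add: bundle_atlas_def)
  ultimately show "sec ` topspace (subtopology T U) \<subseteq> \<Union> {{z \<in> fst c. snd c z \<in> W} | c W. c \<in> atl \<and> open W}"
    unfolding topspace_U using open_UNIV by blast
qed

lemma continuous_map_bundle_fst: "continuous_map (bundle_topology TYPE('k) A :: ('a, 'n, 'm) bundle_point topology) T fst"
  (is "continuous_map ?X T fst")
  unfolding continuous_map_def
proof (intro conjI allI impI)
  have ts: "topspace ?X = (\<Union>c\<in>A. fst (bc c))"
    unfolding bundle_topology_def topology_generated_by_topspace bundle_atlas_def by blast
  show "fst \<in> topspace ?X \<rightarrow> topspace T"
  proof
    fix z assume "z \<in> topspace ?X"
    then obtain c where "c \<in> A" "z \<in> fst (bc c)" unfolding ts by (elim UN_E)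
    moreover from this have "fst z \<in> fst c" using mem_bundle_chart[of "fst z" "snd z" c] by simp
    ultimately show "fst z \<in> topspace T" using smooth_manifold_chart(2)[OF manifold] by blast
  qed
  fix V assume V: "openin T V"
  \<comment> \<open>The preimage of \<open>V\<close> is a union of generating sets, one per chart:
    those whose \<open>W\<close> is the cylinder over the coordinates of \<open>V\<close>.\<close>
  let ?G = "\<lambda>c. {z \<in> fst (bc c). snd (bc c) z \<in> (snd c ` (V \<inter> fst c)) \<times> UNIV}"
  have "{z \<in> topspace ?X. fst z \<in> V} = (\<Union>c\<in>A. ?G c)"
  proof -
    have G: "z \<in> ?G c \<longleftrightarrow> fst z \<in> V" if c: "c \<in> A" and z: "z \<in> fst (bc c)" for c z
    proof -
      have "fst z \<in> fst c" using z mem_bundle_chart[of "fst z" "snd z" c] by simp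
      moreover have "fst (snd (bc c) z) = snd c (fst z)"
        using bundle_chart_apply[of c "fst z" "snd z"] by simp
      ultimately show ?thesis
        using z inj_on_image_mem_iff[OF chart_inj[OF c], of "fst z" "V \<inter> fst c"]
        by (simp add: mem_Times_iff)
    qed
    show ?thesis
    proof (intro equalityI subsetI)
      fix z assume "z \<in> {z \<in> topspace ?X. fst z \<in> V}"
      then obtain c where "c \<in> A" "z \<in> fst (bc c)" "fst z \<in> V" unfolding ts by fast
      then show "z \<in> (\<Union>c\<in>A. ?G c)"
        using G[of c z] by (intro UN_I[of c]) (simp_all only: simp_thms)
    next
      fix z assume "z \<in> (\<Union>c\<in>A. ?G c)"
      then obtain c where c: "c \<in> A" "z \<in> ?G c" by (rule UN_E)
      then have "z \<in> fst (bc c)" by simp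
      moreover from this have "fst z \<in> V" using G c by simp
      ultimately show "z \<in> {z \<in> topspace ?X. fst z \<in> V}" unfolding ts using c(1) by fast
    qed
  qed
  moreover have "openin ?X (?G c)" if "c \<in> A" for c
  proof -
    have "open (snd c ` (V \<inter> fst c))"
      using V smooth_manifold_chart(1)[OF manifold that] by (intro open_chart_imageI[OF manifold that]) auto
    then have "open ((snd c ` (V \<inter> fst c)) \<times> (UNIV :: ('n, 'm, 'k) alt_form set))"
      by (rule open_Times) simp
    then show ?thesis
      unfolding bundle_topology_def bundle_atlas_def using that
      by (intro topology_generated_by_Basis CollectI exI conjI) (rule refl, rule imageI)
  qed
  ultimately show "openin ?X {z \<in> topspace ?X. fst z \<in> V}" by auto
qed

lemma embedding_map_sec: "embedding_map (subtopology T U) (bundle_topology TYPE('k) A) sec"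
  unfolding embedding_map_def homeomorphic_map_maps
proof
  show "homeomorphic_maps (subtopology T U) (subtopology (bundle_topology TYPE('k) A) (sec ` topspace (subtopology T U))) sec fst"
    unfolding homeomorphic_maps_def
  proof (intro conjI ballI)
    show "continuous_map (subtopology T U) (subtopology (bundle_topology TYPE('k) A) (sec ` topspace (subtopology T U))) sec"
      by (simp add: continuous_map_in_subtopology continuous_map_sec)
    show "continuous_map (subtopology (bundle_topology TYPE('k) A) (sec ` topspace (subtopology T U))) (subtopology T U) fst"
      using continuous_map_bundle_fst unfolding topspace_U
      by (auto simp: continuous_map_in_subtopology continuous_map_from_subtopology)
    show "fst (sec p) = p" for p by simp
    show "sec (fst z) = z" if "z \<in> topspace (subtopology (bundle_topology TYPE('k) A) (sec ` topspace (subtopology T U)))" for z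
      using that by auto
  qed
qed

lemma smooth_embedding_sec: "smooth_embedding_on T A U (bundle_topology TYPE('k) A) atl sec"
  unfolding smooth_embedding_on_def smooth_map_on_def
proof (intro conjI ballI)
  show "continuous_map (subtopology T U) (bundle_topology TYPE('k) A) sec" by (rule continuous_map_sec)
  show "embedding_map (subtopology T U) (bundle_topology TYPE('k) A) sec" by (rule embedding_map_sec)
  show "inj_on (pushforward A atl sec p) (tangent_space A p)" if "p \<in> U" for p
    using that by (rule inj_on_pushforward_sec)
  fix c D assume c: "c \<in> A" and "D \<in> atl"
  then obtain d where d: "D = bc d" "d \<in> A" unfolding bundle_atlas_def by blast
  have "{p \<in> U \<inter> fst c. sec p \<in> fst D} = U \<inter> fst c \<inter> fst d"
    using d by (auto simp: sec_in_chart)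
  then show "smooth_on (snd c ` {p \<in> U \<inter> fst c. sec p \<in> fst D}) (coord_map c D sec)"
    using smooth_on_coord_map_sec[OF c d(2)] d(1) by simp
qed

text \<open>The chart chosen at \<open>sec p\<close> is \<open>bc d\<close> for some unknown
  \<open>d\<close>. Linearity of \<Theta> in the fibre turns its derivative along a vector tangent
  to the section into a derivative of \<open>sec_form d\<close>. The sum is the exterior derivative
  of \<theta> pulled back to the chart \<open>d\<close>, and naturality carries it over to
  \<open>c1\<close>.\<close>

lemma ext_deriv_canonical_form_sec:
  assumes p: "p \<in> U" and vs: "length vs = Suc CARD('k)" "set vs \<subseteq> tangent_space A p"
  shows "ext_deriv atl CARD('k) (component i (canonical_form TYPE('k) A)) (sec p) (map (pushforward A atl sec p) vs)
    = flat_ext_deriv CARD('k) (\<lambda>y us. \<theta> y us $ i) (snd c1 p) (map (\<lambda>v. v c1) vs)"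
proof -
  let ?f = "pushforward A atl sec p"
  have c1p: "c1 \<in> charts_at A p" by (rule charts_at_U[OF p])
  have "bc c1 \<in> charts_at atl (sec p)"
    using charts_at_bundle_iff[OF c1, of p "snd (sec p)"] c1p sec_alt[OF p] by (simp add: sec_def)
  then have "chart_at atl (sec p) \<in> charts_at atl (sec p)" by (rule chart_at_in)
  then obtain d where d: "chart_at atl (sec p) = bc d" "d \<in> charts_at A p"
    using charts_at_bundleE unfolding sec_def by metis
  have dA: "d \<in> A" "p \<in> fst d" using d by (auto simp: charts_at_def)
  define y where "y = snd d p"
  define us where "us = map (\<lambda>v. ?f v (bc d)) vs"
  define \<beta> where "\<beta> = (\<lambda>y us. \<theta> y us $ i)"
  let ?\<sigma> = "coord_map d c1 id"
  let ?S = "snd d ` (U \<inter> fst d)"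
  have S: "open ?S" "y \<in> ?S" using open_U_image[OF dA(1,1)] p dA by (auto simp: Int_assoc y_def)
  have vs_in: "vs ! j \<in> tangent_space A p" if "j < length vs" for j
    using vs that nth_mem by blast
  have us: "us = map (\<lambda>v. (v d, frechet_derivative (sec_coord d) (at y) (v d))) vs"
    unfolding us_def y_def using vs(2) pushforward_sec_apply[OF p d(2)] by (auto intro!: map_cong)
  have fst_us: "map fst us = map (\<lambda>v. v d) vs" unfolding us by simp
  have "ext_deriv atl CARD('k) (component i (canonical_form TYPE('k) A)) (sec p) (map ?f vs)
    = flat_ext_deriv CARD('k) (\<lambda>z us. local_rep atl (bc d) (component i (canonical_form TYPE('k) A)) us z)
        (y, sec_coord d y) us"
  proof -
    have "set (map ?f vs) \<subseteq> tangent_space atl (sec p)"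
      using pushforward_in_tangent_space[OF diff_atlas_axioms total.diff_atlas_axioms chart_differentiable_sec[OF p]]
        c1p by auto
    then show ?thesis
      using vs(1) bundle_chart_sec[OF p d(2)]
      by (subst ext_deriv_flat) (auto simp: d(1) us_def o_def y_def)
  qed
  \<comment> \<open>The formula for the representative of \<Theta> is valid over the domain of
    \<open>d\<close> only, an open set around the point.\<close>
  also have "\<dots> = flat_ext_deriv CARD('k) (\<lambda>z us. Rep_alt_form (snd z) (map fst us) $ i) (y, sec_coord d y) us"
    by (rule flat_ext_deriv_cong[of "(snd d ` fst d) \<times> UNIV"])
       (use dA in \<open>auto intro!: open_Times open_chart_image simp: y_def local_rep_canonical_form fun_eq_iff\<close>)
  also have "\<dots> = flat_ext_deriv CARD('k) (flat_pullback ?\<sigma> \<beta>) y (map (\<lambda>v. v d) vs)"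
    unfolding flat_ext_deriv_def
  proof (rule sum.cong[OF refl])
    fix j assume "j \<in> {..CARD('k)}"
    then have j: "j < length vs" using vs(1) by simp
    let ?ws = "delete_nth j (map (\<lambda>v. v d) vs)"
    \<comment> \<open>The function is bounded linear in \<open>z\<close>, hence its own derivative,
      and sees only the fibre component of the direction \<open>us ! j\<close>.\<close>
    have "frechet_derivative (\<lambda>z. Rep_alt_form (snd z) (map fst (delete_nth j us)) $ i) (at (y, sec_coord d y)) (us ! j)
      = Rep_alt_form (snd (us ! j)) (map fst (delete_nth j us)) $ i"
      by (subst frechet_derivative_eqI[OF bounded_linear_imp_has_derivative
          [OF bounded_linear_compose[OF bounded_linear_Rep_alt_form bounded_linear_snd]]]) simp
    also have "\<dots> = Rep_alt_form (frechet_derivative (sec_coord d) (at y) ((vs ! j) d)) ?ws $ i"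
      using j by (simp add: map_delete_nth fst_us) (simp add: us)
    \<comment> \<open>Evaluation on the fixed list \<open>?ws\<close> is bounded linear, so it
      commutes with the derivative of \<open>sec_coord d\<close>.\<close>
    also have "\<dots> = frechet_derivative (\<lambda>y. Rep_alt_form (sec_coord d y) ?ws $ i) (at y) ((vs ! j) d)"
      using frechet_derivative_eqI[OF bounded_linear.has_derivative
          [OF bounded_linear_Rep_alt_form sec_coord_has_derivative[OF p d(2)]], of ?ws i]
      by (simp add: y_def)
    also have "frechet_derivative (\<lambda>y. Rep_alt_form (sec_coord d y) ?ws $ i) (at y)
       = frechet_derivative (\<lambda>y. flat_pullback ?\<sigma> \<beta> y ?ws) (at y)"
      by (rule frechet_derivative_cong_open[OF S])
         (use dA in \<open>auto simp: Rep_sec_coord charts_at_def sec_form_def flat_pullback_def \<beta>_def\<close>)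
    finally show "(- 1) ^ j * frechet_derivative (\<lambda>z. Rep_alt_form (snd z) (map fst (delete_nth j us)) $ i)
        (at (y, sec_coord d y)) (us ! j)
      = (- 1) ^ j * frechet_derivative (\<lambda>y. flat_pullback ?\<sigma> \<beta> y ?ws) (at y) (map (\<lambda>v. v d) vs ! j)"
      using j by simp
  qed
  also have "\<dots> = flat_ext_deriv CARD('k) \<beta> (?\<sigma> y) (map (frechet_derivative ?\<sigma> (at y)) (map (\<lambda>v. v d) vs))"
  proof (rule flat_ext_deriv_pullback[OF S])
    have "smooth_on ?S ?\<sigma>"
      by (rule smooth_on_subset[OF smooth_transition[OF manifold dA(1) c1]]) (use U in auto)
    then show "Ck_on 2 ?\<sigma> ?S" unfolding smooth_on_def by blast
    show "open (snd c1 ` U)" using open_chart_imageI[OF manifold c1 U] .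
    show in1: "?\<sigma> y \<in> snd c1 ` U" using p dA by (simp add: y_def coord_map_chart)
    show "\<beta> z \<in> alt_maps CARD('k) UNIV" if "z \<in> snd c1 ` U" for z
      unfolding \<beta>_def by (rule alt_maps_component[OF \<theta>_alt[OF that]])
    show "(\<lambda>z. \<beta> z ws) differentiable at (?\<sigma> y)" if "length ws = CARD('k)" for ws
      unfolding \<beta>_def by (rule smooth_on_differentiable[OF \<theta>_smooth[OF that] in1])
  qed (use vs in simp)
  also have "?\<sigma> y = snd c1 p" using dA by (simp add: y_def coord_map_chart)
  \<comment> \<open>The coordinates of a tangent vector in \<open>d\<close> and \<open>c1\<close>
    are related by exactly this derivative.\<close>
  also have "map (frechet_derivative ?\<sigma> (at y)) (map (\<lambda>v. v d) vs) = map (\<lambda>v. v c1) vs"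
    using vs(2) tangent_transition[OF _ d(2) c1p] by (auto simp: y_def)
  finally show ?thesis unfolding \<beta>_def .
qed

end

text \<open>\<open>closed_form\<close> tests each point in the chart \<open>chart_at A p\<close>,
  which may change from point to point, while the Poincare lemma needs the same chart throughout a
  ball. The representative in \<open>chart_at A p\<close> is the pullback of the one in
  \<open>c\<close>, so naturality transfers the vanishing.\<close>

lemma closed_form_flat:
  fixes A :: "('a, 'e::euclidean_space) chart set"
  assumes man: "smooth_manifold T A" and form: "diff_form T A k \<alpha>" and closed: "closed_form T A k \<alpha>"
    and c: "c \<in> A" "p \<in> fst c" and us: "length us = Suc k"
  shows "flat_ext_deriv k (\<lambda>y us. local_rep A c \<alpha> us y) (snd c p) us = 0"
proof -
  interpret diff_atlas A by (rule smooth_manifold_diff_atlas[OF man])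
  have cp: "c \<in> charts_at A p" using c by (rule charts_atI)
  define d where "d = chart_at A p"
  have d: "d \<in> charts_at A p" unfolding d_def using cp by (rule chart_at_in)
  have dA: "d \<in> A" "p \<in> fst d" using d by (auto simp: charts_at_def)
  have pT: "p \<in> topspace T" using smooth_manifold_chart(2)[OF man c(1)] c(2) by blast
  let ?\<beta> = "\<lambda>c y us. local_rep A c \<alpha> us y" and ?\<sigma> = "coord_map d c id"
  have rep: "?\<beta> c (snd c q) = form_in_chart A c q (\<alpha> q)" if "c \<in> A" "q \<in> fst c" for c q
    using that by (simp add: local_rep_def chart_inv_chart form_in_chart_def fun_eq_iff)
  \<comment> \<open>The tangent vectors whose coordinates in \<open>c\<close> are \<open>us\<close>,
    so that closedness at \<open>p\<close> can be applied to them.\<close>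
  let ?vs = "map (chart_vec A c p) us"
  have "0 = ext_deriv A k \<alpha> p ?vs"
    using closed pT unfolding closed_form_def by simp
  also have "\<dots> = flat_ext_deriv k (?\<beta> d) (snd d p) (map (\<lambda>v. v d) ?vs)"
    unfolding d_def using us chart_vec_in_tangent_space[OF cp] by (intro ext_deriv_flat) auto
  also have "\<dots> = flat_ext_deriv k (flat_pullback ?\<sigma> (?\<beta> c)) (snd d p) (map (\<lambda>v. v d) ?vs)"
  proof (rule flat_ext_deriv_cong[OF open_overlap[OF dA(1) c(1)]])
    fix z assume "z \<in> snd d ` (fst d \<inter> fst c)"
    then obtain q where q: "z = snd d q" "q \<in> fst d" "q \<in> fst c" by blast
    have cq: "c \<in> charts_at A q" "d \<in> charts_at A q" using q c dA by (auto simp: charts_at_def)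
    show "?\<beta> d z = flat_pullback ?\<sigma> (?\<beta> c) z"
      using q c dA form_in_chart_change[OF cq, of "\<alpha> q"] rep
      by (simp add: fun_eq_iff flat_pullback_def coord_map_chart)
  qed (use dA c in blast)
  also have "\<dots> = flat_ext_deriv k (?\<beta> c) (?\<sigma> (snd d p)) (map (transition_deriv d c p) (map (\<lambda>v. v d) ?vs))"
  proof (rule flat_ext_deriv_pullback[OF open_overlap[OF dA(1) c(1)]])
    show "Ck_on 2 ?\<sigma> (snd d ` (fst d \<inter> fst c))"
      using smooth_transition[OF man dA(1) c(1)] unfolding smooth_on_def by blast
    show "open (snd c ` fst c)" by (rule open_chart_image[OF c(1)])
    show in1: "?\<sigma> (snd d p) \<in> snd c ` fst c" using c dA by (simp add: coord_map_chart)
    show "?\<beta> c z \<in> alt_maps k UNIV" if "z \<in> snd c ` fst c" for z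
    proof -
      obtain q where q: "z = snd c q" "q \<in> fst c" using \<open>z \<in> snd c ` fst c\<close> by blast
      then have "\<alpha> q \<in> alt_maps k (tangent_space A q)"
        using form smooth_manifold_chart(2)[OF man c(1)] unfolding diff_form_def by blast
      from form_in_chart_alt[OF charts_atI[OF c(1) q(2)] this] show ?thesis
        unfolding rep[OF c(1) q(2), symmetric] q(1) .
    qed
    show "(\<lambda>z. ?\<beta> c z ws) differentiable at (?\<sigma> (snd d p))" if "length ws = k" for ws
      using form c(1) that in1 smooth_on_differentiable unfolding diff_form_def by blast
  qed (use dA c us in auto)
  also have "?\<sigma> (snd d p) = snd c p" using dA by (simp add: coord_map_chart)
  also have "map (transition_deriv d c p) (map (\<lambda>v. v d) ?vs) = us"
    using tangent_transition[OF chart_vec_in_tangent_space[OF cp] d cp] chart_vec_self[OF cp]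
    by (simp add: o_def)
  finally show ?thesis by simp
qed

section \<open>The embedding on a coordinate ball\<close>

theorem theorem2p7:
  fixes T :: "'a topology"
    and A :: "('a, real^'n) chart set"
    and \<omega> :: "'a \<Rightarrow> ('a, real^'n) tangent list \<Rightarrow> real^'m"
  assumes "CARD('n) \<ge> 2"
    and "1 \<le> CARD('k::finite)" and "CARD('k) \<le> CARD('n) - 1"
    and "CARD('m) \<ge> 1"
    and "smooth_manifold T A"
    and "plectic_form T A CARD('k) \<omega>"
  shows "\<forall>x\<in>topspace T. \<exists>U (f :: 'a \<Rightarrow> ('a, 'n, 'm) bundle_point).
    openin T U \<and> x \<in> U \<and>
    smooth_embedding_on T A U
      (bundle_topology TYPE('k) A)
      (bundle_atlas TYPE('k) A) f \<and>
    (\<forall>p\<in>U. \<omega> p = pullback_form A (bundle_atlas TYPE('k) A) f (Suc CARD('k))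
                    (canonical_plectic_form TYPE('k) A) p)"
proof
  fix x assume x: "x \<in> topspace T"
  note man = assms(5)
  have form: "diff_form T A (Suc CARD('k)) (component i \<omega>)"
    and closed: "closed_form T A (Suc CARD('k)) (component i \<omega>)" for i
    using assms(6) unfolding plectic_form_def by auto
  interpret diff_atlas A by (rule smooth_manifold_diff_atlas[OF man])
  have "(\<Union>c\<in>A. fst c) = topspace T" using man unfolding smooth_manifold_def by blast
  then obtain c1 where c1: "c1 \<in> A" "x \<in> fst c1" using x by blast
  have "open (snd c1 ` fst c1)" "snd c1 x \<in> snd c1 ` fst c1"
    using open_chart_image[OF c1(1)] c1(2) by auto
  then obtain r where r: "r > 0" "ball (snd c1 x) r \<subseteq> snd c1 ` fst c1"
    using open_contains_ball by metis
  \<comment> \<open>The rays of the Poincare lemma call for a convex domain. As the ball lies inside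
    the chart image, it is exactly the image of \<open>U\<close>.\<close>
  define B where "B = ball (snd c1 x) r"
  define U where "U = {p \<in> fst c1. snd c1 p \<in> B}"
  define W where "W i y us = local_rep A c1 (component i \<omega>) us y" for i y us
  have UB: "snd c1 ` U = B" unfolding U_def using r(2) B_def by auto
  have openU: "openin T U" "U \<subseteq> fst c1" "x \<in> U"
  proof -
    show "openin T U"
      unfolding U_def by (rule openin_chart_preimage[OF man c1(1)]) (simp add: B_def)
  qed (use c1(2) r(1) in \<open>auto simp: U_def B_def\<close>)
  have W: "W i (snd c1 p) = form_in_chart A c1 p (component i \<omega> p)" if "p \<in> fst c1" for i p
    using that c1(1) by (simp add: W_def local_rep_def chart_inv_chart form_in_chart_def fun_eq_iff)
  have \<omega>_alt: "component i \<omega> p \<in> alt_maps (Suc CARD('k)) (tangent_space A p)" if "p \<in> topspace T" for i p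
    using form that unfolding diff_form_def by blast
  have U_top: "U \<subseteq> topspace T" using openU(1) by (rule openin_subset)
  have pU: "\<exists>p\<in>U. y = snd c1 p" if "y \<in> B" for y using UB that by blast
  have B: "open B" "convex B" "snd c1 x \<in> B" using r(1) by (auto simp: B_def)
  \<comment> \<open>The components are integrated separately, giving one primitive for each
    \<open>i\<close>; together they form the \<theta> of the section.\<close>
  have "\<exists>\<theta>. (\<forall>y\<in>B. \<theta> y \<in> alt_maps CARD('k) UNIV) \<and>
      (\<forall>us. length us = CARD('k) \<longrightarrow> smooth_on B (\<lambda>y. \<theta> y us)) \<and>
      (\<forall>y\<in>B. \<forall>us. length us = Suc CARD('k) \<longrightarrow> flat_ext_deriv CARD('k) \<theta> y us = W i y us)" for i
  proof (rule poincare_lemma[OF B, where k = "CARD('k)" and W = "W i"])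
    show "W i y \<in> alt_maps (Suc CARD('k)) UNIV" if "y \<in> B" for y
    proof -
      obtain p where p: "p \<in> U" "y = snd c1 p" using pU[OF \<open>y \<in> B\<close>] by blast
      then have "c1 \<in> charts_at A p" "p \<in> topspace T" "p \<in> fst c1"
        using c1 openU U_top by (auto simp: charts_at_def)
      then show ?thesis unfolding p(2) by (simp add: W form_in_chart_alt \<omega>_alt)
    qed
    show "smooth_on B (\<lambda>y. W i y us)" if "length us = Suc CARD('k)" for us
    proof (rule smooth_on_subset)
      show "smooth_on (snd c1 ` fst c1) (\<lambda>y. W i y us)"
        using form[of i] c1(1) that unfolding diff_form_def W_def by blast
    qed (use r(2) in \<open>simp add: B_def\<close>)
    show "flat_ext_deriv (Suc CARD('k)) (W i) y us = 0" if "y \<in> B" "length us = Suc (Suc CARD('k))" for y us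
    proof -
      obtain p where p: "p \<in> U" "y = snd c1 p" using pU[OF \<open>y \<in> B\<close>] by blast
      then show ?thesis
        using closed_form_flat[OF man form[of i] closed[of i] c1(1) _ that(2), of p] openU
        by (auto simp: W_def[abs_def])
    qed
  qed blast
  then obtain \<theta>' where \<theta>': "\<And>i y. y \<in> B \<Longrightarrow> \<theta>' i y \<in> alt_maps CARD('k) UNIV"
    "\<And>i us. length us = CARD('k) \<Longrightarrow> smooth_on B (\<lambda>y. \<theta>' i y us)"
    "\<And>i y us. y \<in> B \<Longrightarrow> length us = Suc CARD('k) \<Longrightarrow> flat_ext_deriv CARD('k) (\<theta>' i) y us = W i y us"
    by metis
  define \<theta> :: "real^'n \<Rightarrow> (real^'n) list \<Rightarrow> real^'m" where "\<theta> y us = (\<chi> i. \<theta>' i y us)" for y us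
  interpret S: form_section T A "TYPE('k)" "TYPE('m)" c1 U \<theta>
  proof
    show "smooth_manifold T A" by fact
    show "c1 \<in> A" "openin T U" "U \<subseteq> fst c1" by (fact c1 openU)+
    show "\<theta> y \<in> alt_maps CARD('k) UNIV" if "y \<in> snd c1 ` U" for y
      unfolding \<theta>_def[abs_def] using that UB \<theta>'(1) by (intro alt_maps_vec) auto
    show "smooth_on (snd c1 ` U) (\<lambda>y. \<theta> y us $ i)" if "length us = CARD('k)" for us i
      using \<theta>'(2)[OF that] unfolding \<theta>_def UB by simp
  qed
  let ?B = "bundle_atlas TYPE('k) A"
  have "\<omega> p = pullback_form A ?B S.sec (Suc CARD('k)) (canonical_plectic_form TYPE('k) A) p" if p: "p \<in> U" for p
  proof
    fix vs
    have cp: "c1 \<in> charts_at A p" "p \<in> fst c1" "p \<in> topspace T"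
      using p c1 openU U_top by (auto simp: charts_at_def)
    show "\<omega> p vs = pullback_form A ?B S.sec (Suc CARD('k)) (canonical_plectic_form TYPE('k) A) p vs"
    proof (cases "length vs = Suc CARD('k) \<and> set vs \<subseteq> tangent_space A p")
      case True
      \<comment> \<open>Tangent vectors are recovered from their coordinates in \<open>c1\<close>,
        which turns the representative \<open>W i\<close> back into the component of
        \<omega>.\<close>
      have vs_c1: "map (chart_vec A c1 p) (map (\<lambda>v. v c1) vs) = vs"
        unfolding map_map
        by (rule map_idI) (use True in \<open>auto simp: chart_vec_of_tangent[OF _ cp(1)]\<close>)
      show ?thesis
      proof (rule vec_eq_iff[THEN iffD2, rule_format])
        fix i
        have "pullback_form A ?B S.sec (Suc CARD('k)) (canonical_plectic_form TYPE('k) A) p vs $ i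
          = ext_deriv ?B CARD('k) (component i (canonical_form TYPE('k) A)) (S.sec p) (map (pushforward A ?B S.sec p) vs)"
          using True by (simp add: pullback_form_def restr_def canonical_plectic_form_def vec_ext_deriv_def)
        also have "\<dots> = flat_ext_deriv CARD('k) (\<theta>' i) (snd c1 p) (map (\<lambda>v. v c1) vs)"
          using S.ext_deriv_canonical_form_sec[OF p, of vs i] True by (simp add: \<theta>_def)
        also have "\<dots> = W i (snd c1 p) (map (\<lambda>v. v c1) vs)"
          using True UB p by (intro \<theta>'(3)) auto
        also have "\<dots> = \<omega> p vs $ i"
          unfolding W[OF cp(2)] form_in_chart_def vs_c1 component_def ..
        finally show "\<omega> p vs $ i
          = pullback_form A ?B S.sec (Suc CARD('k)) (canonical_plectic_form TYPE('k) A) p vs $ i" ..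
      qed
    next
      case False
      \<comment> \<open>The claim is an equality of functions on all lists. On lists of the wrong
        length or with entries that are not tangent at \<open>p\<close>, both sides are 0 by
        convention.\<close>
      have "component i \<omega> p vs = 0" for i by (rule alt_maps_outside[OF \<omega>_alt[OF cp(3)] False])
      then have "\<omega> p vs = 0" by (simp add: component_def vec_eq_iff)
      then show ?thesis using False by (auto simp: pullback_form_def restr_def)
    qed
  qed
  then show "\<exists>U (f :: 'a \<Rightarrow> ('a, 'n, 'm) bundle_point). openin T U \<and> x \<in> U \<and>
    smooth_embedding_on T A U (bundle_topology TYPE('k) A) ?B f \<and>
    (\<forall>p\<in>U. \<omega> p = pullback_form A ?B f (Suc CARD('k)) (canonical_plectic_form TYPE('k) A) p)"
    using openU S.smooth_embedding_sec by blast
qed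

end
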